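(* Let $(M,g)$ be a Riemannian manifold of dimension $n\ge 2$, let $\rho$ be an MPSH function on $M$, and let $u: \mathbb{D} \to M$ be a conformal harmonic immersed disc such that $\rho \circ u \ge 0$ on $\mathbb{D}$ and $(\rho \circ u)(\zeta) \to 0$ as $\zeta \in \mathbb{D}$ tends to an open arc $\gamma \subset b\mathbb{D}$. Assume that for a certain point $a \in \gamma$ the cluster set $C(u,a)$ contains a point $p \in M$ such that $\rho$ is strictly MPSH near $p$. Then $u$ extends to a neighborhood of $a$ in $\mathbb{D} \cup \gamma$ as a Hölder $1/2$-continuous map.
   Context: All manifolds and metrics are $C^\infty$. $\mathbb{D}$ is the open unit disc in $\mathbb{R}^2\cong\mathbb{C}$ with the standard metric $ds^2$, and $b\mathbb{D}$ is its boundary. A map $u:\mathbb{D}\to(M,g)$ is harmonic if it is a critical point of the energy $\int_{\mathbb{D}}|du|^2\,dm$ (such maps are smooth); a smooth map is conformal if $u^*g=e^{\phi}ds^2$ for some smooth function $\phi$. A conformal harmonic immersed disc is a conformal harmonic immersion $u:\mathbb{D}\to M$. MPSH: an upper semicontinuous function $\rho: V\to[-\infty,+\infty)$ on an open set $V\subset M$ is minimal plurisubharmonic (MPSH) if $\rho\circ u$ is subharmonic on $\mathbb{D}$ for every conformal harmonic immersed disc $u:\mathbb{D}\to V$. A function $\rho$ is strictly MPSH on $V$ if for every point $p\in V$ there exist local normal coordinates $x$ centered at $p$ and $\varepsilon>0$ such that $\rho-\varepsilon|x|^2$ is MPSH in a neighborhood of $p$. The cluster set $C(u,a)$ is the set of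 all limits in $M$ of sequences $u(\zeta_k)$ with $\zeta_k\in\mathbb{D}$, $\zeta_k\to a$. *)

theory Defs
  imports "HOL-Analysis.Analysis"
begin

section \<open>Smooth maps between open subsets of Euclidean spaces\<close>

text \<open>\<open>Ck_on k f S\<close> says that \<open>f\<close> is of class \<open>C\<^sup>k\<close> on \<open>S\<close>; it is meant for open \<open>S\<close>.\<close>

primrec Ck_on ::
  "nat \<Rightarrow> ('a::euclidean_space \<Rightarrow> 'b::real_normed_vector) \<Rightarrow> 'a set \<Rightarrow> bool" where
  "Ck_on 0 f S \<longleftrightarrow> continuous_on S f"
| "Ck_on (Suc k) f S \<longleftrightarrow>
     (\<forall>x\<in>S. f differentiable (at x)) \<and> (\<forall>v. Ck_on k (\<lambda>x. frechet_derivative f (at x) v) S)"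

definition smooth_on :: "('a::euclidean_space \<Rightarrow> 'b::real_normed_vector) \<Rightarrow> 'a set \<Rightarrow> bool" where
  "smooth_on f S \<longleftrightarrow> (\<forall>k. Ck_on k f S)"


section \<open>Riemannian manifolds\<close>

text \<open>The manifold is the whole type \<open>'m\<close>, with its type-class topology; the dimension is
  \<open>CARD('n)\<close>. A chart is a pair of its domain and its coordinate map (whose values outside the
  domain are irrelevant).\<close>

type_synonym ('m, 'n) chart = "'m set \<times> ('m \<Rightarrow> real ^ 'n)"

abbreviation cdom :: "('m, 'n) chart \<Rightarrow> 'm set" where "cdom \<equiv> fst"
abbreviation cmap :: "('m, 'n) chart \<Rightarrow> 'm \<Rightarrow> real ^ 'n" where "cmap \<equiv> snd"
abbreviation cimage :: "('m, 'n) chart \<Rightarrow> (real ^ 'n) set" where "cimage c \<equiv> cmap c ` cdom c"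

definition cinv :: "('m, 'n) chart \<Rightarrow> real ^ 'n \<Rightarrow> 'm" where
  "cinv c = inv_into (cdom c) (cmap c)"

definition is_chart :: "('m::topological_space, 'n::finite) chart \<Rightarrow> bool" where
  "is_chart c \<longleftrightarrow>
     open (cdom c) \<and> open (cimage c) \<and> homeomorphism (cdom c) (cimage c) (cmap c) (cinv c)"

definition transition :: "('m, 'n) chart \<Rightarrow> ('m, 'n) chart \<Rightarrow> real ^ 'n \<Rightarrow> real ^ 'n" where
  "transition c d = cmap d \<circ> cinv c"

abbreviation overlap :: "('m, 'n) chart \<Rightarrow> ('m, 'n) chart \<Rightarrow> (real ^ 'n) set" where
  "overlap c d \<equiv> cmap c ` (cdom c \<inter> cdom d)"

definition smooth_atlas :: "('m::topological_space, 'n::finite) chart set \<Rightarrow> bool" where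
  "smooth_atlas A \<longleftrightarrow>
     (\<forall>c\<in>A. is_chart c) \<and> (\<Union>c\<in>A. cdom c) = UNIV \<and>
     (\<forall>c\<in>A. \<forall>d\<in>A. smooth_on (transition c d) (overlap c d))"

text \<open>\<open>gram M c x $ i $ j\<close> is the component \<open>g\<^sub>i\<^sub>j(x)\<close> of the metric in the chart \<open>c\<close> at the
  coordinate point \<open>x\<close>. Tangent vectors at a point are represented by their components in a
  chart around it.\<close>

record ('m, 'n) riemannian =
  charts :: "('m, 'n) chart set"
  gram :: "('m, 'n) chart \<Rightarrow> real ^ 'n \<Rightarrow> real ^ 'n ^ 'n"

definition ginner ::
  "('m, 'n::finite) riemannian \<Rightarrow> ('m, 'n) chart \<Rightarrow> real ^ 'n \<Rightarrow> real ^ 'n \<Rightarrow> real ^ 'n \<Rightarrow> real" where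
  "ginner M c x v w = v \<bullet> (gram M c x *v w)"

definition riemannian_manifold ::
  "('m::{t2_space, second_countable_topology}, 'n::finite) riemannian \<Rightarrow> bool" where
  "riemannian_manifold M \<longleftrightarrow>
     smooth_atlas (charts M) \<and>
     (\<forall>c\<in>charts M.
        smooth_on (gram M c) (cimage c) \<and>
        (\<forall>x\<in>cimage c. transpose (gram M c x) = gram M c x \<and>
                      (\<forall>v. v \<noteq> 0 \<longrightarrow> ginner M c x v v > 0))) \<and>
     (\<forall>c\<in>charts M. \<forall>d\<in>charts M. \<forall>x\<in>overlap c d. \<forall>v w.
        ginner M c x v w =
        ginner M d (transition c d x)
          (frechet_derivative (transition c d) (at x) v)
          (frechet_derivative (transition c d) (at x) w))"


section \<open>Smooth maps into a Riemannian manifold\<close>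

definition smooth_map ::
  "('m::topological_space, 'n::finite) riemannian \<Rightarrow> 'e::euclidean_space set \<Rightarrow> ('e \<Rightarrow> 'm) \<Rightarrow> bool"
  where
  "smooth_map M S f \<longleftrightarrow>
     continuous_on S f \<and> (\<forall>c\<in>charts M. smooth_on (cmap c \<circ> f) (S \<inter> f -` cdom c))"

definition chart_at :: "('m, 'n::finite) riemannian \<Rightarrow> 'm \<Rightarrow> ('m, 'n) chart" where
  "chart_at M p = (SOME c. c \<in> charts M \<and> p \<in> cdom c)"

text \<open>\<open>pullback M f x v w\<close> is \<open>(f\<^sup>*g)\<^sub>x(v, w)\<close>. By the transformation law for the metric the value
  does not depend on the chart chosen around \<open>f x\<close>.\<close>

definition pullback ::
  "('m, 'n::finite) riemannian \<Rightarrow> ('e::euclidean_space \<Rightarrow> 'm) \<Rightarrow> 'e \<Rightarrow> 'e \<Rightarrow> 'e \<Rightarrow> real" where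
  "pullback M f x v w =
     (let c = chart_at M (f x); D = frechet_derivative (cmap c \<circ> f) (at x)
      in ginner M c (cmap c (f x)) (D v) (D w))"

definition immersion ::
  "('m::topological_space, 'n::finite) riemannian \<Rightarrow> 'e::euclidean_space set \<Rightarrow> ('e \<Rightarrow> 'm) \<Rightarrow> bool"
  where
  "immersion M S f \<longleftrightarrow>
     smooth_map M S f \<and>
     (\<forall>x\<in>S. \<forall>c\<in>charts M. f x \<in> cdom c \<longrightarrow> inj (frechet_derivative (cmap c \<circ> f) (at x)))"


section \<open>Conformal harmonic discs\<close>

abbreviation unit_disc :: "complex set" where "unit_disc \<equiv> ball 0 1"

definition conformal ::
  "('m::topological_space, 'n::finite) riemannian \<Rightarrow> (complex \<Rightarrow> 'm) \<Rightarrow> bool" where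
  "conformal M u \<longleftrightarrow>
     smooth_map M unit_disc u \<and>
     (\<exists>\<phi>::complex \<Rightarrow> real. smooth_on \<phi> unit_disc \<and>
        (\<forall>\<zeta>\<in>unit_disc. \<forall>v w. pullback M u \<zeta> v w = exp (\<phi> \<zeta>) * (v \<bullet> w)))"

definition energy ::
  "('m, 'n::finite) riemannian \<Rightarrow> complex set \<Rightarrow> (complex \<Rightarrow> 'm) \<Rightarrow> real" where
  "energy M K u = (LINT \<zeta>:K|lborel. (\<Sum>b\<in>Basis. pullback M u \<zeta> b b))"

text \<open>Critical points of the energy. The energy over the whole open disc may be infinite, so, as
  usual, the first variation is taken over the compact set \<open>K\<close> outside of which the smooth
  variation \<open>F\<close> of \<open>u\<close> is constant in \<open>t\<close>.\<close>

definition harmonic ::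
  "('m::topological_space, 'n::finite) riemannian \<Rightarrow> (complex \<Rightarrow> 'm) \<Rightarrow> bool" where
  "harmonic M u \<longleftrightarrow>
     smooth_map M unit_disc u \<and>
     (\<forall>(F :: real \<times> complex \<Rightarrow> 'm) \<epsilon> K.
        \<epsilon> > 0 \<and> compact K \<and> K \<subseteq> unit_disc \<and>
        smooth_map M ({-\<epsilon><..<\<epsilon>} \<times> unit_disc) F \<and>
        (\<forall>\<zeta>\<in>unit_disc. F (0, \<zeta>) = u \<zeta>) \<and>
        (\<forall>t\<in>{-\<epsilon><..<\<epsilon>}. \<forall>\<zeta>\<in>unit_disc - K. F (t, \<zeta>) = u \<zeta>)
        \<longrightarrow> ((\<lambda>t. energy M K (\<lambda>\<zeta>. F (t, \<zeta>))) has_real_derivative 0) (at 0))"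

definition conformal_harmonic_immersed_disc ::
  "('m::topological_space, 'n::finite) riemannian \<Rightarrow> (complex \<Rightarrow> 'm) \<Rightarrow> bool" where
  "conformal_harmonic_immersed_disc M u \<longleftrightarrow>
     conformal M u \<and> harmonic M u \<and> immersion M unit_disc u"


section \<open>Geodesics, the exponential map and normal coordinates\<close>

text \<open>\<open>christoffel M c x k i j\<close> is
  \<open>\<Gamma>\<^sup>k\<^sub>i\<^sub>j = (1/2) \<Sum>\<^sub>l g\<^sup>k\<^sup>l (\<partial>\<^sub>i g\<^sub>j\<^sub>l + \<partial>\<^sub>j g\<^sub>i\<^sub>l - \<partial>\<^sub>l g\<^sub>i\<^sub>j)\<close> at \<open>x\<close> in the chart \<open>c\<close>.\<close>

definition gram_partial ::
  "('m, 'n::finite) riemannian \<Rightarrow> ('m, 'n) chart \<Rightarrow> real ^ 'n \<Rightarrow> 'n \<Rightarrow> 'n \<Rightarrow> 'n \<Rightarrow> real" where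
  "gram_partial M c x i j l = frechet_derivative (gram M c) (at x) (axis i 1) $ j $ l"

definition christoffel ::
  "('m, 'n::finite) riemannian \<Rightarrow> ('m, 'n) chart \<Rightarrow> real ^ 'n \<Rightarrow> 'n \<Rightarrow> 'n \<Rightarrow> 'n \<Rightarrow> real" where
  "christoffel M c x k i j =
     (1/2) * (\<Sum>l\<in>UNIV. matrix_inv (gram M c x) $ k $ l *
        (gram_partial M c x i j l + gram_partial M c x j i l - gram_partial M c x l i j))"

definition geodesic ::
  "('m::topological_space, 'n::finite) riemannian \<Rightarrow> real set \<Rightarrow> (real \<Rightarrow> 'm) \<Rightarrow> bool" where
  "geodesic M T \<gamma> \<longleftrightarrow>
     smooth_map M T \<gamma> \<and>
     (\<forall>c\<in>charts M. \<forall>t\<in>T. \<gamma> t \<in> cdom c \<longrightarrow>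
        (let y = cmap c \<circ> \<gamma>; y' = (\<lambda>s. vector_derivative y (at s)) in
         \<forall>k. vector_derivative y' (at t) $ k
             + (\<Sum>i\<in>UNIV. \<Sum>j\<in>UNIV. christoffel M c (y t) k i j * y' t $ i * y' t $ j) = 0))"

text \<open>\<open>is_exp M c p v q\<close> says that \<open>exp\<^sub>p(v)\<close> is defined and equal to \<open>q\<close>, where \<open>v\<close> lists the
  components in the chart \<open>c\<close> of a tangent vector at \<open>p\<close>.\<close>

definition is_exp ::
  "('m::topological_space, 'n::finite) riemannian \<Rightarrow> ('m, 'n) chart \<Rightarrow> 'm \<Rightarrow> real ^ 'n \<Rightarrow> 'm \<Rightarrow> bool"
  where
  "is_exp M c p v q \<longleftrightarrow>
     (\<exists>\<gamma> T. open T \<and> connected T \<and> {0..1} \<subseteq> T \<and> geodesic M T \<gamma> \<and>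
        \<gamma> 0 = p \<and> vector_derivative (cmap c \<circ> \<gamma>) (at 0) = v \<and> \<gamma> 1 = q)"

definition compatible_chart ::
  "('m::topological_space, 'n::finite) riemannian \<Rightarrow> ('m, 'n) chart \<Rightarrow> bool" where
  "compatible_chart M c \<longleftrightarrow>
     is_chart c \<and>
     (\<forall>d\<in>charts M. smooth_on (transition c d) (overlap c d) \<and>
                   smooth_on (transition d c) (overlap d c))"

text \<open>\<open>x\<close> is the inverse of \<open>\<xi> \<mapsto> exp\<^sub>p(\<Sum>\<^sub>i \<xi>\<^sub>i e\<^sub>i)\<close> on a ball, for an orthonormal basis \<open>e\<close> of the
  tangent space at \<open>p\<close>.\<close>

definition normal_coordinates ::
  "('m::topological_space, 'n::finite) riemannian \<Rightarrow> 'm \<Rightarrow> ('m, 'n) chart \<Rightarrow> bool" where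
  "normal_coordinates M p x \<longleftrightarrow>
     compatible_chart M x \<and> p \<in> cdom x \<and> cmap x p = 0 \<and>
     (\<exists>r > 0. cimage x = ball 0 r \<and>
       (\<exists>c\<in>charts M. p \<in> cdom c \<and>
         (\<exists>e :: 'n \<Rightarrow> real ^ 'n.
            (\<forall>i j. ginner M c (cmap c p) (e i) (e j) = (if i = j then 1 else 0)) \<and>
            (\<forall>\<xi>\<in>ball 0 r. is_exp M c p (\<Sum>i\<in>UNIV. (\<xi> $ i) *\<^sub>R e i) (cinv x \<xi>)))))"


section \<open>Subharmonic and minimal plurisubharmonic functions\<close>

definition usc_on :: "'a::topological_space set \<Rightarrow> ('a \<Rightarrow> ereal) \<Rightarrow> bool" where
  "usc_on S f \<longleftrightarrow> (\<forall>c. openin (top_of_set S) {x\<in>S. f x < c})"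

text \<open>The mean over a circle, as the integral of the positive part minus that of the negative part
  (note that \<open>e2ennreal\<close> sends negative numbers to \<open>0\<close>). Only used for functions which are bounded
  above on the circle, where the first integral is finite.\<close>

definition circle_mean :: "(complex \<Rightarrow> ereal) \<Rightarrow> complex \<Rightarrow> real \<Rightarrow> ereal" where
  "circle_mean f a r =
     (enn2ereal (\<integral>\<^sup>+\<theta>\<in>{0..2*pi}. e2ennreal (f (a + of_real r * cis \<theta>)) \<partial>lborel)
      - enn2ereal (\<integral>\<^sup>+\<theta>\<in>{0..2*pi}. e2ennreal (- f (a + of_real r * cis \<theta>)) \<partial>lborel))
     / ereal (2 * pi)"

text \<open>The constant \<open>-\<infinity>\<close> counts as subharmonic.\<close>

definition subharmonic_on :: "complex set \<Rightarrow> (complex \<Rightarrow> ereal) \<Rightarrow> bool" where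
  "subharmonic_on \<Omega> f \<longleftrightarrow>
     (\<forall>z\<in>\<Omega>. f z \<noteq> \<infinity>) \<and> usc_on \<Omega> f \<and>
     (\<forall>a r. r > 0 \<and> cball a r \<subseteq> \<Omega> \<longrightarrow> f a \<le> circle_mean f a r)"

definition MPSH ::
  "('m::topological_space, 'n::finite) riemannian \<Rightarrow> 'm set \<Rightarrow> ('m \<Rightarrow> ereal) \<Rightarrow> bool" where
  "MPSH M V \<rho> \<longleftrightarrow>
     open V \<and> (\<forall>q\<in>V. \<rho> q \<noteq> \<infinity>) \<and> usc_on V \<rho> \<and>
     (\<forall>u. conformal_harmonic_immersed_disc M u \<and> u ` unit_disc \<subseteq> V
          \<longrightarrow> subharmonic_on unit_disc (\<rho> \<circ> u))"

definition strictly_MPSH ::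
  "('m::topological_space, 'n::finite) riemannian \<Rightarrow> 'm set \<Rightarrow> ('m \<Rightarrow> ereal) \<Rightarrow> bool" where
  "strictly_MPSH M V \<rho> \<longleftrightarrow>
     open V \<and>
     (\<forall>p\<in>V. \<exists>x \<epsilon> W. normal_coordinates M p x \<and> \<epsilon> > 0 \<and>
        open W \<and> p \<in> W \<and> W \<subseteq> V \<inter> cdom x \<and>
        MPSH M W (\<lambda>q. \<rho> q - ereal (\<epsilon> * (norm (cmap x q))\<^sup>2)))"


section \<open>Boundary behaviour\<close>

definition open_arc :: "complex set \<Rightarrow> bool" where
  "open_arc \<gamma> \<longleftrightarrow> (\<exists>\<alpha> \<beta>. \<alpha> < \<beta> \<and> \<beta> \<le> \<alpha> + 2 * pi \<and> \<gamma> = cis ` {\<alpha><..<\<beta>})"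

definition cluster_set :: "(complex \<Rightarrow> 'm::topological_space) \<Rightarrow> complex \<Rightarrow> 'm set" where
  "cluster_set u a =
     {p. \<exists>z :: nat \<Rightarrow> complex. (\<forall>k. z k \<in> unit_disc) \<and> z \<longlonglongrightarrow> a \<and> (\<lambda>k. u (z k)) \<longlonglongrightarrow> p}"

text \<open>Length of a curve and Riemannian distance (\<open>\<infinity>\<close> between different components). The curves
  are continuous and smooth off a finite set, in the style of \<open>piecewise_C1_differentiable_on\<close>.\<close>

definition curve_length ::
  "('m, 'n::finite) riemannian \<Rightarrow> (real \<Rightarrow> 'm) \<Rightarrow> ennreal" where
  "curve_length M c = (\<integral>\<^sup>+t\<in>{0<..<1}. ennreal (sqrt (pullback M c t 1 1)) \<partial>lborel)"

definition rdist ::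
  "('m::topological_space, 'n::finite) riemannian \<Rightarrow> 'm \<Rightarrow> 'm \<Rightarrow> ennreal" where
  "rdist M p q =
     (INF c \<in> {c. continuous_on {0..1} c \<and> (\<exists>S. finite S \<and> smooth_map M ({0<..<1} - S) c) \<and>
                  c 0 = p \<and> c 1 = q}.
        curve_length M c)"

definition holder_continuous_on ::
  "('m::topological_space, 'n::finite) riemannian \<Rightarrow> real \<Rightarrow> complex set \<Rightarrow> (complex \<Rightarrow> 'm) \<Rightarrow> bool"
  where
  "holder_continuous_on M \<alpha> N f \<longleftrightarrow>
     (\<exists>C\<ge>0. \<forall>z\<in>N. \<forall>w\<in>N. rdist M (f z) (f w) \<le> ennreal (C * dist z w powr \<alpha>))"

end

theory Submission
  imports Defs
begin

text \<open>Put \<open>w = \<rho> \<circ> u\<close>, a nonnegative subharmonic function on the disc which tends to \<open>0\<close> at the arc.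
Everything rests on the maximum principle, for functions with the sub-mean value property on small
circles, and on the Euler-Lagrange equation of the energy.

Near \<open>a\<close>, comparison with the affine function \<open>1 - Re (\<zeta> \<cdot> cnj b)\<close>, for boundary points \<open>b\<close>, gives
\<open>w \<zeta> \<le> C (1 - \<bar>\<zeta>\<bar>)\<close> (\<open>boundary_decay\<close>).

In a chart around \<open>p\<close> write \<open>y\<close> for the coordinates of \<open>u\<close>. Criticality of \<open>u\<close> for the energy yields
\<open>\<bar>\<Delta>y\<bar> \<le> C \<bar>\<nabla>y\<bar>\<^sup>2\<close>, and this is used only through its consequence for circle averages
(\<open>nearly_harmonic\<close>): the average of a linear function of \<open>y\<close> differs from its central value by at
most \<open>C\<close> times the average of \<open>\<bar>y - y z\<bar>\<^sup>2\<close>. Hence every function of \<open>y\<close> which is bounded below by a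
quadratic polynomial with a dominating square term is almost subharmonic. Strictness of \<open>\<rho>\<close> at \<open>p\<close>
supplies such a square term: for \<open>A\<close> large, \<open>A w - \<beta>\<close> is almost subharmonic for every
semiconcave \<open>\<beta>\<close> of \<open>y\<close> with controlled constants (\<open>almost_submean_of_strict_domination\<close>). That \<open>w\<close>
has the sub-mean value property, and that \<open>w - \<epsilon> \<bar>x \<circ> u\<bar>\<^sup>2\<close> has it where \<open>u\<close> is near \<open>p\<close>, follows by
restricting \<open>u\<close> to small round discs, on which it is again a conformal harmonic immersed disc.

The heart of the argument is a reflection. Let \<open>z1\<close>, \<open>z2\<close> lie symmetrically to a line through the
centre of a disc of radius \<open>R\<close>, at distance at most \<open>R / 2\<close> from each other, let the disc be one on which \<open>0 \<le> w \<le> \<eta>\<close>, and let \<open>z'\<close> be the mirror image of \<open>z\<close>. The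
function \<open>A w z - \<bar>Y z - Y z1\<bar>\<^sup>2 + A w z' - \<bar>Y z' - Y z2\<bar>\<^sup>2\<close> is almost subharmonic on the half disc, at
most \<open>2 A \<eta>\<close> everywhere and at most \<open>2 A \<eta> - \<bar>Y z1 - Y z2\<bar>\<^sup>2 / 2\<close> on the line, but nonnegative at \<open>z1\<close>.
Comparison with a harmonic quadratic polynomial gives \<open>\<bar>Y z1 - Y z2\<bar>\<^sup>2 \<le> 8 A \<eta>\<close> (\<open>coupling_estimate\<close>).
With \<open>\<eta>\<close> of the size of the distance \<open>\<delta>\<close> to the circle this reads \<open>\<bar>Y z1 - Y z2\<bar> \<le> C \<surd>\<delta>\<close> whenever
\<open>\<bar>z1 - z2\<bar>\<close> is at most a fixed fraction of \<open>\<delta>\<close>. Chaining such steps (\<open>hardy_littlewood_chain\<close>) gives a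
Hoelder estimate at all scales larger than the distance to the circle (\<open>coarse_holder\<close>).

For \<open>Y\<close> one first takes the truncation \<open>max 0 (s\<^sup>2 - \<bar>y - yp\<bar>\<^sup>2)\<close>, where \<open>yp\<close> are the
coordinates of \<open>p\<close>, extended by \<open>0\<close> to the whole disc. As \<open>p\<close> is a cluster value at \<open>a\<close>, the coarse estimate forces \<open>u\<close> to stay in the chart near \<open>a\<close>. Then
one takes \<open>Y = y\<close>. At scales smaller than the distance to the circle, the same reflection with \<open>w\<close>
replaced by \<open>\<bar>y - y z1\<bar>\<^sup>2\<close> shows that the oscillation of \<open>y\<close> drops by the factor \<open>8\<close> when the radius drops
by the factor \<open>64\<close> (\<open>nearly_harmonic_holder_half\<close>). Together this is the Hoelder estimate with
exponent \<open>1/2\<close> for \<open>y\<close>; it extends to the closure by continuity, and straight segments in the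
chart bound the Riemannian distance.\<close>

section \<open>Calculus of maps of class \<open>C\<^sup>k\<close>\<close>

lemma frechet_derivative_eqI:
  "(f has_derivative D) (at x) \<Longrightarrow> frechet_derivative f (at x) = D"
  by (rule frechet_derivative_at[symmetric])

lemma has_derivative_frechet:
  "f differentiable (at x) \<Longrightarrow> (f has_derivative frechet_derivative f (at x)) (at x)"
  by (simp add: frechet_derivative_works)

lemma frechet_derivative_cong_open:
  assumes "open S" "x \<in> S" "\<And>y. y \<in> S \<Longrightarrow> f y = g y"
  shows "frechet_derivative f (at x) = frechet_derivative g (at x)"
proof -
  have "(f has_derivative D) (at x) \<longleftrightarrow> (g has_derivative D) (at x)" for D
    using has_derivative_transform_within_open[of f D x UNIV S g]
      has_derivative_transform_within_open[of g D x UNIV S f] assms by auto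
  then show ?thesis unfolding frechet_derivative_def by simp
qed

lemma differentiable_cong_open:
  assumes "open S" "x \<in> S" "\<And>y. y \<in> S \<Longrightarrow> f y = g y" "f differentiable (at x)"
  shows "g differentiable (at x)"
  using has_derivative_transform_within_open[of f _ x UNIV S g] assms
  unfolding differentiable_def by blast

lemma Ck_on_Suc_has_derivative:
  "Ck_on (Suc k) f S \<Longrightarrow> x \<in> S \<Longrightarrow> (f has_derivative frechet_derivative f (at x)) (at x)"
  by (rule has_derivative_frechet) simp

lemma Ck_on_cong:
  assumes "open S" "\<And>x. x \<in> S \<Longrightarrow> f x = g x" "Ck_on k f S"
  shows "Ck_on k g S"
  using assms(2,3)
proof (induction k arbitrary: f g)
  case 0
  then show ?case using continuous_on_cong[of S S f g] by simp
next
  case (Suc k)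
  have "g differentiable (at x)" if "x \<in> S" for x
    using differentiable_cong_open[OF assms(1) that Suc.prems(1)] Suc.prems(2) that by auto
  moreover have "Ck_on k (\<lambda>x. frechet_derivative g (at x) v) S" for v
    by (rule Suc.IH[of "\<lambda>x. frechet_derivative f (at x) v"])
       (use Suc.prems frechet_derivative_cong_open[OF assms(1) _ Suc.prems(1)] in auto)
  ultimately show ?case by simp
qed

lemma Ck_on_subset:
  assumes "Ck_on k f T" "S \<subseteq> T"
  shows "Ck_on k f S"
  using assms(1)
proof (induction k arbitrary: f)
  case 0
  then show ?case using assms(2) continuous_on_subset by auto
next
  case (Suc k)
  then show ?case using assms(2) by auto
qed

lemma Ck_on_imp_continuous_on:
  assumes "Ck_on k f S"
  shows "continuous_on S f"
  using assms
  by (cases k) (auto intro!: continuous_at_imp_continuous_on differentiable_imp_continuous_within)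

lemma Ck_on_SucD:
  assumes "Ck_on (Suc k) f S"
  shows "Ck_on k f S"
  using assms
proof (induction k arbitrary: f)
  case 0
  then show ?case using Ck_on_imp_continuous_on[of "Suc 0"] by simp
next
  case (Suc k)
  have "\<forall>x\<in>S. f differentiable (at x)" using Suc.prems by simp
  moreover have "Ck_on k (\<lambda>x. frechet_derivative f (at x) v) S" for v
    by (rule Suc.IH) (use Suc.prems in simp)
  ultimately show ?case by simp
qed

text \<open>Class \<open>C\<^sup>k\<close> is a local property, which is what gluing maps along open covers requires.\<close>

lemma Ck_on_local:
  assumes "\<And>x. x \<in> S \<Longrightarrow> \<exists>T. open T \<and> x \<in> T \<and> Ck_on k f T"
  shows "Ck_on k f S"
  using assms
proof (induction k arbitrary: f)
  case 0
  have "continuous (at x within S) f" if "x \<in> S" for x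
    using 0[OF that]
    by (metis Ck_on.simps(1) continuous_at_imp_continuous_at_within continuous_on_eq_continuous_at)
  then show ?case by (simp add: continuous_on_eq_continuous_within)
next
  case (Suc k)
  have "f differentiable (at x)" if "x \<in> S" for x
    using Suc.prems[OF that] by auto
  moreover have "Ck_on k (\<lambda>x. frechet_derivative f (at x) v) S" for v
    by (rule Suc.IH) (use Suc.prems in fastforce)
  ultimately show ?case by simp
qed

lemma Ck_on_const: "Ck_on k (\<lambda>x. c) S"
  by (induction k arbitrary: c) auto

lemma Ck_on_bounded_linear:
  assumes "bounded_linear L"
  shows "Ck_on k L S"
proof (cases k)
  case 0
  then show ?thesis using assms by (auto intro: linear_continuous_on)
next
  case (Suc j)
  have "frechet_derivative L (at x) = L" for x
    by (rule frechet_derivative_eqI) (rule bounded_linear_imp_has_derivative[OF assms])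
  then show ?thesis using Suc assms
    by (auto intro: Ck_on_const bounded_linear_imp_differentiable)
qed

lemma Ck_on_bounded_linear_compose:
  assumes L: "bounded_linear L" and "open S" and "Ck_on k f S"
  shows "Ck_on k (\<lambda>x. L (f x)) S"
  using assms(3)
proof (induction k arbitrary: f)
  case 0
  then show ?case using bounded_linear.continuous_on[OF L] by simp
next
  case (Suc k)
  have D: "((\<lambda>x. L (f x)) has_derivative (\<lambda>v. L (frechet_derivative f (at x) v))) (at x)"
    if "x \<in> S" for x
    by (rule bounded_linear.has_derivative[OF L Ck_on_Suc_has_derivative[OF Suc.prems that]])
  have "Ck_on k (\<lambda>x. frechet_derivative (\<lambda>x. L (f x)) (at x) v) S" for v
    by (rule Ck_on_cong[OF \<open>open S\<close> _ Suc.IH[of "\<lambda>x. frechet_derivative f (at x) v"]])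
       (use Suc.prems frechet_derivative_eqI[OF D] in auto)
  then show ?case using D by (auto simp: differentiable_def)
qed

lemma Ck_on_add:
  assumes "open S" and "Ck_on k f S" "Ck_on k g S"
  shows "Ck_on k (\<lambda>x. f x + g x) S"
  using assms(2,3)
proof (induction k arbitrary: f g)
  case 0
  then show ?case by (auto intro: continuous_on_add)
next
  case (Suc k)
  have D: "((\<lambda>x. f x + g x) has_derivative
      (\<lambda>v. frechet_derivative f (at x) v + frechet_derivative g (at x) v)) (at x)"
    if "x \<in> S" for x
    by (rule has_derivative_add[OF Ck_on_Suc_has_derivative[OF Suc.prems(1) that]
          Ck_on_Suc_has_derivative[OF Suc.prems(2) that]])
  have "Ck_on k (\<lambda>x. frechet_derivative (\<lambda>x. f x + g x) (at x) v) S" for v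
    by (rule Ck_on_cong[OF \<open>open S\<close> _ Suc.IH[of "\<lambda>x. frechet_derivative f (at x) v"
          "\<lambda>x. frechet_derivative g (at x) v"]])
       (use Suc.prems frechet_derivative_eqI[OF D] in auto)
  then show ?case using D by (auto simp: differentiable_def)
qed

lemma Ck_on_sum:
  assumes "open S" "finite I" "\<And>i. i \<in> I \<Longrightarrow> Ck_on k (f i) S"
  shows "Ck_on k (\<lambda>x. \<Sum>i\<in>I. f i x) S"
  using assms(2,3)
  by (induction I) (auto intro!: Ck_on_const Ck_on_add[OF \<open>open S\<close>])

lemma Ck_on_bilinear:
  assumes B: "bounded_bilinear B" and "open S" and "Ck_on k f S" "Ck_on k g S"
  shows "Ck_on k (\<lambda>x. B (f x) (g x)) S"
  using assms(3,4)
proof (induction k arbitrary: f g)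
  case 0
  then show ?case using bounded_bilinear.continuous_on[OF B] by simp
next
  case (Suc k)
  have D: "((\<lambda>x. B (f x) (g x)) has_derivative
      (\<lambda>v. B (f x) (frechet_derivative g (at x) v) + B (frechet_derivative f (at x) v) (g x))) (at x)"
    if "x \<in> S" for x
    by (rule bounded_bilinear.FDERIV[OF B Ck_on_Suc_has_derivative[OF Suc.prems(1) that]
          Ck_on_Suc_has_derivative[OF Suc.prems(2) that]])
  have "Ck_on k (\<lambda>x. frechet_derivative (\<lambda>x. B (f x) (g x)) (at x) v) S" for v
    by (rule Ck_on_cong[OF \<open>open S\<close> _ Ck_on_add[OF \<open>open S\<close>
        Suc.IH[of f "\<lambda>x. frechet_derivative g (at x) v"]
        Suc.IH[of "\<lambda>x. frechet_derivative f (at x) v" g]]])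
       (use Suc.prems frechet_derivative_eqI[OF D] in \<open>auto intro: Ck_on_SucD\<close>)
  then show ?case using D by (auto simp: differentiable_def)
qed

lemma linear_sum_Basis:
  fixes x :: "'a::euclidean_space"
  assumes "linear D"
  shows "D x = (\<Sum>b\<in>Basis. (x \<bullet> b) *\<^sub>R D b)"
proof -
  have "D x = D (\<Sum>b\<in>Basis. (x \<bullet> b) *\<^sub>R b)" by (simp add: euclidean_representation)
  also have "\<dots> = (\<Sum>b\<in>Basis. (x \<bullet> b) *\<^sub>R D b)"
    using assms by (simp add: linear_sum linear_cmul)
  finally show ?thesis .
qed

lemma frechet_derivative_sum_Basis:
  fixes f :: "'a::euclidean_space \<Rightarrow> 'b::real_normed_vector"
  assumes "f differentiable (at x)"
  shows "frechet_derivative f (at x) v = (\<Sum>b\<in>Basis. (v \<bullet> b) *\<^sub>R frechet_derivative f (at x) b)"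
  by (rule linear_sum_Basis) (use assms linear_frechet_derivative in auto)

text \<open>The derivative of a composition is expanded over a basis, since the induction on \<open>k\<close> needs it as
a sum of products of functions that are already known to be of class \<open>C\<^sup>k\<close>.\<close>

lemma Ck_on_compose:
  fixes f :: "'a::euclidean_space \<Rightarrow> 'b::euclidean_space"
    and g :: "'b \<Rightarrow> 'c::real_normed_vector"
  assumes "open S" "open T" "f ` S \<subseteq> T" "Ck_on k f S" "Ck_on k g T"
  shows "Ck_on k (\<lambda>x. g (f x)) S"
  using assms(4,5)
proof (induction k arbitrary: g)
  case 0
  then show ?case using assms(3) continuous_on_compose2 by auto
next
  case (Suc k)
  have fk: "Ck_on k f S" using Suc.prems Ck_on_SucD by blast
  have D: "((\<lambda>x. g (f x)) has_derivative
      (\<lambda>v. \<Sum>b\<in>Basis. (frechet_derivative f (at x) v \<bullet> b) *\<^sub>R frechet_derivative g (at (f x)) b)) (at x)"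
    if "x \<in> S" for x
  proof -
    have fx: "f x \<in> T" using that assms(3) by auto
    have "((\<lambda>x. g (f x)) has_derivative
        (\<lambda>v. frechet_derivative g (at (f x)) (frechet_derivative f (at x) v))) (at x)"
      by (rule has_derivative_compose[OF Ck_on_Suc_has_derivative[OF Suc.prems(1) that]
            Ck_on_Suc_has_derivative[OF Suc.prems(2) fx]])
    moreover have "g differentiable (at (f x))" using Suc.prems fx by simp
    ultimately show ?thesis
      by (simp add: frechet_derivative_sum_Basis[of g "f x", symmetric])
  qed
  have "Ck_on k (\<lambda>x. \<Sum>b\<in>Basis. (frechet_derivative f (at x) v \<bullet> b) *\<^sub>R frechet_derivative g (at (f x)) b) S" for v
  proof (rule Ck_on_sum[OF \<open>open S\<close> finite_Basis])
    fix b :: 'b assume "b \<in> Basis"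
    have "Ck_on k (\<lambda>x. frechet_derivative f (at x) v \<bullet> b) S"
      by (rule Ck_on_bounded_linear_compose[OF bounded_linear_inner_left \<open>open S\<close>])
         (use Suc.prems in auto)
    moreover have "Ck_on k (\<lambda>x. frechet_derivative g (at (f x)) b) S"
      by (rule Suc.IH[OF fk]) (use Suc.prems in auto)
    ultimately show "Ck_on k (\<lambda>x. (frechet_derivative f (at x) v \<bullet> b) *\<^sub>R frechet_derivative g (at (f x)) b) S"
      by (rule Ck_on_bilinear[OF bounded_bilinear_scaleR \<open>open S\<close>])
  qed
  then have "Ck_on k (\<lambda>x. frechet_derivative (\<lambda>x. g (f x)) (at x) v) S" for v
    by (rule Ck_on_cong[OF \<open>open S\<close>, rotated])
       (use frechet_derivative_eqI[OF D] in auto)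
  then show ?case using D by (auto simp: differentiable_def)
qed

lemma smooth_on_cong:
  "open S \<Longrightarrow> (\<And>x. x \<in> S \<Longrightarrow> f x = g x) \<Longrightarrow> smooth_on f S \<Longrightarrow> smooth_on g S"
  unfolding smooth_on_def using Ck_on_cong by blast

lemma smooth_on_subset: "smooth_on f T \<Longrightarrow> S \<subseteq> T \<Longrightarrow> smooth_on f S"
  unfolding smooth_on_def using Ck_on_subset by blast

lemma smooth_on_local:
  "(\<And>x. x \<in> S \<Longrightarrow> \<exists>T. open T \<and> x \<in> T \<and> smooth_on f T) \<Longrightarrow> smooth_on f S"
  unfolding smooth_on_def using Ck_on_local by meson

lemma smooth_on_const: "smooth_on (\<lambda>x. c) S"
  unfolding smooth_on_def using Ck_on_const by blast

lemma smooth_on_bounded_linear: "bounded_linear L \<Longrightarrow> smooth_on L S"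
  unfolding smooth_on_def using Ck_on_bounded_linear by blast

lemma smooth_on_bounded_linear_compose:
  "bounded_linear L \<Longrightarrow> open S \<Longrightarrow> smooth_on f S \<Longrightarrow> smooth_on (\<lambda>x. L (f x)) S"
  unfolding smooth_on_def using Ck_on_bounded_linear_compose by blast

lemma smooth_on_add:
  "open S \<Longrightarrow> smooth_on f S \<Longrightarrow> smooth_on g S \<Longrightarrow> smooth_on (\<lambda>x. f x + g x) S"
  unfolding smooth_on_def using Ck_on_add by blast

lemma smooth_on_bilinear:
  "bounded_bilinear B \<Longrightarrow> open S \<Longrightarrow> smooth_on f S \<Longrightarrow> smooth_on g S
    \<Longrightarrow> smooth_on (\<lambda>x. B (f x) (g x)) S"
  unfolding smooth_on_def using Ck_on_bilinear by blast

lemma smooth_on_compose: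
  fixes f :: "'a::euclidean_space \<Rightarrow> 'b::euclidean_space"
  shows "open S \<Longrightarrow> open T \<Longrightarrow> f ` S \<subseteq> T \<Longrightarrow> smooth_on f S \<Longrightarrow> smooth_on g T
    \<Longrightarrow> smooth_on (\<lambda>x. g (f x)) S"
  unfolding smooth_on_def using Ck_on_compose by blast

lemma smooth_on_differentiable: "smooth_on f S \<Longrightarrow> x \<in> S \<Longrightarrow> f differentiable (at x)"
  unfolding smooth_on_def by (metis Ck_on.simps(2))

lemma smooth_on_frechet_derivative:
  "smooth_on f S \<Longrightarrow> smooth_on (\<lambda>x. frechet_derivative f (at x) v) S"
  unfolding smooth_on_def by (metis Ck_on.simps(2))

lemma smooth_on_imp_continuous_on: "smooth_on f S \<Longrightarrow> continuous_on S f"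
  unfolding smooth_on_def using Ck_on_imp_continuous_on by blast

section \<open>A smooth bump function\<close>

text \<open>The powers of \<open>1/t\<close> are included because these functions are closed, up to linear
combinations, under differentiation; smoothness of \<open>exp (- 1/t)\<close> is then an induction.\<close>

definition flat_fun :: "nat \<Rightarrow> real \<Rightarrow> real" where
  "flat_fun k t = (if t > 0 then exp (- (1 / t)) / t ^ k else 0)"

lemma flat_fun_tendsto_0: "(flat_fun k \<longlongrightarrow> 0) (at 0)"
proof -
  have "((\<lambda>t. (1/t) ^ k / exp (1/t)) \<longlongrightarrow> 0) (at_right (0::real))"
    using filterlim_compose[OF tendsto_power_div_exp_0[of k] filterlim_inverse_at_top_right]
    by (simp add: inverse_eq_divide)
  moreover have "eventually (\<lambda>t. flat_fun k t = (1/t) ^ k / exp (1/t)) (at_right (0::real))"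
    by (auto simp: flat_fun_def eventually_at_filter exp_minus power_divide field_simps)
  ultimately have "(flat_fun k \<longlongrightarrow> 0) (at_right 0)"
    by (subst tendsto_cong)
  moreover have "(flat_fun k \<longlongrightarrow> 0) (at_left 0)"
    by (rule tendsto_eventually) (auto simp: flat_fun_def eventually_at_filter)
  ultimately show ?thesis by (simp add: filterlim_at_split)
qed

lemma flat_fun_has_derivative:
  "(flat_fun k has_field_derivative (flat_fun (k + 2) t - real k * flat_fun (k + 1) t)) (at t)"
proof -
  consider "t > 0" | "t < 0" | "t = 0" by linarith
  then show ?thesis
  proof cases
    case 1
    have "((\<lambda>t. exp (- (1 / t)) / t ^ k) has_field_derivative
        (flat_fun (k + 2) t - real k * flat_fun (k + 1) t)) (at t)"
    proof (cases k)
      case 0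
      then show ?thesis using 1
        by (auto intro!: derivative_eq_intros simp: flat_fun_def power2_eq_square)
    next
      case (Suc j)
      have p: "((\<lambda>t. t ^ Suc j) has_field_derivative real (Suc j) * t ^ j) (at t)"
        using DERIV_pow[of "Suc j" t] by simp
      have e: "((\<lambda>t. exp (- (1 / t))) has_field_derivative exp (- (1 / t)) / t\<^sup>2) (at t)"
        using 1 by (auto intro!: derivative_eq_intros simp: power2_eq_square)
      have "((\<lambda>t. exp (- (1 / t)) / t ^ Suc j) has_field_derivative
          (exp (- (1 / t)) / t\<^sup>2 * t ^ Suc j - exp (- (1 / t)) * (real (Suc j) * t ^ j))
            / (t ^ Suc j * t ^ Suc j)) (at t)"
        using 1 by (intro DERIV_divide[OF e p]) simp
      moreover have "(E / t\<^sup>2 * (t * P) - E * (real (Suc j) * P)) / (t * P * (t * P))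
          = E / (P * t * t * t) - real (Suc j) * (E / (P * t * t))" if "P \<noteq> 0" for E P :: real
        using 1 that by (simp add: divide_simps power2_eq_square) (simp add: algebra_simps)
      from this[of "t ^ j" "exp (- (1 / t))"]
      have "(exp (- (1 / t)) / t\<^sup>2 * t ^ Suc j - exp (- (1 / t)) * (real (Suc j) * t ^ j))
            / (t ^ Suc j * t ^ Suc j) = flat_fun (Suc j + 2) t - real (Suc j) * flat_fun (Suc j + 1) t"
        using 1 by (simp add: flat_fun_def mult_ac)
      ultimately show ?thesis unfolding Suc by simp
    qed
    then show ?thesis
      by (rule has_field_derivative_transform_within_open[of _ _ _ "{0<..}"]) (use 1 in \<open>auto simp: flat_fun_def\<close>)
  next
    case 2
    have "((\<lambda>t. 0) has_field_derivative (flat_fun (k + 2) t - real k * flat_fun (k + 1) t)) (at t)"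
      using 2 by (simp add: flat_fun_def)
    then show ?thesis
      by (rule has_field_derivative_transform_within_open[of _ _ _ "{..<0}"]) (use 2 in \<open>auto simp: flat_fun_def\<close>)
  next
    case 3
    have "((\<lambda>h. flat_fun (k + 1) h) \<longlongrightarrow> 0) (at 0)" by (rule flat_fun_tendsto_0)
    moreover have "eventually (\<lambda>h. flat_fun (k + 1) h = (flat_fun k (0 + h) - flat_fun k 0) / h) (at 0)"
      by (auto simp: flat_fun_def eventually_at_filter)
    ultimately have "(\<lambda>h. (flat_fun k (0 + h) - flat_fun k 0) / h) \<midarrow>0\<rightarrow> 0"
      by (rule Lim_transform_eventually)
    then show ?thesis using 3 by (simp add: DERIV_def flat_fun_def)
  qed
qed

lemma smooth_on_flat_fun: "smooth_on (flat_fun k) S"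
proof -
  have "Ck_on n (flat_fun k) UNIV" for n
  proof (induction n arbitrary: k)
    case 0
    show ?case
      using flat_fun_has_derivative by (auto intro!: DERIV_continuous_on)
  next
    case (Suc n)
    have D: "(flat_fun k has_derivative
       (\<lambda>v. v *\<^sub>R (flat_fun (k + 2) t + (- real k) *\<^sub>R flat_fun (k + 1) t))) (at t)" for t
      using flat_fun_has_derivative[of k t]
      by (simp add: has_field_derivative_def mult.commute[of _ "_ - _"] mult_commute_abs)
    have "Ck_on n (\<lambda>t. v *\<^sub>R (flat_fun (k + 2) t + (- real k) *\<^sub>R flat_fun (k + 1) t)) UNIV" for v
      by (intro Ck_on_bounded_linear_compose[OF bounded_linear_scaleR_right] Ck_on_add Suc.IH) auto
    then have "Ck_on n (\<lambda>x. frechet_derivative (flat_fun k) (at x) v) UNIV" for v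
      using frechet_derivative_eqI[OF D] by simp
    then show ?case using D by (auto simp: differentiable_def)
  qed
  then show ?thesis unfolding smooth_on_def using Ck_on_subset by blast
qed

text \<open>The smooth function \<open>exp (- 1 / (r\<^sup>2 - \<bar>x - z\<bar>\<^sup>2))\<close> on the ball, zero outside.\<close>

definition bump :: "'a::euclidean_space \<Rightarrow> real \<Rightarrow> 'a \<Rightarrow> real" where
  "bump z r x = flat_fun 0 (r\<^sup>2 - (norm (x - z))\<^sup>2)"

lemma bump_nonneg: "bump z r x \<ge> 0"
  by (simp add: bump_def flat_fun_def)

lemma bump_center_pos: "r > 0 \<Longrightarrow> bump z r z > 0"
  by (simp add: bump_def flat_fun_def)

lemma bump_outside: "r > 0 \<Longrightarrow> x \<notin> ball z r \<Longrightarrow> bump z r x = 0"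
  using power_mono[of r "norm (x - z)" 2]
  by (auto simp: bump_def flat_fun_def dist_norm norm_minus_commute simp del: power_mono_iff)

lemma flat_fun_0_le_1: "flat_fun 0 t \<le> 1"
  by (simp add: flat_fun_def)

lemma bump_le_1: "bump z r x \<le> 1"
  by (simp add: bump_def flat_fun_0_le_1)

lemma smooth_on_bump: "open S \<Longrightarrow> smooth_on (bump z r) S"
proof -
  assume S: "open S"
  have 1: "smooth_on (\<lambda>x. x + (-z)) S"
    by (intro smooth_on_add smooth_on_const S smooth_on_bounded_linear[OF bounded_linear_ident])
  have "smooth_on (\<lambda>x. r\<^sup>2 + (-1) *\<^sub>R ((x + (-z)) \<bullet> (x + (-z)))) S"
    by (intro smooth_on_add S smooth_on_const smooth_on_bounded_linear_compose[OF bounded_linear_scaleR_right]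
         smooth_on_bilinear[OF bounded_bilinear_inner] 1)
  from smooth_on_compose[OF S open_UNIV _ this smooth_on_flat_fun[of 0 UNIV]]
  show ?thesis unfolding bump_def by (simp add: power2_norm_eq_inner)
qed

section \<open>Charts and smooth maps into a manifold\<close>

lemma is_chart_facts:
  assumes "is_chart c"
  shows "open (cdom c)" "open (cimage c)" "continuous_on (cdom c) (cmap c)"
    "continuous_on (cimage c) (cinv c)"
    "\<And>q. q \<in> cdom c \<Longrightarrow> cinv c (cmap c q) = q"
    "\<And>x. x \<in> cimage c \<Longrightarrow> cmap c (cinv c x) = x"
    "\<And>x. x \<in> cimage c \<Longrightarrow> cinv c x \<in> cdom c"
    "inj_on (cmap c) (cdom c)"
  using assms unfolding is_chart_def homeomorphism_def
  by (auto intro: inj_on_inverseI)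

lemma riemannian_chart:
  assumes "riemannian_manifold M" "c \<in> charts M"
  shows "is_chart c"
  using assms unfolding riemannian_manifold_def smooth_atlas_def by blast

lemma riemannian_chart_exists:
  assumes "riemannian_manifold M"
  shows "\<exists>c\<in>charts M. q \<in> cdom c"
  using assms unfolding riemannian_manifold_def smooth_atlas_def by blast

lemma chart_at:
  assumes "riemannian_manifold M"
  shows "chart_at M q \<in> charts M" "q \<in> cdom (chart_at M q)"
  using someI_ex[of "\<lambda>c. c \<in> charts M \<and> q \<in> cdom c"] riemannian_chart_exists[OF assms, of q]
  unfolding chart_at_def by blast+

lemma open_overlap:
  assumes "is_chart c" "is_chart d"
  shows "open (overlap c d)"
proof -
  have "overlap c d = cimage c \<inter> cinv c -` (cdom c \<inter> cdom d)"
    using is_chart_facts[OF assms(1)] by force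
  moreover have "open (cimage c \<inter> cinv c -` (cdom c \<inter> cdom d))"
    using is_chart_facts[OF assms(1)] is_chart_facts[OF assms(2)]
    by (intro continuous_open_preimage) auto
  ultimately show ?thesis by simp
qed

lemma smooth_map_chart:
  assumes "smooth_map M S f" "c \<in> charts M"
  shows "smooth_on (cmap c \<circ> f) (S \<inter> f -` cdom c)"
  using assms unfolding smooth_map_def by blast

lemma smooth_map_continuous: "smooth_map M S f \<Longrightarrow> continuous_on S f"
  unfolding smooth_map_def by blast

lemma open_chart_preimage:
  assumes "riemannian_manifold M" "c \<in> charts M" "open S" "smooth_map M S f"
  shows "open (S \<inter> f -` cdom c)"
  by (rule continuous_open_preimage[OF smooth_map_continuous[OF assms(4)] assms(3)])
     (use is_chart_facts(1) riemannian_chart assms in blast)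

lemma smooth_map_subset:
  assumes "smooth_map M T f" "S \<subseteq> T"
  shows "smooth_map M S f"
  using assms unfolding smooth_map_def
  by (meson Int_mono continuous_on_subset order_refl smooth_on_subset)

lemma smooth_map_local:
  assumes R: "riemannian_manifold M"
    and loc: "\<And>x. x \<in> S \<Longrightarrow> \<exists>T g. open T \<and> x \<in> T \<and> smooth_map M T g \<and> (\<forall>y\<in>T. f y = g y)"
  shows "smooth_map M S f"
  unfolding smooth_map_def
proof (intro conjI ballI)
  have "continuous (at x within S) f" if x: "x \<in> S" for x
  proof -
    obtain T g where T: "open T" "x \<in> T" "smooth_map M T g" "\<forall>y\<in>T. f y = g y"
      using loc[OF x] by blast
    have "continuous_on T f"
      using smooth_map_continuous[OF T(3)] T(4) by (metis continuous_on_cong)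
    then show ?thesis
      using T by (meson continuous_at_imp_continuous_at_within continuous_on_eq_continuous_at)
  qed
  then show "continuous_on S f" by (simp add: continuous_on_eq_continuous_within)
next
  fix c assume c: "c \<in> charts M"
  show "smooth_on (cmap c \<circ> f) (S \<inter> f -` cdom c)"
  proof (rule smooth_on_local)
    fix x assume x: "x \<in> S \<inter> f -` cdom c"
    then obtain T g where T: "open T" "x \<in> T" "smooth_map M T g" "\<forall>y\<in>T. f y = g y"
      using loc[of x] by blast
    let ?T = "T \<inter> g -` cdom c"
    have o: "open ?T" by (rule open_chart_preimage[OF R c T(1) T(3)])
    have "smooth_on (cmap c \<circ> f) ?T"
      by (rule smooth_on_cong[OF o _ smooth_map_chart[OF T(3) c]]) (use T(4) in auto)
    then show "\<exists>T. open T \<and> x \<in> T \<and> smooth_on (cmap c \<circ> f) T"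
      using o x T by (intro exI[of _ ?T]) auto
  qed
qed

text \<open>Only precompositions with maps between Euclidean spaces occur: reparametrisations of discs and
families written as \<open>cinv c\<close> after a map into the chart image.\<close>

lemma smooth_map_compose:
  fixes g :: "'a::euclidean_space \<Rightarrow> 'b::euclidean_space"
  assumes R: "riemannian_manifold M" and f: "smooth_map M T f"
    and g: "smooth_on g S" "g ` S \<subseteq> T" and o: "open S" "open T"
  shows "smooth_map M S (\<lambda>x. f (g x))"
  unfolding smooth_map_def
proof (intro conjI ballI)
  show "continuous_on S (\<lambda>x. f (g x))"
    by (rule continuous_on_compose2[OF smooth_map_continuous[OF f] smooth_on_imp_continuous_on[OF g(1)] g(2)])
next
  fix c assume c: "c \<in> charts M"
  have oT: "open (T \<inter> f -` cdom c)" by (rule open_chart_preimage[OF R c o(2) f])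
  have oS: "open (S \<inter> g -` (T \<inter> f -` cdom c))"
    by (rule continuous_open_preimage[OF smooth_on_imp_continuous_on[OF g(1)] o(1) oT])
  have eq: "S \<inter> g -` (T \<inter> f -` cdom c) = S \<inter> (\<lambda>x. f (g x)) -` cdom c"
    using g(2) by auto
  have "smooth_on (\<lambda>x. (cmap c \<circ> f) (g x)) (S \<inter> g -` (T \<inter> f -` cdom c))"
    by (rule smooth_on_compose[OF oS oT _ _ smooth_map_chart[OF f c]])
       (use smooth_on_subset[OF g(1)] in auto)
  then show "smooth_on (cmap c \<circ> (\<lambda>x. f (g x))) (S \<inter> (\<lambda>x. f (g x)) -` cdom c)"
    unfolding eq by (simp add: o_def)
qed

lemma smooth_map_cinv:
  assumes R: "riemannian_manifold M" and c: "c \<in> charts M"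
  shows "smooth_map M (cimage c) (cinv c)"
  unfolding smooth_map_def
proof (intro conjI ballI)
  note ch = is_chart_facts[OF riemannian_chart[OF R c]]
  show "continuous_on (cimage c) (cinv c)" by (rule ch)
  fix d assume d: "d \<in> charts M"
  have "cimage c \<inter> cinv c -` cdom d = overlap c d"
    using ch by force
  moreover have "smooth_on (transition c d) (overlap c d)"
    using R c d unfolding riemannian_manifold_def smooth_atlas_def by blast
  ultimately show "smooth_on (cmap d \<circ> cinv c) (cimage c \<inter> cinv c -` cdom d)"
    by (simp add: transition_def)
qed

section \<open>The pulled back metric\<close>

lemma pullback_cong_open:
  fixes M :: "('m, 'n::finite) riemannian"
  assumes "open S" "x \<in> S" "\<And>y. y \<in> S \<Longrightarrow> f y = g y"
  shows "pullback M f x v w = pullback M g x v w"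
proof -
  have "frechet_derivative (cmap c \<circ> f) (at x) = frechet_derivative (cmap c \<circ> g) (at x)"
    for c :: "('m, 'n) chart"
    by (rule frechet_derivative_cong_open[OF assms(1,2)]) (use assms(3) in auto)
  then show ?thesis using assms unfolding pullback_def by (simp add: Let_def)
qed

text \<open>The pulled back metric is defined with an arbitrarily chosen chart around the image point. The
transformation law of the metric and the chain rule move the computation to any given chart.\<close>

lemma pullback_in_chart:
  assumes R: "riemannian_manifold M" and c: "c \<in> charts M" and fx: "f x \<in> cdom c"
    and S: "open S" "x \<in> S" and f: "smooth_map M S f"
  shows "pullback M f x v w = ginner M c (cmap c (f x))
     (frechet_derivative (cmap c \<circ> f) (at x) v) (frechet_derivative (cmap c \<circ> f) (at x) w)"
proof -
  define d where "d = chart_at M (f x)"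
  have d: "d \<in> charts M" "f x \<in> cdom d" unfolding d_def by (rule chart_at[OF R])+
  note chc = is_chart_facts[OF riemannian_chart[OF R c]]
  note chd = is_chart_facts[OF riemannian_chart[OF R d(1)]]
  let ?z = "cmap c (f x)" and ?D = "frechet_derivative (cmap c \<circ> f) (at x)"
  let ?E = "frechet_derivative (transition c d) (at ?z)"
  have z: "?z \<in> overlap c d" using fx d by auto
  have law: "ginner M c ?z v w = ginner M d (transition c d ?z) (?E v) (?E w)" for v w
    using R c d z unfolding riemannian_manifold_def by blast
  have D: "((cmap c \<circ> f) has_derivative ?D) (at x)"
    by (rule has_derivative_frechet[OF smooth_on_differentiable[OF smooth_map_chart[OF f c]]])
       (use S fx in auto)
  have "smooth_on (transition c d) (overlap c d)"
    using R c d unfolding riemannian_manifold_def smooth_atlas_def by blast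
  then have "(transition c d has_derivative ?E) (at ?z)"
    using has_derivative_frechet smooth_on_differentiable z by blast
  then have "((transition c d \<circ> (cmap c \<circ> f)) has_derivative (?E \<circ> ?D)) (at x)"
    using diff_chain_at[OF D] by simp
  moreover have "open (S \<inter> f -` cdom c)" by (rule open_chart_preimage[OF R c S(1) f])
  ultimately have "((cmap d \<circ> f) has_derivative (?E \<circ> ?D)) (at x)"
    by (rule has_derivative_transform_within_open) (use S fx chc in \<open>auto simp: transition_def\<close>)
  then have "frechet_derivative (cmap d \<circ> f) (at x) = ?E \<circ> ?D"
    by (rule frechet_derivative_eqI)
  moreover have "transition c d ?z = cmap d (f x)" using chc fx by (simp add: transition_def)
  ultimately show ?thesis
    unfolding pullback_def Let_def d_def[symmetric] law by simp
qed

lemma pullback_affine: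
  fixes f :: "'e::euclidean_space \<Rightarrow> 'm::{t2_space,second_countable_topology}"
  assumes R: "riemannian_manifold M" and T: "open T" "z + r *\<^sub>R x \<in> T" and f: "smooth_map M T f"
  shows "pullback M (\<lambda>x. f (z + r *\<^sub>R x)) x v w = r\<^sup>2 * pullback M f (z + r *\<^sub>R x) v w"
proof -
  let ?A = "\<lambda>x. z + r *\<^sub>R x"
  define c where "c = chart_at M (f (?A x))"
  have c: "c \<in> charts M" "f (?A x) \<in> cdom c" unfolding c_def by (rule chart_at[OF R])+
  let ?D = "frechet_derivative (cmap c \<circ> f) (at (?A x))"
  have D: "((cmap c \<circ> f) has_derivative ?D) (at (?A x))"
    by (rule has_derivative_frechet[OF smooth_on_differentiable[OF smooth_map_chart[OF f c(1)]]])
       (use T c in auto)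
  have lin: "linear ?D" using D has_derivative_linear by blast
  have "(?A has_derivative (\<lambda>v. r *\<^sub>R v)) (at x)"
    by (auto intro!: derivative_eq_intros)
  from diff_chain_at[OF this D]
  have "((cmap c \<circ> (\<lambda>x. f (?A x))) has_derivative (\<lambda>v. ?D (r *\<^sub>R v))) (at x)"
    by (simp add: o_def)
  from frechet_derivative_eqI[OF this]
  have "frechet_derivative (cmap c \<circ> (\<lambda>x. f (?A x))) (at x) = (\<lambda>v. r *\<^sub>R ?D v)"
    using linear_cmul[OF lin] by auto
  then show ?thesis
    unfolding pullback_def Let_def c_def[symmetric]
    by (simp add: ginner_def matrix_vector_mult_scaleR power2_eq_square)
qed

section \<open>Restriction of conformal harmonic discs to round subdiscs\<close>

text \<open>If \<open>g\<close> is not measurable, neither is its composition with the affine bijection, and both integrals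
have the value \<open>0\<close>; so the formula applies to every integrand of the energy.\<close>

lemma lborel_integral_affine:
  fixes g :: "'e::euclidean_space \<Rightarrow> real"
  assumes r: "r \<noteq> 0"
  shows "(LINT z|lborel. g z) = \<bar>r\<bar> ^ DIM('e) * (LINT x|lborel. g (z0 + r *\<^sub>R x))"
proof (cases "g \<in> borel_measurable borel")
  case True
  have "(LINT z|lborel. g z) =
      integral\<^sup>L (density (distr lborel borel (\<lambda>x. z0 + r *\<^sub>R x)) (\<lambda>_. \<bar>r\<bar> ^ DIM('e))) g"
    using lborel_affine[OF r, of z0] by simp
  also have "\<dots> = (LINT z|distr lborel borel (\<lambda>x. z0 + r *\<^sub>R x). \<bar>r\<bar> ^ DIM('e) *\<^sub>R g z)"
    using True by (intro integral_density) auto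
  also have "\<dots> = (LINT x|lborel. \<bar>r\<bar> ^ DIM('e) *\<^sub>R g (z0 + r *\<^sub>R x))"
    using True by (intro integral_distr) auto
  finally show ?thesis by simp
next
  case False
  have "(\<lambda>x. g (z0 + r *\<^sub>R x)) \<notin> borel_measurable borel"
  proof
    assume m: "(\<lambda>x. g (z0 + r *\<^sub>R x)) \<in> borel_measurable borel"
    have "(\<lambda>z. (\<lambda>x. g (z0 + r *\<^sub>R x)) ((1 / r) *\<^sub>R (z - z0))) \<in> borel_measurable borel"
      by (rule measurable_compose[OF _ m]) simp
    then show False using False r by simp
  qed
  then have "\<not> integrable lborel (\<lambda>x. g (z0 + r *\<^sub>R x))" "\<not> integrable lborel g"
    using False borel_measurable_integrable by fastforce+
  then show ?thesis by (simp add: not_integrable_integral_eq)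
qed

text \<open>In two dimensions the energy is invariant under similarities: the factor \<open>r\<^sup>2\<close> from the two
derivatives cancels the Jacobian.\<close>

lemma energy_affine:
  fixes f h :: "complex \<Rightarrow> 'm::{t2_space,second_countable_topology}"
  assumes R: "riemannian_manifold M" and r: "r > 0"
    and T: "open T" "smooth_map M T f" and S: "open S" "K \<subseteq> S"
    and A: "\<And>x. x \<in> S \<Longrightarrow> z + r *\<^sub>R x \<in> T" and h: "\<And>x. x \<in> S \<Longrightarrow> h x = f (z + r *\<^sub>R x)"
  shows "energy M ((\<lambda>x. z + r *\<^sub>R x) ` K) f = energy M K h"
proof -
  let ?A = "\<lambda>x. z + r *\<^sub>R x"
  have pb: "pullback M h x b b = r\<^sup>2 * pullback M f (?A x) b b" if x: "x \<in> S" for x b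
    using pullback_cong_open[OF S(1) x h, where M=M and v=b and w=b] pullback_affine[OF R T(1) A[OF x] T(2)] by simp
  have ind: "indicator (?A ` K) (?A x) = (indicator K x :: real)" for x
    using r by (auto simp: indicator_def)
  have "energy M (?A ` K) f = (LINT y|lborel. indicator (?A ` K) y *\<^sub>R (\<Sum>b\<in>Basis. pullback M f y b b))"
    by (simp add: energy_def set_lebesgue_integral_def)
  also have "\<dots> = r\<^sup>2 * (LINT x|lborel. indicator K x *\<^sub>R (\<Sum>b\<in>Basis. pullback M f (?A x) b b))"
    using r by (subst lborel_integral_affine[where r=r and ?z0.0=z]) (simp_all add: ind)
  also have "\<dots> = (LINT x|lborel. indicator K x *\<^sub>R (r\<^sup>2 * (\<Sum>b\<in>Basis. pullback M f (?A x) b b)))"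
    by (simp flip: integral_mult_right_zero add: mult.left_commute)
  also have "\<dots> = (LINT x|lborel. indicator K x *\<^sub>R (\<Sum>b\<in>Basis. pullback M h x b b))"
  proof (rule Bochner_Integration.integral_cong[OF refl])
    fix x
    show "indicator K x *\<^sub>R (r\<^sup>2 * (\<Sum>b\<in>Basis. pullback M f (?A x) b b))
        = indicator K x *\<^sub>R (\<Sum>b\<in>Basis. pullback M h x b b)"
      using pb S(2) by (auto simp: indicator_def sum_distrib_left)
  qed
  finally show ?thesis by (simp add: energy_def set_lebesgue_integral_def)
qed

lemma smooth_map_snd:
  assumes R: "riemannian_manifold M" and "open (I::real set)" "open D" "smooth_map M D u"
  shows "smooth_map M (I \<times> D) (\<lambda>p. u (snd p))"
  by (rule smooth_map_compose[OF R assms(4)])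
     (use assms in \<open>auto intro!: smooth_on_bounded_linear bounded_linear_snd open_Times\<close>)

text \<open>A variation supported in a compact part of a subdisc extends by the original map, because both
definitions agree off the compact set.\<close>

lemma smooth_map_glue:
  fixes u :: "complex \<Rightarrow> 'm::{t2_space,second_countable_topology}"
  assumes R: "riemannian_manifold M" and I: "open (I::real set)" and D: "open D" "smooth_map M D u"
    and B: "open B" "B \<subseteq> D" and K: "compact K" "K \<subseteq> B" and F: "smooth_map M (I \<times> B) F"
    and eq: "\<And>t x. t \<in> I \<Longrightarrow> x \<in> B - K \<Longrightarrow> F (t, x) = u x"
  shows "smooth_map M (I \<times> D) (\<lambda>p. if snd p \<in> B then F p else u (snd p))"
proof (rule smooth_map_local[OF R])
  fix p assume p: "p \<in> I \<times> D"
  show "\<exists>T g. open T \<and> p \<in> T \<and> smooth_map M T g \<and>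
      (\<forall>y\<in>T. (if snd y \<in> B then F y else u (snd y)) = g y)"
  proof (cases "snd p \<in> B")
    case True
    then show ?thesis using p I B(1) F
      by (intro exI[of _ "I \<times> B"] exI[of _ F]) (auto intro: open_Times)
  next
    case False
    have o: "open (D - K)" using D(1) K(1) by (simp add: compact_imp_closed open_Diff)
    have "smooth_map M (I \<times> (D - K)) (\<lambda>p. u (snd p))"
      by (rule smooth_map_snd[OF R I o smooth_map_subset[OF D(2)]]) auto
    then show ?thesis using p False K(2) I o eq
      by (intro exI[of _ "I \<times> (D - K)"] exI[of _ "\<lambda>p. u (snd p)"]) (auto intro!: open_Times)
  qed
qed

lemma smooth_on_affine:
  "open S \<Longrightarrow> smooth_on (\<lambda>x. z + r *\<^sub>R x) S"
  by (intro smooth_on_add smooth_on_const smooth_on_bounded_linear bounded_linear_scaleR_right)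

text \<open>For harmonicity, a variation of the restricted disc is transported to a variation of the whole
disc, constant in the parameter off the smaller disc; by conformal invariance both have the same energy.\<close>

lemma conformal_harmonic_immersed_disc_affine:
  fixes u :: "complex \<Rightarrow> 'm::{t2_space,second_countable_topology}"
    and M :: "('m, 'n::finite) riemannian"
  assumes R: "riemannian_manifold M" and u: "conformal_harmonic_immersed_disc M u"
    and r: "r > 0" and B: "ball z r \<subseteq> unit_disc"
  shows "conformal_harmonic_immersed_disc M (\<lambda>x. u (z + r *\<^sub>R x))"
proof -
  let ?A = "\<lambda>x. z + r *\<^sub>R x"
  have conf: "conformal M u" and harm: "harmonic M u" and imm: "immersion M unit_disc u"
    using u unfolding conformal_harmonic_immersed_disc_def by auto
  have su: "smooth_map M unit_disc u" using conf unfolding conformal_def by blast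
  have AB: "?A x \<in> ball z r" if "x \<in> unit_disc" for x
    using that r by (simp add: dist_norm)
  then have A: "?A x \<in> unit_disc" if "x \<in> unit_disc" for x using B that by blast
  have su': "smooth_map M unit_disc (\<lambda>x. u (?A x))"
    by (rule smooth_map_compose[OF R su smooth_on_affine]) (use A in auto)
  obtain \<phi> :: "complex \<Rightarrow> real" where \<phi>: "smooth_on \<phi> unit_disc"
    "\<forall>\<zeta>\<in>unit_disc. \<forall>v w. pullback M u \<zeta> v w = exp (\<phi> \<zeta>) * (v \<bullet> w)"
    using conf unfolding conformal_def by blast
  have "conformal M (\<lambda>x. u (?A x))"
    unfolding conformal_def
  proof (intro conjI su' exI[of _ "\<lambda>x. \<phi> (?A x) + 2 * ln r"] ballI allI)
    show "smooth_on (\<lambda>x. \<phi> (?A x) + 2 * ln r) unit_disc"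
      by (intro smooth_on_add smooth_on_const smooth_on_compose[OF _ _ _ smooth_on_affine \<phi>(1)])
         (use A in auto)
    fix \<zeta> v w assume \<zeta>: "\<zeta> \<in> unit_disc"
    have "exp (2 * ln r) = r\<^sup>2"
      using r by (simp add: exp_double)
    then show "pullback M (\<lambda>x. u (?A x)) \<zeta> v w = exp (\<phi> (?A \<zeta>) + 2 * ln r) * (v \<bullet> w)"
      using pullback_affine[OF R _ A[OF \<zeta>] su, where v=v and w=w] \<phi>(2) A[OF \<zeta>] by (simp add: exp_add)
  qed
  moreover have "immersion M unit_disc (\<lambda>x. u (?A x))"
    unfolding immersion_def
  proof (intro conjI su' ballI impI)
    fix x c assume x: "x \<in> unit_disc" and c: "c \<in> charts M" "u (?A x) \<in> cdom c"
    let ?D = "frechet_derivative (cmap c \<circ> u) (at (?A x))"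
    have D: "((cmap c \<circ> u) has_derivative ?D) (at (?A x))"
      by (rule has_derivative_frechet[OF smooth_on_differentiable[OF smooth_map_chart[OF su c(1)]]])
         (use A[OF x] c in auto)
    have "(?A has_derivative (\<lambda>v. r *\<^sub>R v)) (at x)"
      by (auto intro!: derivative_eq_intros)
    from diff_chain_at[OF this D]
    have "((cmap c \<circ> (\<lambda>x. u (?A x))) has_derivative (\<lambda>v. ?D (r *\<^sub>R v))) (at x)"
      by (simp add: o_def)
    from frechet_derivative_eqI[OF this]
    have "frechet_derivative (cmap c \<circ> (\<lambda>x. u (?A x))) (at x) = (\<lambda>v. ?D (r *\<^sub>R v))" .
    moreover have "inj ?D" using imm A[OF x] c unfolding immersion_def by blast
    moreover have "inj (\<lambda>v::complex. r *\<^sub>R v)" using r by (auto simp: inj_def)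
    ultimately show "inj (frechet_derivative (cmap c \<circ> (\<lambda>x. u (?A x))) (at x))"
      using inj_compose[of ?D "\<lambda>v. r *\<^sub>R v"] by (simp add: o_def)
  qed
  moreover have "harmonic M (\<lambda>x. u (?A x))"
    unfolding harmonic_def
  proof (intro conjI su' allI impI)
    fix F :: "real \<times> complex \<Rightarrow> 'm" and \<epsilon> K
    assume H: "\<epsilon> > 0 \<and> compact K \<and> K \<subseteq> unit_disc \<and>
        smooth_map M ({-\<epsilon><..<\<epsilon>} \<times> unit_disc) F \<and>
        (\<forall>\<zeta>\<in>unit_disc. F (0, \<zeta>) = u (?A \<zeta>)) \<and>
        (\<forall>t\<in>{-\<epsilon><..<\<epsilon>}. \<forall>\<zeta>\<in>unit_disc - K. F (t, \<zeta>) = u (?A \<zeta>))"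
    let ?I = "{-\<epsilon><..<\<epsilon>}" and ?B = "ball z r" and ?K = "?A ` K"
    let ?Ai = "\<lambda>y. - ((1/r) *\<^sub>R z) + (1/r) *\<^sub>R y"
    have AiA: "?Ai (?A x) = x" and AAi: "?A (?Ai x) = x" for x
      using r by (simp_all add: scaleR_right_distrib scaleR_right_diff_distrib)
    have AiB: "?Ai y \<in> unit_disc" if "y \<in> ?B" for y
    proof -
      have "?Ai y = (1/r) *\<^sub>R (y - z)" by (simp add: scaleR_right_diff_distrib)
      then show ?thesis using that r by (simp add: dist_norm norm_minus_commute)
    qed
    define G where "G = (\<lambda>p. if snd p \<in> ?B then F (fst p, ?Ai (snd p)) else u (snd p))"
    have cK: "compact ?K" using H by (intro compact_continuous_image continuous_intros) auto
    have KB: "?K \<subseteq> ?B" using AB H by blast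
    have smA: "smooth_on (\<lambda>p::real \<times> complex. (fst p, ?Ai (snd p))) (?I \<times> ?B)"
    proof -
      have "smooth_on (\<lambda>p::real \<times> complex. (0, - ((1/r) *\<^sub>R z)) + (fst p, (1/r) *\<^sub>R snd p)) (?I \<times> ?B)"
        by (intro smooth_on_add smooth_on_const smooth_on_bounded_linear bounded_linear_Pair
            bounded_linear_fst bounded_linear_compose[OF bounded_linear_scaleR_right bounded_linear_snd]
            open_Times) auto
      then show ?thesis by simp
    qed
    have F': "smooth_map M (?I \<times> ?B) (\<lambda>p. F (fst p, ?Ai (snd p)))"
      by (rule smooth_map_compose[OF R _ smA]) (use H AiB in \<open>auto intro!: open_Times\<close>)
    have eqF: "F (t, ?Ai \<zeta>) = u \<zeta>" if "t \<in> ?I" "\<zeta> \<in> ?B - ?K" for t \<zeta>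
    proof -
      have "?Ai \<zeta> \<notin> K" using that(2) AAi[of \<zeta>] by (metis DiffD2 imageI)
      then show ?thesis using H that AiB AAi by simp
    qed
    have smG: "smooth_map M (?I \<times> unit_disc) G"
      unfolding G_def
      by (rule smooth_map_glue[OF R _ _ su _ B cK KB F']) (use eqF in auto)
    have DG: "((\<lambda>t. energy M ?K (\<lambda>\<zeta>. G (t, \<zeta>))) has_real_derivative 0) (at 0)"
    proof -
      have "\<forall>\<zeta>\<in>unit_disc. G (0, \<zeta>) = u \<zeta>"
        using H AiB AAi unfolding G_def by simp
      moreover have "\<forall>t\<in>?I. \<forall>\<zeta>\<in>unit_disc - ?K. G (t, \<zeta>) = u \<zeta>"
      proof (intro ballI)
        fix t \<zeta> assume t: "t \<in> ?I" and \<zeta>: "\<zeta> \<in> unit_disc - ?K"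
        have "?Ai \<zeta> \<notin> K" using \<zeta> AAi[of \<zeta>] by (metis DiffD2 imageI)
        then show "G (t, \<zeta>) = u \<zeta>" using H t AiB AAi unfolding G_def by simp
      qed
      ultimately show ?thesis
        using harm smG H cK KB B unfolding harmonic_def by blast
    qed
    have "energy M ?K (\<lambda>\<zeta>. G (t, \<zeta>)) = energy M K (\<lambda>\<zeta>. F (t, \<zeta>))" if t: "t \<in> ?I" for t
    proof (rule energy_affine[OF R r open_ball _ open_ball])
      have "smooth_on (\<lambda>\<zeta>::complex. (t, \<zeta>)) unit_disc"
      proof -
        have "smooth_on (\<lambda>\<zeta>::complex. (t, 0) + (0, \<zeta>)) unit_disc"
          by (intro smooth_on_add smooth_on_const smooth_on_bounded_linear bounded_linear_Pair
              bounded_linear_zero bounded_linear_ident) auto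
        then show ?thesis by simp
      qed
      then show "smooth_map M unit_disc (\<lambda>\<zeta>. G (t, \<zeta>))"
        by (rule smooth_map_compose[OF R smG]) (use t in \<open>auto intro!: open_Times\<close>)
    qed (use H A AB AiA in \<open>auto simp: G_def\<close>)
    then show "((\<lambda>t. energy M K (\<lambda>\<zeta>. F (t, \<zeta>))) has_real_derivative 0) (at 0)"
      by (intro has_field_derivative_transform_within_open[OF DG, of ?I]) (use H in auto)
  qed
  ultimately show ?thesis unfolding conformal_harmonic_immersed_disc_def by blast
qed

section \<open>Circle averages and almost submean functions\<close>

definition circle_integrable :: "(complex \<Rightarrow> real) \<Rightarrow> complex \<Rightarrow> real \<Rightarrow> bool" where
  "circle_integrable g z r \<longleftrightarrow> set_integrable lborel {0..2*pi} (\<lambda>\<theta>. g (z + of_real r * cis \<theta>))"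

definition circle_average :: "(complex \<Rightarrow> real) \<Rightarrow> complex \<Rightarrow> real \<Rightarrow> real" where
  "circle_average g z r = (LINT \<theta>:{0..2*pi}|lborel. g (z + of_real r * cis \<theta>)) / (2 * pi)"

text \<open>The sub-mean value inequality up to an error \<open>o(r\<^sup>2)\<close>. This is weak enough to be checked by second
order Taylor expansions, stable under sums, and still strong enough for the maximum principle,
where the perturbation \<open>\<eta> \<bar>z\<bar>\<^sup>2\<close> gains exactly \<open>\<eta> r\<^sup>2\<close>.\<close>

definition almost_submean :: "(complex \<Rightarrow> real) \<Rightarrow> complex \<Rightarrow> bool" where
  "almost_submean g z \<longleftrightarrow> (\<forall>\<^sub>F r in at_right 0. circle_integrable g z r) \<and>
     (\<forall>\<eta>>0. \<forall>\<^sub>F r in at_right 0. g z \<le> circle_average g z r + \<eta> * r\<^sup>2)"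

definition usc_real :: "'a::metric_space set \<Rightarrow> ('a \<Rightarrow> real) \<Rightarrow> bool" where
  "usc_real K g \<longleftrightarrow> (\<forall>z\<in>K. \<forall>c>g z. \<forall>\<^sub>F w in at z within K. g w < c)"

lemma circle_integrable_add: "circle_integrable f z r \<Longrightarrow> circle_integrable g z r \<Longrightarrow> circle_integrable (\<lambda>w. f w + g w) z r"
  unfolding circle_integrable_def by (rule set_integral_add)

lemma circle_integrable_scale: "circle_integrable f z r \<Longrightarrow> circle_integrable (\<lambda>w. c * f w) z r"
  unfolding circle_integrable_def by simp

lemma circle_average_add: "circle_integrable f z r \<Longrightarrow> circle_integrable g z r \<Longrightarrow> circle_average (\<lambda>w. f w + g w) z r = circle_average f z r + circle_average g z r"
  unfolding circle_integrable_def circle_average_def by (simp add: set_integral_add add_divide_distrib)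

lemma circle_average_scale: "circle_average (\<lambda>w. c * f w) z r = c * circle_average f z r"
  unfolding circle_average_def by simp

lemma circle_integrable_cong: "(\<And>w. dist z w = r \<Longrightarrow> f w = g w) \<Longrightarrow> r \<ge> 0 \<Longrightarrow> circle_integrable f z r \<longleftrightarrow> circle_integrable g z r"
  unfolding circle_integrable_def by (simp add: dist_norm norm_mult)

lemma circle_average_cong: "(\<And>w. dist z w = r \<Longrightarrow> f w = g w) \<Longrightarrow> r \<ge> 0 \<Longrightarrow> circle_average f z r = circle_average g z r"
  unfolding circle_average_def by (simp add: dist_norm norm_mult)

lemma circle_average_mono:
  assumes "circle_integrable f z r" "circle_integrable g z r" "\<And>w. dist z w = r \<Longrightarrow> f w \<le> g w" "r \<ge> 0"
  shows "circle_average f z r \<le> circle_average g z r"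
  unfolding circle_average_def
proof (intro divide_right_mono set_integral_mono)
  fix \<theta> show "f (z + of_real r * cis \<theta>) \<le> g (z + of_real r * cis \<theta>)"
    by (rule assms(3)) (use assms(4) in \<open>simp add: dist_norm norm_mult\<close>)
qed (use assms(1,2) in \<open>simp_all add: circle_integrable_def\<close>)

lemma circle_integrable_continuous:
  assumes "continuous_on (sphere z r) g" "r \<ge> 0"
  shows "circle_integrable g z r"
  unfolding circle_integrable_def set_integrable_def
proof (rule borel_integrable_compact)
  show "continuous_on {0..2*pi} (\<lambda>\<theta>. g (z + of_real r * cis \<theta>))"
    by (rule continuous_on_compose2[OF assms(1)])
       (use assms(2) in \<open>auto intro!: continuous_intros simp: dist_norm norm_mult\<close>)
qed simp

lemma circle_integrable_const: "circle_integrable (\<lambda>w. c) z r"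
  unfolding circle_integrable_def set_integrable_def by (rule borel_integrable_compact) auto

lemma circle_average_const: "circle_average (\<lambda>w. c) z r = c"
  unfolding circle_average_def by (simp add: set_integral_const)

lemma almost_submean_add:
  assumes "almost_submean f z" "almost_submean g z"
  shows "almost_submean (\<lambda>w. f w + g w) z"
  unfolding almost_submean_def
proof (intro conjI allI impI)
  have f: "\<forall>\<^sub>F r in at_right 0. circle_integrable f z r" and g: "\<forall>\<^sub>F r in at_right 0. circle_integrable g z r"
    using assms unfolding almost_submean_def by auto
  show "\<forall>\<^sub>F r in at_right 0. circle_integrable (\<lambda>w. f w + g w) z r"
    using f g by eventually_elim (rule circle_integrable_add)
  fix \<eta> :: real assume "\<eta> > 0"
  then have "\<forall>\<^sub>F r in at_right 0. f z \<le> circle_average f z r + (\<eta>/2) * r\<^sup>2"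
    "\<forall>\<^sub>F r in at_right 0. g z \<le> circle_average g z r + (\<eta>/2) * r\<^sup>2"
    using assms unfolding almost_submean_def by (meson half_gt_zero)+
  then show "\<forall>\<^sub>F r in at_right 0. f z + g z \<le> circle_average (\<lambda>w. f w + g w) z r + \<eta> * r\<^sup>2"
    using f g by eventually_elim (simp add: circle_average_add field_simps)
qed

lemma almost_submean_scale:
  assumes "almost_submean f z" "c \<ge> 0"
  shows "almost_submean (\<lambda>w. c * f w) z"
proof (cases "c = 0")
  case True
  then show ?thesis by (simp add: almost_submean_def circle_integrable_const circle_average_const)
next
  case False
  then have c: "c > 0" using assms by simp
  show ?thesis unfolding almost_submean_def
  proof (intro conjI allI impI)
    show "\<forall>\<^sub>F r in at_right 0. circle_integrable (\<lambda>w. c * f w) z r"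
      using assms circle_integrable_scale unfolding almost_submean_def by (auto elim: eventually_mono)
    fix \<eta> :: real assume "\<eta> > 0"
    then have "\<forall>\<^sub>F r in at_right 0. f z \<le> circle_average f z r + (\<eta>/c) * r\<^sup>2"
      using assms(1) c unfolding almost_submean_def by (meson divide_pos_pos)
    then show "\<forall>\<^sub>F r in at_right 0. c * f z \<le> circle_average (\<lambda>w. c * f w) z r + \<eta> * r\<^sup>2"
    proof eventually_elim
      case (elim r)
      then have "c * f z \<le> c * (circle_average f z r + (\<eta>/c) * r\<^sup>2)" using c by simp
      then show ?case using c by (simp add: circle_average_scale algebra_simps)
    qed
  qed
qed

lemma eventually_at_right_0_less:
  fixes d :: real shows "d > 0 \<Longrightarrow> \<forall>\<^sub>F r in at_right 0. 0 < r \<and> r < d"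
  by (auto simp: eventually_at_right_field)

lemma almost_submean_cong:
  assumes "almost_submean f z" "open S" "z \<in> S" "\<And>w. w \<in> S \<Longrightarrow> g w = f w"
  shows "almost_submean g z"
proof -
  obtain e where e: "e > 0" "ball z e \<subseteq> S" using assms(2,3) open_contains_ball by blast
  have *: "\<forall>\<^sub>F r in at_right 0. circle_integrable g z r = circle_integrable f z r \<and> circle_average g z r = circle_average f z r"
    using eventually_at_right_0_less[OF e(1)]
  proof eventually_elim
    case (elim r)
    then have "g w = f w" if "dist z w = r" for w using that e assms(4) by auto
    then show ?case using elim circle_integrable_cong[of z r g f] circle_average_cong[of z r g f] by auto
  qed
  show ?thesis
    unfolding almost_submean_def
  proof (intro conjI allI impI)
    show "\<forall>\<^sub>F r in at_right 0. circle_integrable g z r"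
      using assms(1) * unfolding almost_submean_def by (auto elim: eventually_elim2)
    fix \<eta> :: real assume "\<eta> > 0"
    then have "\<forall>\<^sub>F r in at_right 0. f z \<le> circle_average f z r + \<eta> * r\<^sup>2"
      using assms(1) unfolding almost_submean_def by blast
    then show "\<forall>\<^sub>F r in at_right 0. g z \<le> circle_average g z r + \<eta> * r\<^sup>2"
      using * by eventually_elim (use assms(3,4) in auto)
  qed
qed

lemma circle_integrals:
  "set_integrable lborel {0..2*pi} cos" "set_integrable lborel {0..2*pi} sin"
  "set_integrable lborel {0..2*pi} (\<lambda>t. (cos t)\<^sup>2)" "set_integrable lborel {0..2*pi} (\<lambda>t. (sin t)\<^sup>2)"
  "set_integrable lborel {0..2*pi} (\<lambda>t. cos t * sin t)"
  "(LINT t:{0..2*pi}|lborel. cos t) = 0" "(LINT t:{0..2*pi}|lborel. sin t) = 0"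
  "(LINT t:{0..2*pi}|lborel. (cos t)\<^sup>2) = pi" "(LINT t:{0..2*pi}|lborel. (sin t)\<^sup>2) = pi"
  "(LINT t:{0..2*pi}|lborel. cos t * sin t) = 0"
proof -
  have si: "set_integrable lborel {0..2*pi} f" if "continuous_on {0..2*pi} f" for f :: "real \<Rightarrow> real"
    unfolding set_integrable_def using borel_integrable_compact[OF _ that] by simp
  have ft: "(LINT t:{0..2*pi}|lborel. f t) = F (2*pi) - F 0"
    if "continuous_on {0..2*pi} f" and "\<And>t. (F has_real_derivative f t) (at t)" for f F :: "real \<Rightarrow> real"
  proof -
    have "(f has_integral (F (2*pi) - F 0)) {0..2*pi}"
      by (rule fundamental_theorem_of_calculus)
         (use that(2) in \<open>auto simp: has_real_derivative_iff_has_vector_derivative[symmetric]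
            intro: has_field_derivative_at_within\<close>)
    then show ?thesis using set_borel_integral_eq_integral(2)[OF si[OF that(1)]] integral_unique by metis
  qed
  show "set_integrable lborel {0..2*pi} cos" "set_integrable lborel {0..2*pi} sin"
    "set_integrable lborel {0..2*pi} (\<lambda>t. (cos t)\<^sup>2)" "set_integrable lborel {0..2*pi} (\<lambda>t. (sin t)\<^sup>2)"
    "set_integrable lborel {0..2*pi} (\<lambda>t. cos t * sin t)"
    by (intro si continuous_intros)+
  show "(LINT t:{0..2*pi}|lborel. cos t) = 0"
    by (subst ft[where F = sin]) (auto intro!: continuous_intros derivative_eq_intros)
  show "(LINT t:{0..2*pi}|lborel. sin t) = 0"
    by (subst ft[where F = "\<lambda>t. - cos t"]) (auto intro!: continuous_intros derivative_eq_intros)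
  show "(LINT t:{0..2*pi}|lborel. (cos t)\<^sup>2) = pi"
  proof (subst ft[where F = "\<lambda>t. (t + sin t * cos t) / 2"])
    have "1 + (cos t * cos t - sin t * sin t) = 2 * (cos t)\<^sup>2" for t :: real
      using sin_squared_eq[of t] by (simp add: power2_eq_square)
    then show "((\<lambda>t. (t + sin t * cos t) / 2) has_real_derivative (cos t)\<^sup>2) (at t)" for t
      by (auto intro!: derivative_eq_intros)
  qed (auto intro!: continuous_intros)
  show "(LINT t:{0..2*pi}|lborel. (sin t)\<^sup>2) = pi"
  proof (subst ft[where F = "\<lambda>t. (t - sin t * cos t) / 2"])
    have "1 - (cos t * cos t - sin t * sin t) = 2 * (sin t)\<^sup>2" for t :: real
      using cos_squared_eq[of t] by (simp add: power2_eq_square)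
    then show "((\<lambda>t. (t - sin t * cos t) / 2) has_real_derivative (sin t)\<^sup>2) (at t)" for t
      by (auto intro!: derivative_eq_intros)
  qed (auto intro!: continuous_intros)
  show "(LINT t:{0..2*pi}|lborel. cos t * sin t) = 0"
    by (subst ft[where F = "\<lambda>t. (sin t)\<^sup>2 / 2"])
       (auto intro!: continuous_intros derivative_eq_intros)
qed

text \<open>A polynomial of degree two without constant term in the real and imaginary part.\<close>

definition qform :: "real \<Rightarrow> real \<Rightarrow> real \<Rightarrow> real \<Rightarrow> real \<Rightarrow> complex \<Rightarrow> real" where
  "qform p q a b c h = p * Re h + q * Im h + a * (Re h)\<^sup>2 + b * (Re h * Im h) + c * (Im h)\<^sup>2"

lemma continuous_on_qform [continuous_intros]:
  "continuous_on S f \<Longrightarrow> continuous_on S (\<lambda>x. qform p q a b c (f x))"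
  unfolding qform_def by (intro continuous_intros)

lemma circle_average_qform:
  "circle_average (\<lambda>w. d + qform p q a b c (w - z)) z r = d + (a + c) / 2 * r\<^sup>2"
proof -
  let ?I = "\<lambda>f. LINT t:{0..2*pi}|lborel. f t"
  have lin: "set_integrable lborel {0..2*pi} (\<lambda>t. k * f t + g t) \<and> ?I (\<lambda>t. k * f t + g t) = k * ?I f + y"
    if "set_integrable lborel {0..2*pi} f" "set_integrable lborel {0..2*pi} g \<and> ?I g = y"
    for k y and f g :: "real \<Rightarrow> real"
    using that by (simp add: set_integral_add)
  have const: "set_integrable lborel {0..2*pi} (\<lambda>t. d) \<and> ?I (\<lambda>t. d) = 2 * pi * d"
    unfolding set_integrable_def
    by (intro conjI borel_integrable_compact) (auto simp: set_integral_const)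
  have eq: "d + qform p q a b c (z + of_real r * cis t - z)
      = (p * r) * cos t + ((q * r) * sin t + ((a * r\<^sup>2) * (cos t)\<^sup>2
          + ((b * r\<^sup>2) * (cos t * sin t) + ((c * r\<^sup>2) * (sin t)\<^sup>2 + d))))" for t
    by (simp add: qform_def power_mult_distrib power2_eq_square algebra_simps)
  note ints = circle_integrals
  have "?I (\<lambda>t. d + qform p q a b c (z + of_real r * cis t - z))
      = (p * r) * 0 + ((q * r) * 0 + ((a * r\<^sup>2) * pi + ((b * r\<^sup>2) * 0 + ((c * r\<^sup>2) * pi + 2 * pi * d))))"
    unfolding eq
    using lin[OF ints(1) lin[OF ints(2) lin[OF ints(3) lin[OF ints(5) lin[OF ints(4) const]]]],
        of "p * r" "q * r" "a * r\<^sup>2" "b * r\<^sup>2" "c * r\<^sup>2", unfolded ints(6-10)] by blast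
  then show ?thesis
    unfolding circle_average_def by (simp add: field_simps)
qed

text \<open>A second order expansion at \<open>z\<close> determines circle averages up to \<open>o(r\<^sup>2)\<close>: linear and mixed terms
average out and both squares have average \<open>r\<^sup>2 / 2\<close>.\<close>

lemma circle_average_peano:
  assumes "\<And>\<epsilon>. \<epsilon> > 0 \<Longrightarrow> \<exists>\<delta>>0. \<forall>h. norm h < \<delta> \<longrightarrow>
      \<bar>S (z + h) - S z - qform p q a b c h\<bar> \<le> \<epsilon> * (norm h)\<^sup>2"
    and int: "\<forall>\<^sub>F r in at_right 0. circle_integrable S z r" and \<eta>: "\<eta> > 0"
  shows "\<forall>\<^sub>F r in at_right 0. \<bar>circle_average S z r - S z - (a + c) / 2 * r\<^sup>2\<bar> \<le> \<eta> * r\<^sup>2"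
proof -
  obtain \<delta> where \<delta>: "\<delta> > 0" "\<forall>h. norm h < \<delta> \<longrightarrow>
      \<bar>S (z + h) - S z - qform p q a b c h\<bar> \<le> \<eta> * (norm h)\<^sup>2"
    using assms(1)[OF \<eta>] by blast
  show ?thesis
    using int eventually_at_right_0_less[OF \<delta>(1)]
  proof eventually_elim
    case (elim r)
    have q: "circle_integrable (\<lambda>w. d + qform p q a b c (w - z)) z r" for d
      using elim by (intro circle_integrable_continuous continuous_intros) auto
    have b: "\<bar>S w - S z - qform p q a b c (w - z)\<bar> \<le> \<eta> * r\<^sup>2" if "dist z w = r" for w
      using \<delta>(2)[rule_format, of "w - z"] elim that by (simp add: dist_norm norm_minus_commute)
    have "circle_average S z r \<le> circle_average (\<lambda>w. (S z + \<eta> * r\<^sup>2) + qform p q a b c (w - z)) z r"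
      by (rule circle_average_mono) (use elim q b in \<open>force simp: abs_le_iff\<close>)+
    moreover have "circle_average (\<lambda>w. (S z - \<eta> * r\<^sup>2) + qform p q a b c (w - z)) z r \<le> circle_average S z r"
      by (rule circle_average_mono) (use elim q b in \<open>force simp: abs_le_iff\<close>)+
    ultimately show ?case by (simp add: circle_average_qform abs_le_iff)
  qed
qed

section \<open>Upper semicontinuity and the maximum principle\<close>

lemma usc_realD:
  assumes "usc_real K g" "z \<in> K" "g z < c"
  obtains e where "e > 0" "\<And>w. w \<in> K \<Longrightarrow> dist w z < e \<Longrightarrow> g w < c"
proof -
  have "\<forall>\<^sub>F w in at z within K. g w < c" using assms unfolding usc_real_def by blast
  then obtain e where "e > 0" "\<And>w. w \<in> K \<Longrightarrow> w \<noteq> z \<Longrightarrow> dist w z < e \<Longrightarrow> g w < c"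
    unfolding eventually_at by blast
  then show ?thesis using that assms(3) by metis
qed

lemma usc_real_add:
  assumes "usc_real K f" "usc_real K g"
  shows "usc_real K (\<lambda>w. f w + g w)"
  unfolding usc_real_def
proof (intro ballI allI impI)
  fix z c assume z: "z \<in> K" and c: "f z + g z < c"
  define e where "e = (c - (f z + g z)) / 2"
  have e: "e > 0" using c unfolding e_def by simp
  have "\<forall>\<^sub>F w in at z within K. f w < f z + e" "\<forall>\<^sub>F w in at z within K. g w < g z + e"
    using assms z e unfolding usc_real_def by auto
  then show "\<forall>\<^sub>F w in at z within K. f w + g w < c"
    by eventually_elim (simp add: e_def field_simps)
qed

lemma usc_real_continuous:
  assumes "continuous_on K g"
  shows "usc_real K g"
  unfolding usc_real_def
  using assms by (auto simp: continuous_on_def order_tendsto_iff)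

lemma usc_real_scale:
  assumes "usc_real K f" "c \<ge> 0"
  shows "usc_real K (\<lambda>w. c * f w)"
proof (cases "c = 0")
  case True
  then show ?thesis by (simp add: usc_real_continuous)
next
  case False
  then have c: "c > 0" using assms by simp
  show ?thesis
    unfolding usc_real_def
  proof (intro ballI allI impI)
    fix z d assume z: "z \<in> K" and d: "c * f z < d"
    have "f z < d / c" using c d by (simp add: pos_less_divide_eq mult.commute)
    then have "\<forall>\<^sub>F w in at z within K. f w < d / c"
      using assms(1) z unfolding usc_real_def by blast
    then show "\<forall>\<^sub>F w in at z within K. c * f w < d"
      by eventually_elim (use c in \<open>simp add: pos_less_divide_eq mult.commute\<close>)
  qed
qed

lemma usc_real_subset: "usc_real T f \<Longrightarrow> S \<subseteq> T \<Longrightarrow> usc_real S f"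
  unfolding usc_real_def using filter_leD[OF at_le] by blast

lemma usc_real_compose:
  assumes "usc_real T f" "continuous_on S h" "h ` S \<subseteq> T"
  shows "usc_real S (\<lambda>w. f (h w))"
  unfolding usc_real_def
proof (intro ballI allI impI)
  fix z c assume z: "z \<in> S" and c: "f (h z) < c"
  obtain e where e: "e > 0" "\<And>w. w \<in> T \<Longrightarrow> dist w (h z) < e \<Longrightarrow> f w < c"
    using usc_realD[OF assms(1) _ c] z assms(3) by blast
  have "\<forall>\<^sub>F w in at z within S. dist (h w) (h z) < e"
    using assms(2) z e(1) by (simp add: continuous_on_def tendsto_iff)
  moreover have "\<forall>\<^sub>F w in at z within S. w \<in> S" by (simp add: eventually_at_filter)
  ultimately show "\<forall>\<^sub>F w in at z within S. f (h w) < c"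
    by eventually_elim (use e assms(3) in auto)
qed

text \<open>If no point were a maximum, the open sets on which \<open>g\<close> stays below a value taken elsewhere would
cover \<open>K\<close>; the largest of finitely many such values is attained in one of the sets, a contradiction.\<close>

lemma usc_real_attains_max:
  assumes "compact K" "K \<noteq> {}" "usc_real K g"
  shows "\<exists>z\<in>K. \<forall>w\<in>K. g w \<le> g z"
proof (rule ccontr)
  assume "\<not> ?thesis"
  then have "\<forall>z\<in>K. \<exists>w\<in>K. g z < g w" by (auto simp: not_le)
  then obtain h where h: "\<And>z. z \<in> K \<Longrightarrow> h z \<in> K \<and> g z < g (h z)" by metis
  have "\<exists>e>0. \<forall>w\<in>K. dist w z < e \<longrightarrow> g w < g (h z)" if "z \<in> K" for z
    using usc_realD[OF assms(3) that, of "g (h z)"] h that by metis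
  then obtain e where e: "\<And>z. z \<in> K \<Longrightarrow> e z > 0 \<and> (\<forall>w\<in>K. dist w z < e z \<longrightarrow> g w < g (h z))" by metis
  obtain F where F: "F \<subseteq> K" "finite F" "K \<subseteq> (\<Union>z\<in>F. ball z (e z))"
    by (rule compactE_image[OF assms(1), of K "\<lambda>z. ball z (e z)"]) (use e in auto)
  have "F \<noteq> {}" using F assms(2) by auto
  then have "Max ((\<lambda>z. g (h z)) ` F) \<in> (\<lambda>z. g (h z)) ` F"
    using F(2) by (intro Max_in) auto
  then obtain m where "m \<in> F" "Max ((\<lambda>z. g (h z)) ` F) = g (h m)" by auto
  then have m: "m \<in> F" "\<forall>z\<in>F. g (h z) \<le> g (h m)"
    using F(2) by (auto simp flip: \<open>Max _ = _\<close>)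
  then have "h m \<in> K" using h F by blast
  then obtain z where "z \<in> F" "dist (h m) z < e z" using F by (auto simp: dist_commute)
  then show False using e[of z] F m h \<open>h m \<in> K\<close> by force
qed

text \<open>Upper semicontinuity gives both measurability and the bound from above.\<close>

lemma usc_real_circle_integrable:
  assumes usc: "usc_real (sphere z r) g" and r: "r \<ge> 0" and lb: "\<And>w. w \<in> sphere z r \<Longrightarrow> b \<le> g w"
  shows "circle_integrable g z r"
proof -
  let ?A = "{0..2*pi}" and ?G = "\<lambda>\<theta>. g (z + of_real r * cis \<theta>)"
  have sph: "z + of_real r * cis \<theta> \<in> sphere z r" for \<theta> using r by (simp add: dist_norm norm_mult)
  have ne: "sphere z r \<noteq> {}" using sph by blast
  obtain m where m: "\<forall>w\<in>sphere z r. g w \<le> g m"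
    using usc_real_attains_max[OF compact_sphere ne usc] by blast
  have uG: "usc_real UNIV ?G"
    by (rule usc_real_compose[OF usc]) (use sph in \<open>auto intro!: continuous_intros\<close>)
  have op: "open {\<theta>. ?G \<theta> < c}" for c
    unfolding open_dist
  proof
    fix t assume "t \<in> {\<theta>. ?G \<theta> < c}"
    then show "\<exists>e>0. \<forall>y. dist y t < e \<longrightarrow> y \<in> {\<theta>. ?G \<theta> < c}"
      using usc_realD[OF uG, of t c] by auto
  qed
  have "?G \<in> borel_measurable borel"
    unfolding borel_measurable_iff_less using borel_open[OF op] by simp
  then have "set_borel_measurable lborel ?A ?G"
    unfolding set_borel_measurable_def by (intro borel_measurable_scaleR) simp_all
  moreover have "set_integrable lborel ?A (\<lambda>\<theta>. \<bar>b\<bar> + \<bar>g m\<bar>)"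
    unfolding set_integrable_def by (rule borel_integrable_compact) auto
  moreover have "\<bar>?G \<theta>\<bar> \<le> \<bar>b\<bar> + \<bar>g m\<bar>" for \<theta>
    using m lb sph[of \<theta>] by (smt (verit))
  ultimately show ?thesis
    unfolding circle_integrable_def by (intro set_integrable_bound[of lborel ?A "\<lambda>\<theta>. \<bar>b\<bar> + \<bar>g m\<bar>" ?G]) auto
qed

text \<open>At a maximum of \<open>g w + \<eta> \<bar>w\<bar>\<^sup>2\<close> the circle averages of \<open>g\<close> fall below the central value by at least
\<open>\<eta> r\<^sup>2\<close>, as \<open>\<bar>w\<bar>\<^sup>2\<close> has average \<open>\<bar>z\<bar>\<^sup>2 + r\<^sup>2\<close>.\<close>

lemma not_almost_submean_strict_max:
  assumes e: "e > 0" and \<eta>: "\<eta> > 0"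
    and max: "\<And>w. dist z w < e \<Longrightarrow> g w + \<eta> * (norm w)\<^sup>2 \<le> g z + \<eta> * (norm z)\<^sup>2"
  shows "\<not> almost_submean g z"
proof
  assume "almost_submean g z"
  then have "\<forall>\<^sub>F r in at_right 0. circle_integrable g z r" "\<forall>\<^sub>F r in at_right 0. g z \<le> circle_average g z r + (\<eta>/2) * r\<^sup>2"
    using \<eta> unfolding almost_submean_def by (auto dest: spec[of _ "\<eta>/2"])
  then have "\<forall>\<^sub>F r in at_right 0. (circle_integrable g z r \<and> g z \<le> circle_average g z r + (\<eta>/2) * r\<^sup>2) \<and> 0 < r \<and> r < e"
    using eventually_at_right_0_less[OF e] by eventually_elim auto
  then obtain r where r: "circle_integrable g z r" "g z \<le> circle_average g z r + (\<eta>/2) * r\<^sup>2" "0 < r" "r < e"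
    using eventually_happens'[OF trivial_limit_at_right_real] by blast
  let ?q = "\<lambda>w. g z + qform (- \<eta> * 2 * Re z) (- \<eta> * 2 * Im z) (- \<eta>) 0 (- \<eta>) (w - z)"
  have q: "?q w = g z + \<eta> * (norm z)\<^sup>2 - \<eta> * (norm w)\<^sup>2" for w
    by (simp add: qform_def cmod_power2) (simp add: power2_eq_square algebra_simps)
  have "circle_average g z r \<le> circle_average ?q z r"
  proof (rule circle_average_mono[OF r(1)])
    show "circle_integrable ?q z r" using r by (intro circle_integrable_continuous continuous_intros) auto
    show "g w \<le> ?q w" if "dist z w = r" for w
      unfolding q using max[of w] that r by simp
  qed (use r in simp)
  also have "\<dots> = g z - \<eta> * r\<^sup>2" unfolding circle_average_qform by simp
  finally have "g z \<le> g z - (\<eta>/2) * r\<^sup>2" using r(2) by simp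
  moreover have "(\<eta>/2) * r\<^sup>2 > 0" using r(3) \<eta> by simp
  ultimately show False by linarith
qed

text \<open>The maximum of \<open>g z + \<eta> \<bar>z\<bar>\<^sup>2\<close> cannot lie at an almost submean point, so it lies where
\<open>g \<le> 0\<close>; then \<open>\<eta>\<close> tends to \<open>0\<close>.\<close>

theorem max_principle:
  assumes K: "compact K" and usc: "usc_real K g"
    and cases: "\<And>z. z \<in> K \<Longrightarrow> g z \<le> 0 \<or> z \<in> interior K \<and> almost_submean g z"
    and w: "w \<in> K"
  shows "g w \<le> 0"
proof -
  obtain B where B: "B > 0" "\<And>z. z \<in> K \<Longrightarrow> norm z \<le> B"
    using compact_imp_bounded[OF K] unfolding bounded_pos by blast
  have "g w \<le> \<eta> * B\<^sup>2" if \<eta>: "\<eta> > 0" for \<eta>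
  proof -
    have "usc_real K (\<lambda>z. g z + \<eta> * (norm z)\<^sup>2)"
      by (intro usc_real_add usc usc_real_continuous continuous_intros)
    then obtain z where z: "z \<in> K" "\<And>w. w \<in> K \<Longrightarrow> g w + \<eta> * (norm w)\<^sup>2 \<le> g z + \<eta> * (norm z)\<^sup>2"
      using usc_real_attains_max[OF K] w by blast
    have "g z \<le> 0"
    proof (rule ccontr)
      assume "\<not> g z \<le> 0"
      then have zi: "z \<in> interior K" "almost_submean g z" using cases[OF z(1)] by auto
      then obtain e where e: "e > 0" "ball z e \<subseteq> K" by (meson mem_interior)
      have "\<not> almost_submean g z"
        by (rule not_almost_submean_strict_max[OF e(1) \<eta>]) (use z(2) e(2) in auto)
      then show False using zi(2) by blast
    qed
    moreover have "\<eta> * (norm z)\<^sup>2 \<le> \<eta> * B\<^sup>2"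
      using B(2)[OF z(1)] \<eta> by (simp add: power_mono)
    moreover have "0 \<le> \<eta> * (norm w)\<^sup>2" using \<eta> by simp
    ultimately show ?thesis using z(2)[OF w] by linarith
  qed
  from this[of "e / B\<^sup>2" for e] have "g w \<le> 0 + e" if "e > 0" for e
    using B(1) that by simp
  then show ?thesis by (rule field_le_epsilon)
qed

section \<open>Isometries of the plane\<close>

lemma set_integral_shift:
  fixes F :: "real \<Rightarrow> real"
  assumes "set_integrable lborel {a..b} F"
  shows "set_integrable lborel {a-c..b-c} (\<lambda>t. F (t + c))"
    "(LINT t:{a-c..b-c}|lborel. F (t + c)) = (LINT t:{a..b}|lborel. F t)"
proof -
  have i: "indicator {a-c..b-c} t *\<^sub>R F (t + c) = indicator {a..b} (c + 1 * t) *\<^sub>R F (c + 1 * t)" for t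
    by (auto simp: indicator_def add.commute)
  show "set_integrable lborel {a-c..b-c} (\<lambda>t. F (t + c))"
    using lborel_integrable_real_affine[OF assms[unfolded set_integrable_def], of 1 c]
    unfolding set_integrable_def i by simp
  show "(LINT t:{a-c..b-c}|lborel. F (t + c)) = (LINT t:{a..b}|lborel. F t)"
    using lborel_integral_real_affine[of 1 "\<lambda>t. indicator {a..b} t *\<^sub>R F t" c]
    unfolding set_lebesgue_integral_def i by simp
qed

text \<open>By periodicity the part of the shifted interval beyond \<open>2 * pi\<close> returns to its beginning.\<close>

lemma periodic_integral_shift:
  fixes F :: "real \<Rightarrow> real"
  assumes per: "\<And>t. F (t + 2*pi) = F t" and int: "set_integrable lborel {0..2*pi} F"
    and c: "0 \<le> c" "c \<le> 2*pi"
  shows "set_integrable lborel {0..2*pi} (\<lambda>t. F (t + c))"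
    "(LINT t:{0..2*pi}|lborel. F (t + c)) = (LINT t:{0..2*pi}|lborel. F t)"
proof -
  have "set_integrable lborel {2*pi..4*pi} F"
    using set_integral_shift(1)[OF int, of "-2*pi"] per[of "t - 2*pi" for t] by simp
  from set_integrable_Un[OF int this] have big: "set_integrable lborel ({0..2*pi} \<union> {2*pi..4*pi}) F"
    by simp
  have sub: "set_integrable lborel {x..y} F" if "0 \<le> x" "y \<le> 4*pi" for x y
    by (rule set_integrable_subset[OF big]) (use that in auto)
  have HK: "F integrable_on {x..y}" "(LINT t:{x..y}|lborel. F t) = integral {x..y} F"
    if "0 \<le> x" "y \<le> 4*pi" for x y
    using set_borel_integral_eq_integral[OF sub[OF that]] by auto
  have ci: "set_integrable lborel {c..2*pi+c} F" using sub c by simp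
  show "set_integrable lborel {0..2*pi} (\<lambda>t. F (t + c))"
    using set_integral_shift(1)[OF ci, of c] by simp
  have "(LINT t:{0..2*pi}|lborel. F (t + c)) = (LINT t:{c..2*pi+c}|lborel. F t)"
    using set_integral_shift(2)[OF ci, of c] by simp
  also have "\<dots> = integral {c..2*pi} F + integral {2*pi..2*pi+c} F"
    using c by (subst HK) (auto simp: Henstock_Kurzweil_Integration.integral_combine HK)
  also have "integral {2*pi..2*pi+c} F = integral {0..c} F"
  proof -
    have "integral {2*pi..2*pi+c} F = (LINT t:{2*pi..2*pi+c}|lborel. F t)" using c by (simp add: HK)
    also have "\<dots> = (LINT t:{0..c}|lborel. F (t + 2*pi))"
      using set_integral_shift(2)[OF sub[of "2*pi" "2*pi+c"], of "2*pi"] c by simp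
    also have "\<dots> = integral {0..c} F" using c by (simp add: per HK)
    finally show ?thesis .
  qed
  also have "integral {c..2*pi} F + integral {0..c} F = (LINT t:{0..2*pi}|lborel. F t)"
    using c by (subst HK) (auto simp: Henstock_Kurzweil_Integration.integral_combine HK add.commute)
  finally show "(LINT t:{0..2*pi}|lborel. F (t + c)) = (LINT t:{0..2*pi}|lborel. F t)" .
qed

lemma periodic_integral_uminus:
  fixes F :: "real \<Rightarrow> real"
  assumes per: "\<And>t. F (t + 2*pi) = F t" and int: "set_integrable lborel {0..2*pi} F"
  shows "set_integrable lborel {0..2*pi} (\<lambda>t. F (- t))"
    "(LINT t:{0..2*pi}|lborel. F (- t)) = (LINT t:{0..2*pi}|lborel. F t)"
proof -
  have i: "indicator {0..2*pi} t *\<^sub>R F (- t)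
      = indicator {0..2*pi} (2*pi + (-1) * t) *\<^sub>R F (2*pi + (-1) * t)" for t
    using per[of "- t"] by (auto simp: indicator_def add.commute)
  show "set_integrable lborel {0..2*pi} (\<lambda>t. F (- t))"
    using lborel_integrable_real_affine[OF int[unfolded set_integrable_def], of "-1" "2*pi"]
    unfolding set_integrable_def i by simp
  show "(LINT t:{0..2*pi}|lborel. F (- t)) = (LINT t:{0..2*pi}|lborel. F t)"
    using lborel_integral_real_affine[of "-1" "\<lambda>t. indicator {0..2*pi} t *\<^sub>R F t" "2*pi"]
    unfolding set_lebesgue_integral_def i by simp
qed

lemma circle_average_rotate:
  assumes e: "norm e = 1" and int: "circle_integrable g (m + e * z) r"
  shows "circle_integrable (\<lambda>w. g (m + e * w)) z r" "circle_average (\<lambda>w. g (m + e * w)) z r = circle_average g (m + e * z) r"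
proof -
  let ?c = "Arg2pi e" and ?F = "\<lambda>t. g (m + e * z + of_real r * cis t)"
  have c: "0 \<le> ?c" "?c \<le> 2*pi" using Arg2pi_ge_0 Arg2pi_lt_2pi less_imp_le by blast+
  have ec: "e = cis ?c"
    using Arg2pi_eq[of e] e by (simp add: cis_conv_exp)
  have eq: "g (m + e * (z + of_real r * cis t)) = ?F (t + ?c)" for t
  proof -
    have "e * cis t = cis (t + ?c)" by (subst ec) (simp add: cis_mult add.commute)
    moreover have "m + e * (z + of_real r * cis t) = m + e * z + of_real r * (e * cis t)"
      by (simp add: algebra_simps)
    ultimately show ?thesis by (simp only:)
  qed
  have per: "?F (t + 2*pi) = ?F t" for t by (simp add: cis_mult[symmetric])
  note P = periodic_integral_shift[of ?F, OF per int[unfolded circle_integrable_def] c]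
  show "circle_integrable (\<lambda>w. g (m + e * w)) z r" unfolding circle_integrable_def eq by (rule P)
  show "circle_average (\<lambda>w. g (m + e * w)) z r = circle_average g (m + e * z) r" unfolding circle_average_def eq P(2) ..
qed

lemma circle_average_cnj:
  assumes int: "circle_integrable g (cnj z) r"
  shows "circle_integrable (\<lambda>w. g (cnj w)) z r" "circle_average (\<lambda>w. g (cnj w)) z r = circle_average g (cnj z) r"
proof -
  let ?F = "\<lambda>t. g (cnj z + of_real r * cis t)"
  have eq: "g (cnj (z + of_real r * cis t)) = ?F (- t)" for t
    by (simp add: cis_cnj)
  have per: "?F (t + 2*pi) = ?F t" for t by (simp add: cis_mult[symmetric])
  note P = periodic_integral_uminus[of ?F, OF per int[unfolded circle_integrable_def]]
  show "circle_integrable (\<lambda>w. g (cnj w)) z r" unfolding circle_integrable_def eq by (rule P)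
  show "circle_average (\<lambda>w. g (cnj w)) z r = circle_average g (cnj z) r" unfolding circle_average_def eq P(2) ..
qed

lemma almost_submean_rotate:
  assumes e: "norm e = 1" and g: "almost_submean g (m + e * z)"
  shows "almost_submean (\<lambda>w. g (m + e * w)) z"
  unfolding almost_submean_def
proof (intro conjI allI impI)
  have c: "\<forall>\<^sub>F r in at_right 0. circle_integrable g (m + e * z) r" using g unfolding almost_submean_def by blast
  then show "\<forall>\<^sub>F r in at_right 0. circle_integrable (\<lambda>w. g (m + e * w)) z r"
    by eventually_elim (rule circle_average_rotate[OF e])
  fix \<eta> :: real assume "\<eta> > 0"
  then have "\<forall>\<^sub>F r in at_right 0. g (m + e * z) \<le> circle_average g (m + e * z) r + \<eta> * r\<^sup>2"
    using g unfolding almost_submean_def by blast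
  then show "\<forall>\<^sub>F r in at_right 0. g (m + e * z) \<le> circle_average (\<lambda>w. g (m + e * w)) z r + \<eta> * r\<^sup>2"
    using c by eventually_elim (simp add: circle_average_rotate[OF e])
qed

lemma almost_submean_cnj:
  assumes g: "almost_submean g (cnj z)"
  shows "almost_submean (\<lambda>w. g (cnj w)) z"
  unfolding almost_submean_def
proof (intro conjI allI impI)
  have c: "\<forall>\<^sub>F r in at_right 0. circle_integrable g (cnj z) r" using g unfolding almost_submean_def by blast
  then show "\<forall>\<^sub>F r in at_right 0. circle_integrable (\<lambda>w. g (cnj w)) z r"
    by eventually_elim (rule circle_average_cnj)
  fix \<eta> :: real assume "\<eta> > 0"
  then have "\<forall>\<^sub>F r in at_right 0. g (cnj z) \<le> circle_average g (cnj z) r + \<eta> * r\<^sup>2"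
    using g unfolding almost_submean_def by blast
  then show "\<forall>\<^sub>F r in at_right 0. g (cnj z) \<le> circle_average (\<lambda>w. g (cnj w)) z r + \<eta> * r\<^sup>2"
    using c by eventually_elim (simp add: circle_average_cnj)
qed

lemma almost_submean_harmonic_qform:
  assumes "\<And>h. S (z + h) = S z + qform p q a b (- a) h"
  shows "almost_submean S z"
proof -
  have S: "S w = S z + qform p q a b (- a) (w - z)" for w
    using assms[of "w - z"] by simp
  have cS: "continuous_on T S" for T
    by (subst continuous_on_cong[OF refl S]) (auto intro!: continuous_intros)
  have c: "\<forall>\<^sub>F r in at_right 0. circle_integrable S z r"
    using eventually_at_right_0_less[OF zero_less_one] by eventually_elim (intro circle_integrable_continuous cS, simp)
  have m: "circle_average S z r = S z" for r
  proof -
    have "circle_average S z r = circle_average (\<lambda>w. S z + qform p q a b (- a) (w - z)) z r"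
      unfolding circle_average_def using S by metis
    then show ?thesis by (simp add: circle_average_qform)
  qed
  show ?thesis unfolding almost_submean_def m using c by auto
qed

section \<open>The reflection principle\<close>

text \<open>In coordinates in which the points are \<open>x\<close> and \<open>- x\<close> with \<open>x > 0\<close>, the sum of \<open>g1\<close> and the mirror
image of \<open>g2\<close> is compared on the half disc with \<open>\<alpha> + (\<beta> - \<alpha>) h\<close>, where
\<open>h = (Im\<^sup>2 - Re\<^sup>2 + 2 R Re) / R\<^sup>2\<close> is harmonic, nonnegative on the diameter, at least \<open>1\<close> on the half
circle, and at most \<open>2 x / R\<close> at the point \<open>x\<close>.\<close>

lemma reflection_estimate:
  fixes z1 z2 :: complex and R \<alpha> \<beta> :: real
  defines "m \<equiv> (z1 + z2) / 2"
  assumes R: "dist z1 z2 < 2 * R" and \<alpha>\<beta>: "\<alpha> \<le> \<beta>"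
    and usc: "usc_real (cball m R) g1" "usc_real (cball m R) g2"
    and sub: "\<And>z. z \<in> ball m R \<Longrightarrow> almost_submean g1 z" "\<And>z. z \<in> ball m R \<Longrightarrow> almost_submean g2 z"
    and mid: "\<And>z. z \<in> cball m R \<Longrightarrow> dist z z1 = dist z z2 \<Longrightarrow> g1 z + g2 z \<le> \<alpha>"
    and all: "\<And>z z'. z \<in> cball m R \<Longrightarrow> z' \<in> cball m R \<Longrightarrow> g1 z + g2 z' \<le> \<beta>"
  shows "g1 z1 + g2 z2 \<le> \<alpha> + (\<beta> - \<alpha>) * (dist z1 z2 / R)"
proof (cases "z1 = z2")
  case True
  then have "m = z1" unfolding m_def by simp
  then show ?thesis using mid[of z1] True R by simp
next
  case False
  define x where "x = dist z1 z2 / 2"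
  define e where "e = (z1 - z2) / of_real (dist z1 z2)"
  have "0 < dist z1 z2" using False by simp
  then have x: "0 < x" "x < R" and R0: "R > 0" using R unfolding x_def by linarith+
  have e: "norm e = 1" using False unfolding e_def by (simp add: dist_norm norm_divide)
  have z1: "z1 = m + e * of_real x" and z2: "z2 = m - e * of_real x"
    using False unfolding m_def e_def x_def by (simp_all add: field_simps)
  let ?T = "\<lambda>\<xi>. m + e * \<xi>" and ?T' = "\<lambda>\<xi>. m + (- e) * cnj \<xi>"
  define h where "h = (\<lambda>\<xi>::complex. ((Im \<xi>)\<^sup>2 - (Re \<xi>)\<^sup>2 + 2 * R * Re \<xi>) / R\<^sup>2)"
  define g where "g = (\<lambda>\<xi>. (g1 (?T \<xi>) + g2 (?T' \<xi>)) + (- \<alpha> - (\<beta> - \<alpha>) * h \<xi>))"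
  define K where "K = cball (0::complex) R \<inter> {\<xi>. Re \<xi> \<ge> 0}"
  have TK: "?T \<xi> \<in> cball m R" "?T' \<xi> \<in> cball m R" if "\<xi> \<in> cball 0 R" for \<xi>
    using that e by (simp_all add: dist_norm norm_mult)
  have Tb: "?T \<xi> \<in> ball m R" "?T' \<xi> \<in> ball m R" if "\<xi> \<in> ball 0 R" for \<xi>
    using that e by (simp_all add: dist_norm norm_mult)
  have "g (of_real x) \<le> 0"
  proof (rule max_principle[of K])
    show "compact K" unfolding K_def
      by (intro compact_Int_closed closed_halfspace_Re_ge) auto
    have ch: "continuous_on K (\<lambda>\<xi>. - \<alpha> - (\<beta> - \<alpha>) * h \<xi>)"
      unfolding h_def by (intro continuous_intros) (use R0 in auto)
    show "usc_real K g" unfolding g_def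
      by (intro usc_real_add usc_real_compose[OF usc(1)] usc_real_compose[OF usc(2)]
           usc_real_continuous[OF ch] continuous_intros) (use TK in \<open>auto simp: K_def\<close>)
    show "of_real x \<in> K" unfolding K_def using x by simp
    fix \<xi> assume \<xi>: "\<xi> \<in> K"
    then have re: "Re \<xi> \<ge> 0" and n: "norm \<xi> \<le> R" unfolding K_def by auto
    consider "Re \<xi> = 0" | "norm \<xi> = R" | "Re \<xi> > 0" "norm \<xi> < R" using re n by linarith
    then show "g \<xi> \<le> 0 \<or> \<xi> \<in> interior K \<and> almost_submean g \<xi>"
    proof cases
      case 1
      have "?T' \<xi> = ?T \<xi>" using 1 by (simp add: complex_eq_iff)
      moreover have "dist (?T \<xi>) z1 = dist (?T \<xi>) z2"
      proof -
        have "?T \<xi> - z1 = e * (\<xi> - of_real x)" "?T \<xi> - z2 = e * (\<xi> + of_real x)"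
          unfolding z1 z2 by (simp_all add: algebra_simps)
        moreover have "norm (\<xi> - of_real x) = norm (\<xi> + of_real x)" using 1 by (simp add: cmod_def)
        ultimately show ?thesis by (simp only: dist_norm norm_mult)
      qed
      ultimately have "g1 (?T \<xi>) + g2 (?T' \<xi>) \<le> \<alpha>" using mid TK(1)[of \<xi>] n by simp
      moreover have "h \<xi> \<ge> 0" using 1 unfolding h_def by simp
      then have "0 \<le> (\<beta> - \<alpha>) * h \<xi>" using \<alpha>\<beta> by simp
      ultimately have "g \<xi> \<le> 0" unfolding g_def by linarith
      then show ?thesis ..
    next
      case 2
      have "g1 (?T \<xi>) + g2 (?T' \<xi>) \<le> \<beta>" using all TK[of \<xi>] n by simp
      moreover have "h \<xi> \<ge> 1"
      proof -
        have "(Im \<xi>)\<^sup>2 = R\<^sup>2 - (Re \<xi>)\<^sup>2" using 2 cmod_power2[of \<xi>] by simp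
        moreover have "Re \<xi> * Re \<xi> \<le> R * Re \<xi>" using re complex_Re_le_cmod[of \<xi>] 2 by (intro mult_right_mono) auto
        ultimately show ?thesis unfolding h_def using R0 by (simp add: power2_eq_square)
      qed
      then have "(\<beta> - \<alpha>) * 1 \<le> (\<beta> - \<alpha>) * h \<xi>" using \<alpha>\<beta> by (intro mult_left_mono) auto
      ultimately show ?thesis unfolding g_def by simp
    next
      case 3
      have "open (ball (0::complex) R \<inter> {\<xi>. Re \<xi> > 0})"
        by (intro open_Int open_halfspace_Re_gt) auto
      then have "\<xi> \<in> interior K"
        by (rule interiorI) (use 3 in \<open>auto simp: K_def\<close>)
      moreover have "almost_submean (\<lambda>\<xi>. - \<alpha> - (\<beta> - \<alpha>) * h \<xi>) \<xi>"
      proof (rule almost_submean_harmonic_qform)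
        let ?k = "(\<beta> - \<alpha>) / R\<^sup>2"
        fix d
        show "- \<alpha> - (\<beta> - \<alpha>) * h (\<xi> + d) = - \<alpha> - (\<beta> - \<alpha>) * h \<xi>
          + qform (?k * (2 * Re \<xi> - 2 * R)) (- (?k * (2 * Im \<xi>))) ?k 0 (- ?k) d"
          unfolding h_def qform_def using R0 by (simp add: field_simps power2_eq_square)
      qed
      moreover have "almost_submean (\<lambda>\<xi>. g1 (?T \<xi>)) \<xi>"
        by (rule almost_submean_rotate[OF e sub(1)]) (use Tb 3 in auto)
      moreover have "almost_submean (\<lambda>\<xi>. g2 (?T' \<xi>)) \<xi>"
        by (rule almost_submean_cnj, rule almost_submean_rotate, use e in simp, rule sub(2)) (use Tb 3 in auto)
      ultimately show ?thesis unfolding g_def by (auto intro!: almost_submean_add)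
    qed
  qed
  then have "g1 z1 + g2 z2 \<le> \<alpha> + (\<beta> - \<alpha>) * h (of_real x)"
    unfolding g_def z1 z2 by simp
  also have "(\<beta> - \<alpha>) * h (of_real x) \<le> (\<beta> - \<alpha>) * (dist z1 z2 / R)"
  proof (intro mult_left_mono)
    have "h (of_real x) \<le> 2 * R * x / R\<^sup>2" unfolding h_def by (intro divide_right_mono) auto
    then show "h (of_real x) \<le> dist z1 z2 / R" using R0 by (simp add: x_def power2_eq_square)
  qed (use \<alpha>\<beta> in simp)
  finally show ?thesis by simp
qed

text \<open>The reflection estimate for \<open>g_i = A w - \<bar>Y - Y z_i\<bar>\<^sup>2\<close>. On the mirror line both squares refer to the
same value of \<open>Y\<close>, so by the parallelogram inequality their sum is at least \<open>\<bar>Y z1 - Y z2\<bar>\<^sup>2 / 2\<close>; at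
the points themselves both squares vanish. In probabilistic terms, two Brownian motions are coupled
by reflection until they meet.\<close>

lemma coupling_estimate:
  fixes Y :: "complex \<Rightarrow> 'b::real_inner"
  defines "m \<equiv> \<lambda>z1 z2 :: complex. (z1 + z2) / 2"
  assumes R: "R > 0" "dist z1 z2 \<le> R / 2" and A: "A \<ge> 0"
    and w: "usc_real (cball (m z1 z2) R) w" "\<And>z. z \<in> cball (m z1 z2) R \<Longrightarrow> 0 \<le> w z \<and> w z \<le> \<eta>"
    and Y: "continuous_on (cball (m z1 z2) R) Y"
    and sub: "\<And>q z. q \<in> {Y z1, Y z2} \<Longrightarrow> z \<in> ball (m z1 z2) R \<Longrightarrow> almost_submean (\<lambda>z. A * w z - (norm (Y z - q))\<^sup>2) z"
  shows "(norm (Y z1 - Y z2))\<^sup>2 \<le> 8 * A * \<eta>"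
proof -
  let ?D = "(norm (Y z1 - Y z2))\<^sup>2"
  let ?g = "\<lambda>q z. A * w z - (norm (Y z - q))\<^sup>2"
  have usc: "usc_real (cball (m z1 z2) R) (?g q)" for q
  proof -
    have "usc_real (cball (m z1 z2) R) (\<lambda>z. A * w z + (- (norm (Y z - q))\<^sup>2))"
      by (intro usc_real_add usc_real_scale[OF w(1) A] usc_real_continuous continuous_intros Y)
    then show ?thesis by simp
  qed
  have le: "A * w z \<le> A * \<eta>" if "z \<in> cball (m z1 z2) R" for z
    using w(2)[OF that] A by (intro mult_left_mono) auto
  have par: "?D \<le> 2 * ((norm (y - Y z1))\<^sup>2 + (norm (y - Y z2))\<^sup>2)" for y
  proof -
    have "0 \<le> (norm ((y - Y z1) + (y - Y z2)))\<^sup>2" by simp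
    moreover have "?D = (norm ((y - Y z2) - (y - Y z1)))\<^sup>2" by simp
    ultimately show ?thesis
      by (simp only: power2_norm_eq_inner inner_simps) (simp add: inner_commute algebra_simps)
  qed
  have "?g (Y z1) z1 + ?g (Y z2) z2 \<le> (2 * A * \<eta> - ?D / 2) + (2 * A * \<eta> - (2 * A * \<eta> - ?D / 2)) * (dist z1 z2 / R)"
  proof (rule reflection_estimate[where ?g1.0 = "?g (Y z1)" and ?g2.0 = "?g (Y z2)"])
    fix z assume z: "z \<in> cball ((z1 + z2) / 2) R" 
    show "?g (Y z1) z + ?g (Y z2) z \<le> 2 * A * \<eta> - ?D / 2"
      using le[of z] par[of "Y z"] z unfolding m_def by simp
    fix z' assume z': "z' \<in> cball ((z1 + z2) / 2) R"
    show "?g (Y z1) z + ?g (Y z2) z' \<le> 2 * A * \<eta>"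
      using le[of z] le[of z'] z z' zero_le_power2[of "norm (Y z - Y z1)"]
        zero_le_power2[of "norm (Y z' - Y z2)"] unfolding m_def by linarith
  qed (use R usc sub in \<open>auto simp: m_def\<close>)
  moreover have "z1 \<in> cball (m z1 z2) R" "z2 \<in> cball (m z1 z2) R"
  proof -
    have "m z1 z2 - z1 = - ((z1 - z2) / 2)" "m z1 z2 - z2 = (z1 - z2) / 2"
      unfolding m_def by (simp_all add: field_simps)
    then have "dist (m z1 z2) z1 = dist z1 z2 / 2" "dist (m z1 z2) z2 = dist z1 z2 / 2"
      by (simp_all only: dist_norm norm_minus_cancel norm_divide) simp_all
    then show "z1 \<in> cball (m z1 z2) R" "z2 \<in> cball (m z1 z2) R"
      using R by simp_all
  qed
  then have "0 \<le> ?g (Y z1) z1 + ?g (Y z2) z2" using w(2) A by simp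
  moreover have "?D / 2 * (dist z1 z2 / R) \<le> ?D / 2 * (1 / 2)"
    using R by (intro mult_left_mono) (auto simp: field_simps)
  moreover have "(2 * A * \<eta> - (2 * A * \<eta> - ?D / 2)) * (dist z1 z2 / R) = ?D / 2 * (dist z1 z2 / R)" by simp
  ultimately show ?thesis by linarith
qed

section \<open>Nearly harmonic maps\<close>

text \<open>This is the integrated form of \<open>\<bar>\<Delta>y\<bar> \<le> 2 C \<bar>\<nabla>y\<bar>\<^sup>2\<close>. In this form it combines with inequalities between
functions of \<open>y\<close>, so that no composite function has to be differentiated.\<close>

definition nearly_harmonic :: "real \<Rightarrow> (complex \<Rightarrow> 'b::real_inner) \<Rightarrow> complex \<Rightarrow> bool" where
  "nearly_harmonic C y z \<longleftrightarrow> (\<forall>v. \<forall>\<eta>>0. \<forall>\<^sub>F r in at_right 0.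
     \<bar>circle_average (\<lambda>w. v \<bullet> y w) z r - v \<bullet> y z\<bar> \<le> C * norm v * circle_average (\<lambda>w. (norm (y w - y z))\<^sup>2) z r + \<eta> * r\<^sup>2)"

text \<open>The average of the linear term may be negative, but nearly harmonic maps bound it by the average of
the square term, with the constant \<open>C \<bar>l\<bar> \<le> \<kappa>\<close>.\<close>

lemma almost_submean_of_quadratic_minorant:
  fixes y :: "complex \<Rightarrow> 'b::real_inner"
  assumes nh: "nearly_harmonic C y z" and S: "open S" "z \<in> S" "continuous_on S y"
    and l: "C * norm l \<le> \<kappa>" and int: "\<forall>\<^sub>F r in at_right 0. circle_integrable g z r"
    and le: "\<And>w. w \<in> S \<Longrightarrow> g z + l \<bullet> (y w - y z) + \<kappa> * (norm (y w - y z))\<^sup>2 \<le> g w"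
  shows "almost_submean g z"
  unfolding almost_submean_def
proof (intro conjI int allI impI)
  fix \<eta> :: real assume "\<eta> > 0"
  then have ev: "\<forall>\<^sub>F r in at_right 0. \<bar>circle_average (\<lambda>w. l \<bullet> y w) z r - l \<bullet> y z\<bar>
      \<le> C * norm l * circle_average (\<lambda>w. (norm (y w - y z))\<^sup>2) z r + \<eta> * r\<^sup>2"
    using nh unfolding nearly_harmonic_def by blast
  obtain e where e: "e > 0" "ball z e \<subseteq> S" using S(1,2) open_contains_ball by blast
  show "\<forall>\<^sub>F r in at_right 0. g z \<le> circle_average g z r + \<eta> * r\<^sup>2"
    using ev int eventually_at_right_0_less[OF e(1)]
  proof eventually_elim
    case (elim r)
    let ?D = "circle_average (\<lambda>w. (norm (y w - y z))\<^sup>2) z r"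
    have sp: "sphere z r \<subseteq> S" using elim e by force
    have cy: "continuous_on (sphere z r) y" by (rule continuous_on_subset[OF S(3) sp])
    have i1: "circle_integrable (\<lambda>w. l \<bullet> y w) z r" and i2: "circle_integrable (\<lambda>w. (norm (y w - y z))\<^sup>2) z r"
      using elim by (intro circle_integrable_continuous continuous_intros cy; simp)+
    let ?q = "\<lambda>w. (g z - l \<bullet> y z) + (l \<bullet> y w + \<kappa> * (norm (y w - y z))\<^sup>2)"
    have iq: "circle_integrable ?q z r" by (intro circle_integrable_add circle_integrable_const i1 circle_integrable_scale i2)
    have "circle_average ?q z r \<le> circle_average g z r"
    proof (rule circle_average_mono[OF iq])
      fix w assume "dist z w = r"
      then have "w \<in> S" using sp by auto
      from le[OF this] show "?q w \<le> g w" by (simp add: inner_diff_right)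
    qed (use elim in auto)
    moreover have "circle_average ?q z r = (g z - l \<bullet> y z) + (circle_average (\<lambda>w. l \<bullet> y w) z r + \<kappa> * ?D)"
      by (simp only: circle_average_add[OF circle_integrable_const circle_integrable_add[OF i1 circle_integrable_scale[OF i2]]]
          circle_average_add[OF i1 circle_integrable_scale[OF i2]] circle_average_scale circle_average_const)
    moreover have "0 \<le> ?D"
      using circle_average_mono[OF circle_integrable_const[of 0 z r] i2] elim by (simp add: circle_average_const)
    then have "C * norm l * ?D \<le> \<kappa> * ?D" using l by (rule mult_right_mono[rotated])
    ultimately show ?case using elim(1) by linarith
  qed
qed

lemma norm_sq_expand:
  fixes y :: "'b::real_inner"
  shows "(norm (y' - q))\<^sup>2 = (norm (y - q))\<^sup>2 + (2 *\<^sub>R (y - q)) \<bullet> (y' - y) + (norm (y' - y))\<^sup>2"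
  by (simp only: power2_norm_eq_inner inner_simps) (simp add: inner_commute algebra_simps)

text \<open>The square of a nearly harmonic map with small oscillation is so strictly subharmonic that it
absorbs every linear function of norm at most \<open>1\<close>. Applied to \<open>v\<close> and \<open>- v\<close>, this controls linear
functions from both sides.\<close>

lemma almost_submean_norm_sq_plus_linear:
  fixes y :: "complex \<Rightarrow> 'b::real_inner"
  assumes nh: "nearly_harmonic C y z" and C: "C \<ge> 0" and S: "open S" "z \<in> S" "continuous_on S y"
    and v: "norm v \<le> 1" and q: "4 * C * norm (y z - q) \<le> 1"
  shows "almost_submean (\<lambda>w. 2 * C * (norm (y w - q))\<^sup>2 + v \<bullet> y w) z"
proof (rule almost_submean_of_quadratic_minorant[OF nh S, where l = "(4 * C) *\<^sub>R (y z - q) + v" and \<kappa> = "2 * C"])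
  have "norm ((4 * C) *\<^sub>R (y z - q) + v) \<le> 1 + 1"
    by (rule norm_triangle_le) (use v q C in simp)
  then have "C * norm ((4 * C) *\<^sub>R (y z - q) + v) \<le> C * (1 + 1)" using C by (rule mult_left_mono)
  then show "C * norm ((4 * C) *\<^sub>R (y z - q) + v) \<le> 2 * C" by simp
  obtain e where e: "e > 0" "ball z e \<subseteq> S" using S(1,2) open_contains_ball by blast
  show "\<forall>\<^sub>F r in at_right 0. circle_integrable (\<lambda>w. 2 * C * (norm (y w - q))\<^sup>2 + v \<bullet> y w) z r"
    using eventually_at_right_0_less[OF e(1)]
  proof eventually_elim
    case (elim r)
    have "continuous_on (sphere z r) y"
      by (rule continuous_on_subset[OF S(3)]) (use elim e in force)
    then show ?case using elim by (intro circle_integrable_continuous continuous_intros) auto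
  qed
  fix w
  have "2 * C * (norm (y w - q))\<^sup>2 = 2 * C * ((norm (y z - q))\<^sup>2 + (2 *\<^sub>R (y z - q)) \<bullet> (y w - y z) + (norm (y w - y z))\<^sup>2)"
    by (subst norm_sq_expand[of "y w" q "y z"]) simp
  then show "2 * C * (norm (y z - q))\<^sup>2 + v \<bullet> y z + ((4 * C) *\<^sub>R (y z - q) + v) \<bullet> (y w - y z)
      + 2 * C * (norm (y w - y z))\<^sup>2 \<le> 2 * C * (norm (y w - q))\<^sup>2 + v \<bullet> y w"
    by (simp add: inner_add_left inner_diff_right algebra_simps)
qed

text \<open>Let the oscillation on the disc of radius \<open>s\<close> around \<open>z1\<close> be \<open>\<omega>'\<close>. The reflection estimate for
\<open>2 C \<bar>y - y z1\<bar>\<^sup>2 \<plusminus> v \<bullet> y\<close> has the bound \<open>4 C \<omega>'\<^sup>2\<close> on the mirror line, as the linear parts cancel there, and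
exceeds it elsewhere by at most \<open>2 \<omega>'\<close>. On the disc of radius \<open>s / 64\<close> this leaves at most
\<open>4 C \<omega>'\<^sup>2 + \<omega>' / 16 \<le> \<omega>' / 8\<close>. Since \<open>1 / 8 = \<surd>(1 / 64)\<close>, iteration gives the exponent \<open>1/2\<close>.\<close>

theorem nearly_harmonic_holder_half:
  fixes y :: "complex \<Rightarrow> 'b::real_inner"
  assumes R: "R > 0" and y: "continuous_on (cball z1 R) y"
    and nh: "\<And>z. z \<in> ball z1 R \<Longrightarrow> nearly_harmonic C y z" and C: "C \<ge> 0"
    and \<omega>: "\<omega> \<ge> 0" "64 * C * \<omega> \<le> 1" "\<And>z. z \<in> cball z1 R \<Longrightarrow> norm (y z - y z1) \<le> \<omega>"
    and z: "z \<in> cball z1 R"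
  shows "norm (y z - y z1) \<le> 8 * \<omega> * sqrt (dist z z1 / R)"
proof -
  have step: "norm (y z2 - y z1) \<le> \<omega>' / 8"
    if s: "0 < s" "s \<le> R" and \<omega>': "0 \<le> \<omega>'" "64 * C * \<omega>' \<le> 1"
      and bd: "\<And>z. z \<in> cball z1 s \<Longrightarrow> norm (y z - y z1) \<le> \<omega>'" and z2: "z2 \<in> cball z1 (s / 64)"
    for s \<omega>' z2
  proof (cases "y z2 = y z1")
    case True
    then show ?thesis using \<omega>' by simp
  next
    case False
    \<comment> \<open>the direction in which the two values differ\<close>
    define v where "v = (1 / norm (y z2 - y z1)) *\<^sub>R (y z2 - y z1)"
    have v: "norm v = 1" "v \<bullet> (y z2 - y z1) = norm (y z2 - y z1)"
      using False unfolding v_def by (simp_all add: power2_norm_eq_inner[symmetric] power2_eq_square)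
    let ?m = "(z2 + z1) / 2"
    let ?g = "\<lambda>\<sigma> w. 2 * C * (norm (y w - y z1))\<^sup>2 + (\<sigma> *\<^sub>R v) \<bullet> y w"
    have dm: "dist z1 ?m \<le> s / 128"
    proof -
      have "z1 - ?m = (z1 - z2) / 2" by (simp add: field_simps)
      then have "dist z1 ?m = dist z1 z2 / 2" by (simp only: dist_norm norm_divide) simp
      then show ?thesis using z2 by simp
    qed
    have cb: "w \<in> ball z1 s" if "w \<in> cball ?m (s / 2)" for w
      using dist_triangle[of z1 w ?m] that dm s(1) by simp
    have y': "continuous_on (cball ?m (s / 2)) y"
      by (rule continuous_on_subset[OF y]) (use cb s in force)
    have small: "2 * C * (norm (y w - y z1))\<^sup>2 \<le> 2 * C * \<omega>'\<^sup>2" if "w \<in> ball z1 s" for w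
      using bd[of w] that C by (intro mult_left_mono power_mono) auto
    have almost_submean: "almost_submean (?g \<sigma>) w" if w: "w \<in> ball ?m (s / 2)" and \<sigma>: "\<sigma> \<in> {1, -1}" for w \<sigma>
    proof (rule almost_submean_norm_sq_plus_linear[OF nh C open_ball[of z1 s]])
      have ws: "w \<in> ball z1 s" using cb w by force
      then show "w \<in> ball z1 R" "w \<in> ball z1 s" using s by auto
      show "continuous_on (ball z1 s) y" by (rule continuous_on_subset[OF y]) (use s in auto)
      show "norm (\<sigma> *\<^sub>R v) \<le> 1" using v \<sigma> by auto
      have "4 * C * norm (y w - y z1) \<le> 4 * C * \<omega>'"
        using bd[of w] ws C by (intro mult_left_mono) auto
      then show "4 * C * norm (y w - y z1) \<le> 1" using \<omega>' C mult_nonneg_nonneg[of C \<omega>'] by linarith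
    qed
    have "?g 1 z2 + ?g (-1) z1 \<le> 4 * C * \<omega>'\<^sup>2 + ((4 * C * \<omega>'\<^sup>2 + 2 * \<omega>') - 4 * C * \<omega>'\<^sup>2) * (dist z2 z1 / (s / 2))"
    proof (rule reflection_estimate[where ?g1.0 = "?g 1" and ?g2.0 = "?g (-1)"])
      show "dist z2 z1 < 2 * (s / 2)" using z2 s by (simp add: dist_commute)
      show "usc_real (cball ?m (s / 2)) (?g 1)" "usc_real (cball ?m (s / 2)) (?g (-1))"
        by (intro usc_real_continuous continuous_intros y')+
      fix w assume w: "w \<in> cball ?m (s / 2)"
      show "?g 1 w + ?g (-1) w \<le> 4 * C * \<omega>'\<^sup>2" using small[OF cb[OF w]] by simp
      fix w' assume w': "w' \<in> cball ?m (s / 2)"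
      have "v \<bullet> (y w - y w') \<le> norm (y w - y w')" using norm_cauchy_schwarz[of v "y w - y w'"] v by simp
      also have "\<dots> \<le> 2 * \<omega>'"
        using norm_triangle_ineq4[of "y w - y z1" "y w' - y z1"] bd[of w] bd[of w'] cb[OF w] cb[OF w'] by simp
      finally show "?g 1 w + ?g (-1) w' \<le> 4 * C * \<omega>'\<^sup>2 + 2 * \<omega>'"
        using small[OF cb[OF w]] small[OF cb[OF w']] by (simp add: inner_diff_right)
    qed (use almost_submean[where \<sigma>=1] almost_submean[where \<sigma>="-1"] \<omega>' in simp_all)
    also have "\<dots> \<le> 4 * C * \<omega>'\<^sup>2 + 2 * \<omega>' * (1 / 32)"
    proof -
      have "dist z2 z1 / (s / 2) \<le> 1 / 32" using z2 s by (simp add: dist_commute field_simps)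
      then show ?thesis using \<omega>' mult_left_mono[of "dist z2 z1 / (s / 2)" "1/32" "2 * \<omega>'"] by simp
    qed
    also have "4 * C * \<omega>'\<^sup>2 \<le> \<omega>' / 16"
      using mult_right_mono[OF \<omega>'(2) \<omega>'(1)] by (simp add: power2_eq_square)
    finally have "2 * C * (norm (y z2 - y z1))\<^sup>2 + v \<bullet> (y z2 - y z1) \<le> \<omega>' / 8"
      by (simp add: inner_diff_right)
    moreover have "0 \<le> 2 * C * (norm (y z2 - y z1))\<^sup>2" using C by simp
    ultimately show ?thesis using v(2) by linarith
  qed
  have iter: "norm (y z - y z1) \<le> \<omega> / 8 ^ n" if "z \<in> cball z1 (R / 64 ^ n)" for n z
    using that
  proof (induction n arbitrary: z)
    case 0
    then show ?case using \<omega>(3) by simp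
  next
    case (Suc n)
    have "norm (y z - y z1) \<le> (\<omega> / 8 ^ n) / 8"
    proof (rule step[of "R / 64 ^ n"])
      show "R / 64 ^ n \<le> R" using R by (simp add: divide_le_eq mult_le_cancel_left1)
      have "\<omega> / 8 ^ n \<le> \<omega>" using \<omega>(1) by (simp add: divide_le_eq mult_le_cancel_left1)
      then show "64 * C * (\<omega> / 8 ^ n) \<le> 1"
        using \<omega>(2) C by (smt (verit) mult_left_mono mult_nonneg_nonneg)
    qed (use Suc R \<omega> in \<open>auto simp: mult.commute\<close>)
    then show ?case by (simp add: mult.commute)
  qed
  show ?thesis
  proof (cases "z = z1")
    case False
    let ?t = "dist z z1 / R"
    have t: "0 < ?t" "?t \<le> 1" using False R z by (auto simp: dist_commute)
    have "\<exists>n. (1 / 64 :: real) ^ n < ?t" using real_arch_pow_inv[of ?t "1/64"] t by simp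
    define n where "n = (LEAST n. (1 / 64 :: real) ^ n < ?t)"
    have n: "(1 / 64 :: real) ^ n < ?t" unfolding n_def by (rule LeastI_ex) fact
    have "n \<noteq> 0" using n t by (auto intro: ccontr)
    then obtain k where k: "n = Suc k" by (cases n) auto
    have "\<not> (1 / 64 :: real) ^ k < ?t" using not_less_Least[of k "\<lambda>n. (1 / 64 :: real) ^ n < ?t"] k n_def by auto
    then have "z \<in> cball z1 (R / 64 ^ k)"
      using R by (simp add: dist_commute power_divide field_simps)
    then have "norm (y z - y z1) \<le> \<omega> / 8 ^ k" by (rule iter)
    also have "\<dots> = 8 * \<omega> * (1 / 8) ^ n" by (simp add: k power_divide)
    also have "(1 / 8 :: real) ^ n \<le> sqrt ?t"
    proof (rule real_le_rsqrt)
      have "((1 / 8 :: real) ^ n)\<^sup>2 = (1 / 64) ^ n" by (simp add: power2_eq_square flip: power_mult_distrib)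
      then show "((1 / 8 :: real) ^ n)\<^sup>2 \<le> ?t" using n by simp
    qed
    finally show ?thesis using \<omega>(1) by (simp add: mult_left_mono)
  qed simp
qed

section \<open>Linear decay at the boundary arc\<close>

text \<open>Points of the circle near \<open>a\<close> are \<open>cis (\<theta> + Arg (c / a))\<close>, where \<open>a = cis \<theta>\<close>, with an argument close to \<open>\<theta>\<close>.\<close>

lemma open_arc_neighbourhood:
  assumes "open_arc \<gamma>" "a \<in> \<gamma>"
  shows "norm a = 1" "\<exists>r>0. \<forall>c. norm c = 1 \<and> dist c a < r \<longrightarrow> c \<in> \<gamma>"
proof -
  obtain \<alpha> \<beta> where \<gamma>: "\<gamma> = cis ` {\<alpha><..<\<beta>}" using assms(1) unfolding open_arc_def by blast
  then obtain \<theta> where \<theta>: "\<alpha> < \<theta>" "\<theta> < \<beta>" "a = cis \<theta>" using assms(2) by auto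
  show a: "norm a = 1" using \<theta> by simp
  define \<eta> where "\<eta> = min (\<theta> - \<alpha>) (\<beta> - \<theta>)"
  have "\<eta> > 0" using \<theta> unfolding \<eta>_def by simp
  moreover have "isCont Arg 1" by (rule continuous_at_Arg) (simp add: complex_nonpos_Reals_iff)
  ultimately obtain r where r: "r > 0" "\<And>z. dist z 1 < r \<Longrightarrow> dist (Arg z) (Arg 1) < \<eta>"
    unfolding continuous_at_eps_delta by blast
  show "\<exists>r>0. \<forall>c. norm c = 1 \<and> dist c a < r \<longrightarrow> c \<in> \<gamma>"
  proof (intro exI[of _ r] conjI r(1) allI impI)
    fix c assume c: "norm c = 1 \<and> dist c a < r"
    have "a \<noteq> 0" using a by auto
    then have "c / a - 1 = (c - a) / a" by (simp add: field_simps)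
    then have "dist (c / a) 1 = dist c a" using a by (simp add: dist_norm norm_divide)
    then have \<phi>: "\<bar>Arg (c / a)\<bar> < \<eta>" using r(2)[of "c / a"] c by (simp add: dist_real_def)
    have "cis (Arg (c / a)) = c / a"
    proof -
      have "c / a \<noteq> 0" using c a by force
      then show ?thesis using cis_Arg[of "c / a"] c a by (simp add: sgn_div_norm norm_divide)
    qed
    then have "c = cis (\<theta> + Arg (c / a))" using a \<theta>(3) by (auto simp: cis_mult[symmetric])
    moreover have "\<theta> + Arg (c / a) \<in> {\<alpha><..<\<beta>}" using \<phi> unfolding \<eta>_def by auto
    ultimately show "c \<in> \<gamma>" unfolding \<gamma> by blast
  qed
qed

text \<open>For \<open>b\<close> on the circle, \<open>1 - Re (z \<cdot> cnj b)\<close> is affine, nonnegative on the closed disc, at least \<open>s\<^sup>2 / 2\<close>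
at distance \<open>s\<close> from \<open>b\<close>, and equal to \<open>1 - \<bar>z\<bar>\<close> on the radius through \<open>b\<close>. To apply the maximum
principle on a compact set, \<open>w\<close> is extended by its boundary value \<open>0\<close>.\<close>

lemma boundary_decay_radial:
  fixes w :: "complex \<Rightarrow> real"
  assumes b: "norm b = 1" and s: "s > 0" and usc: "usc_real unit_disc w"
    and sub: "\<And>z. z \<in> unit_disc \<Longrightarrow> almost_submean w z"
    and le1: "\<And>z. z \<in> unit_disc \<Longrightarrow> dist z b \<le> s \<Longrightarrow> w z \<le> 1"
    and lim: "\<And>c. norm c = 1 \<Longrightarrow> dist c b \<le> s \<Longrightarrow> (w \<longlongrightarrow> 0) (at c within unit_disc)"
    and z: "z \<in> unit_disc" "z = of_real (norm z) * b" "1 - norm z \<le> s"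
  shows "w z \<le> (2 / s\<^sup>2) * (1 - norm z)"
proof -
  let ?K = "cball (0::complex) 1 \<inter> cball b s"
  \<comment> \<open>upper semicontinuous up to the boundary because \<open>w\<close> tends to \<open>0\<close> at the arc\<close>
  define v where "v = (\<lambda>z. if norm z < 1 then w z else 0)"
  define h where "h = (\<lambda>z. - (2 / s\<^sup>2) * (1 - (Re z * Re b + Im z * Im b)))"
  have bb: "(Re b)\<^sup>2 + (Im b)\<^sup>2 = 1" using b cmod_power2[of b] by simp
  have le: "Re z * Re b + Im z * Im b \<le> norm z" for z
    using complex_Re_le_cmod[of "z * cnj b"] b by (simp add: norm_mult)
  have "v z + h z \<le> 0"
  proof (rule max_principle[of ?K])
    show "compact ?K" by (intro compact_Int compact_cball)
    have "usc_real ?K v"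
      unfolding usc_real_def
    proof (intro ballI allI impI)
      fix y c assume y: "y \<in> ?K" and c: "v y < c"
      show "\<forall>\<^sub>F x in at y within ?K. v x < c"
      proof (cases "norm y < 1")
        case True
        obtain e where e: "e > 0" "\<And>x. x \<in> unit_disc \<Longrightarrow> dist x y < e \<Longrightarrow> w x < c"
          using usc_realD[OF usc, of y c] True c unfolding v_def by auto
        have "dist x y < 1 - norm y \<Longrightarrow> norm x < 1" for x
          using norm_triangle_ineq2[of x y] by (simp add: dist_norm)
        then show ?thesis
          unfolding eventually_at using e True
          by (intro exI[of _ "min e (1 - norm y)"]) (auto simp: v_def)
      next
        case False
        then have ny: "norm y = 1" using y by simp
        have c0: "c > 0" using c False unfolding v_def by simp
        have "\<forall>\<^sub>F x in at y within unit_disc. w x < c"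
          using lim[OF ny] y c0 by (auto simp: order_tendsto_iff dist_commute)
        then obtain e where e: "e > 0" "\<And>x. x \<in> unit_disc \<Longrightarrow> x \<noteq> y \<Longrightarrow> dist x y < e \<Longrightarrow> w x < c"
          unfolding eventually_at by blast
        then show ?thesis
          unfolding eventually_at using c0
          by (intro exI[of _ e]) (auto simp: v_def)
      qed
    qed
    moreover have "continuous_on ?K h" unfolding h_def by (intro continuous_intros)
    ultimately show "usc_real ?K (\<lambda>z. v z + h z)" by (rule usc_real_add[OF _ usc_real_continuous])
    show "z \<in> ?K"
    proof -
      have "b - z = of_real (1 - norm z) * b" by (subst z(2)) (simp add: algebra_simps)
      then have "dist b z = \<bar>1 - norm z\<bar> * norm b" by (simp only: dist_norm norm_mult norm_of_real)
      then have "dist b z = 1 - norm z" using b z(1) by simp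
      then show ?thesis using z by simp
    qed
    fix y assume y: "y \<in> ?K"
    consider "norm y = 1" | "norm y < 1" "dist y b = s" | "norm y < 1" "dist y b < s"
      using y by (force simp: dist_commute)
    then show "v y + h y \<le> 0 \<or> y \<in> interior ?K \<and> almost_submean (\<lambda>z. v z + h z) y"
    proof cases
      case 1
      then show ?thesis using le[of y] unfolding v_def h_def by simp
    next
      case 2
      have "v y \<le> 1" using le1[of y] 2 unfolding v_def by simp
      moreover have "s\<^sup>2 / 2 \<le> 1 - (Re y * Re b + Im y * Im b)"
      proof -
        have "s\<^sup>2 = (norm (y - b))\<^sup>2" using 2 by (simp add: dist_norm)
        also have "\<dots> = (norm y)\<^sup>2 + 1 - 2 * (Re y * Re b + Im y * Im b)"
          using bb unfolding cmod_power2 by (simp add: power2_eq_square algebra_simps)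
        also have "(norm y)\<^sup>2 \<le> 1" using 2 by (simp add: power_le_one)
        finally show ?thesis by simp
      qed
      then have "(2 / s\<^sup>2) * (s\<^sup>2 / 2) \<le> (2 / s\<^sup>2) * (1 - (Re y * Re b + Im y * Im b))"
        using s by (intro mult_left_mono) auto
      moreover have "(2 / s\<^sup>2) * (s\<^sup>2 / 2) = 1" using s by simp
      ultimately have "v y + h y \<le> 0" unfolding h_def by linarith
      then show ?thesis ..
    next
      case 3
      have "y \<in> interior ?K"
        by (rule interiorI[of "ball 0 1 \<inter> ball b s"]) (use 3 in \<open>auto simp: dist_commute\<close>)
      moreover have "almost_submean v y"
        by (rule almost_submean_cong[OF sub, of y unit_disc]) (use 3 in \<open>auto simp: v_def\<close>)
      moreover have "almost_submean h y"
        by (rule almost_submean_harmonic_qform[where p = "2 / s\<^sup>2 * Re b" and q = "2 / s\<^sup>2 * Im b" and a = 0 and b = 0])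
           (simp add: h_def qform_def algebra_simps add_divide_distrib)
      ultimately show ?thesis by (auto intro: almost_submean_add)
    qed
  qed
  moreover have "Re z * Re b + Im z * Im b = norm z"
  proof -
    have "Re z = norm z * Re b" "Im z = norm z * Im b" using arg_cong[OF z(2), of Re] arg_cong[OF z(2), of Im] by simp_all
    then have "Re z * Re b + Im z * Im b = norm z * ((Re b)\<^sup>2 + (Im b)\<^sup>2)"
      by (metis distrib_left mult.assoc power2_eq_square)
    then show ?thesis using bb by simp
  qed
  ultimately show ?thesis using z(1) unfolding v_def h_def by simp
qed

theorem boundary_decay:
  fixes w :: "complex \<Rightarrow> real"
  assumes a: "norm a = 1" and r: "0 < r" "r \<le> 1" and usc: "usc_real unit_disc w"
    and sub: "\<And>z. z \<in> unit_disc \<Longrightarrow> almost_submean w z"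
    and le1: "\<And>z. z \<in> unit_disc \<Longrightarrow> dist z a < r \<Longrightarrow> w z \<le> 1"
    and lim: "\<And>c. norm c = 1 \<Longrightarrow> dist c a < r \<Longrightarrow> (w \<longlongrightarrow> 0) (at c within unit_disc)"
    and z: "z \<in> unit_disc" "dist z a < r / 4"
  shows "w z \<le> (32 / r\<^sup>2) * (1 - norm z)"
proof -
  have zn: "1 - norm z < r / 4" using z a norm_triangle_ineq2[of a z] by (simp add: dist_norm norm_minus_commute)
  then have z0: "z \<noteq> 0" using r by auto
  define b where "b = z / of_real (norm z)"
  have b: "norm b = 1" "z = of_real (norm z) * b" using z0 unfolding b_def by (auto simp: norm_divide)
  have "dist b z = dist b (of_real (norm z) * b)" by (rule arg_cong[OF b(2)])
  also have "\<dots> = norm (of_real (1 - norm z) * b)" by (simp add: dist_norm algebra_simps)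
  finally have "dist b z = \<bar>1 - norm z\<bar> * norm b" by (simp only: norm_mult norm_of_real)
  then have bz: "dist b z = 1 - norm z" using b(1) z(1) by simp
  have near: "dist c a < r" if "dist c b \<le> r / 4" for c
    using dist_triangle[of c a b] dist_triangle[of b a z] bz zn z(2) that r by linarith
  have "w z \<le> (2 / (r / 4)\<^sup>2) * (1 - norm z)"
    by (rule boundary_decay_radial[OF b(1) _ usc sub _ _ z(1) b(2)])
       (use near le1 lim zn r in auto)
  then show ?thesis by (simp add: power_divide)
qed

section \<open>Chains of steps towards the boundary\<close>

text \<open>Near \<open>a\<close>, moving in the direction \<open>- a\<close> increases the distance to the circle at a rate between
\<open>1/2\<close> and \<open>1\<close>.\<close>

lemma norm_push:
  fixes a z :: complex
  assumes a: "norm a = 1" and z: "dist z a < 1/4" and t: "0 \<le> t" "t < 1/4"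
  shows "norm (z - of_real t * a) \<le> norm z - t / 2" "norm z - t \<le> norm (z - of_real t * a)"
proof -
  have aa: "(Re a)\<^sup>2 + (Im a)\<^sup>2 = 1" using a cmod_power2[of a] by simp
  let ?p = "Re z * Re a + Im z * Im a"
  have "(norm (z - of_real t * a))\<^sup>2 = (norm z)\<^sup>2 - 2 * t * ?p + t\<^sup>2 * ((Re a)\<^sup>2 + (Im a)\<^sup>2)"
    unfolding cmod_power2 by (simp add: power2_eq_square algebra_simps)
  then have e: "(norm (z - of_real t * a))\<^sup>2 = (norm z)\<^sup>2 - 2 * t * ?p + t\<^sup>2" using aa by simp
  have "1 - ?p = Re ((a - z) * cnj a)" using aa by (simp add: power2_eq_square algebra_simps)
  also have "\<dots> \<le> norm ((a - z) * cnj a)" by (rule complex_Re_le_cmod)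
  also have "\<dots> = dist z a" using a by (simp add: norm_mult dist_norm norm_minus_commute)
  finally have p: "?p \<ge> 3/4" using z by simp
  have nz: "3/4 \<le> norm z" "norm z \<le> 5/4"
    using z a norm_triangle_ineq2[of a z] norm_triangle_ineq2[of z a] by (simp_all add: dist_norm norm_minus_commute)
  have "t * (norm z + t * (3/4)) \<le> t * (2 * ?p)"
    using p nz t by (intro mult_left_mono) auto
  then have "(norm (z - of_real t * a))\<^sup>2 \<le> (norm z - t / 2)\<^sup>2"
    unfolding e by (simp add: power2_eq_square algebra_simps)
  then show "norm (z - of_real t * a) \<le> norm z - t / 2"
    by (rule power2_le_imp_le) (use nz t in simp)
  show "norm z - t \<le> norm (z - of_real t * a)"
    using norm_triangle_ineq2[of z "of_real t * a"] a t by (simp add: norm_mult)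
qed

text \<open>Both points are pushed in the direction \<open>- a\<close> by \<open>8 \<bar>z1 - z2\<bar>\<close>; then their distance to the circle is
at least four times their mutual distance, and one step joins them. All points are translated by the same vector,
so that their difference is preserved. Along each push, steps proportional to the distance to the circle
give a geometric series of square roots, which is summed by induction on the number of steps.\<close>

theorem hardy_littlewood_chain:
  fixes Y :: "complex \<Rightarrow> 'b::real_normed_vector"
  assumes a: "norm a = 1" and s: "0 < s" "s \<le> 1/4" and C: "C \<ge> 0"
    and step: "\<And>z1 z2. z1 \<in> unit_disc \<Longrightarrow> z2 \<in> unit_disc \<Longrightarrow> dist z1 a < s \<Longrightarrow> dist z2 a < s \<Longrightarrow>
      dist z1 z2 \<le> (1 - norm z1) / 4 \<Longrightarrow> norm (Y z1 - Y z2) \<le> C * sqrt (1 - norm z1)"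
    and z: "z1 \<in> unit_disc" "z2 \<in> unit_disc" "dist z1 a < s / 20" "dist z2 a < s / 20"
  shows "norm (Y z1 - Y z2) \<le> 400 * C * (sqrt (1 - norm z1) + sqrt (1 - norm z2) + sqrt (dist z1 z2))"
proof -
  let ?p = "\<lambda>z t. z - of_real t * a"
  have near: "dist (?p z t) a < s" "?p z t \<in> unit_disc" "norm (?p z t) \<le> norm z - t / 2"
      "norm z - t \<le> norm (?p z t)"
    if "z \<in> unit_disc" "0 \<le> t" "dist z a + t < s" for z t
  proof -
    have "dist (?p z t) a \<le> dist z a + t"
      using norm_triangle_ineq4[of "z - a" "of_real t * a"] a that by (simp add: dist_norm norm_mult algebra_simps)
    then show "dist (?p z t) a < s" using that by simp
    show "norm (?p z t) \<le> norm z - t / 2" "norm z - t \<le> norm (?p z t)"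
      using norm_push[OF a, of z t] that s zero_le_dist[of z a] by auto
    then show "?p z t \<in> unit_disc" using that by simp
  qed
  \<comment> \<open>on the last ninth of the way, a single step, \<open>Y\<close> changes by at most \<open>3 * C * sqrt t\<close>; as \<open>sqrt (8/9) \<le> 19/20\<close>, the constant 60 reproduces itself: \<open>3 + 60 * (19/20) = 60\<close>\<close>
  have push: "norm (Y z - Y (?p z t)) \<le> C * sqrt (1 - norm z) + 60 * C * sqrt t"
    if z: "z \<in> unit_disc" "0 \<le> t" "dist z a + t < s" and n: "t \<le> (9/8) ^ n * ((1 - norm z) / 4)" for z t n
    using that(2-)
  proof (induction n arbitrary: t)
    case 0
    have "dist z (?p z t) = t" using a 0 by (simp add: dist_norm norm_mult)
    then have "norm (Y z - Y (?p z t)) \<le> C * sqrt (1 - norm z)"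
      using step[of z "?p z t"] near[OF z(1), of t] 0 z by simp
    moreover have "0 \<le> 60 * C * sqrt t" using C 0 by simp
    ultimately show ?case by linarith
  next
    case (Suc n)
    show ?case
    proof (cases "t \<le> (1 - norm z) / 4")
      case True
      have "dist z (?p z t) = t" using a Suc.prems by (simp add: dist_norm norm_mult)
      then have "norm (Y z - Y (?p z t)) \<le> C * sqrt (1 - norm z)"
        using step[of z "?p z t"] near[OF z(1), of t] Suc.prems True z by simp
      moreover have "0 \<le> 60 * C * sqrt t" using C Suc.prems by simp
      ultimately show ?thesis by linarith
    next
      case False
      let ?u = "8 * t / 9"
      have u: "0 \<le> ?u" "dist z a + ?u < s" using Suc.prems by auto
      have IH: "norm (Y z - Y (?p z ?u)) \<le> C * sqrt (1 - norm z) + 60 * C * sqrt ?u"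
        by (rule Suc.IH) (use u Suc.prems in auto)
      note nu = near[OF z(1) u] and nt = near[OF z(1) Suc.prems(1,2)]
      have "?p z ?u - ?p z t = of_real (t / 9) * a" by (simp add: field_simps)
      then have "dist (?p z ?u) (?p z t) = t / 9" using a Suc.prems(1) by (simp only: dist_norm norm_mult) simp
      also have "\<dots> \<le> (1 - norm (?p z ?u)) / 4" using nu(3) z(1) by simp
      finally have "norm (Y (?p z ?u) - Y (?p z t)) \<le> C * sqrt (1 - norm (?p z ?u))"
        by (intro step nu nt)
      also have "\<dots> \<le> C * (3 * sqrt t)"
      proof (intro mult_left_mono C)
        have "1 - norm (?p z ?u) \<le> 3\<^sup>2 * t" using nu(4) False Suc.prems by simp
        then have "sqrt (1 - norm (?p z ?u)) \<le> sqrt (3\<^sup>2 * t)" by (rule real_sqrt_le_mono)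
        then show "sqrt (1 - norm (?p z ?u)) \<le> 3 * sqrt t" by (simp add: real_sqrt_mult)
      qed
      finally have 1: "norm (Y (?p z ?u) - Y (?p z t)) \<le> C * (3 * sqrt t)" .
      have "sqrt ?u \<le> sqrt ((19/20)\<^sup>2 * t)"
        by (rule real_sqrt_le_mono) (use Suc.prems in \<open>simp add: power2_eq_square\<close>)
      then have "60 * C * sqrt ?u \<le> 60 * C * (19/20 * sqrt t)"
        using C by (intro mult_left_mono) (simp_all add: real_sqrt_mult)
      then show ?thesis
        using IH 1 norm_triangle_ineq[of "Y z - Y (?p z ?u)" "Y (?p z ?u) - Y (?p z t)"] by simp
    qed
  qed
  have push': "norm (Y z - Y (?p z t)) \<le> C * sqrt (1 - norm z) + 60 * C * sqrt t"
    if z: "z \<in> unit_disc" "0 \<le> t" "dist z a + t < s" for z t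
  proof -
    have d: "(1 - norm z) / 4 > 0" using z by simp
    obtain n where "t / ((1 - norm z) / 4) < (9/8) ^ n" using real_arch_pow[of "9/8"] by auto
    then have "t \<le> (9/8) ^ n * ((1 - norm z) / 4)" using d by (simp only: pos_divide_less_eq less_imp_le)
    then show ?thesis by (rule push[OF z])
  qed
  let ?d = "dist z1 z2" and ?t = "8 * dist z1 z2"
  have d: "?d < s / 10" using dist_triangle2[of z1 z2 a] z by simp
  have t: "0 \<le> ?t" "dist z1 a + ?t < s" "dist z2 a + ?t < s" using d z s by simp_all
  note n1 = near[OF z(1) t(1,2)] and n2 = near[OF z(2) t(1,3)]
  have "dist (?p z1 ?t) (?p z2 ?t) = ?d" by (simp add: dist_norm)
  also have "\<dots> \<le> (1 - norm (?p z1 ?t)) / 4" using n1(3) z(1) by simp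
  finally have "norm (Y (?p z1 ?t) - Y (?p z2 ?t)) \<le> C * sqrt (1 - norm (?p z1 ?t))"
    by (intro step n1 n2)
  also have "\<dots> \<le> C * (sqrt (1 - norm z1) + sqrt ?t)"
  proof (intro mult_left_mono C)
    have "sqrt (1 - norm (?p z1 ?t)) \<le> sqrt ((1 - norm z1) + ?t)" using n1(4) by (intro real_sqrt_le_mono) simp
    also have "\<dots> \<le> sqrt (1 - norm z1) + sqrt ?t" using z(1) by (intro sqrt_add_le_add_sqrt) auto
    finally show "sqrt (1 - norm (?p z1 ?t)) \<le> sqrt (1 - norm z1) + sqrt ?t" .
  qed
  finally have mid: "norm (Y (?p z1 ?t) - Y (?p z2 ?t)) \<le> C * (sqrt (1 - norm z1) + sqrt ?t)" .
  have "norm (Y z1 - Y z2) \<le> norm (Y z1 - Y (?p z1 ?t)) + norm (Y (?p z1 ?t) - Y (?p z2 ?t)) + norm (Y z2 - Y (?p z2 ?t))"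
    using norm_triangle_ineq[of "Y z1 - Y (?p z1 ?t)" "Y (?p z1 ?t) - Y z2"]
      norm_triangle_ineq4[of "Y (?p z1 ?t) - Y (?p z2 ?t)" "Y z2 - Y (?p z2 ?t)"] by simp
  also have "\<dots> \<le> C * (2 * sqrt (1 - norm z1) + sqrt (1 - norm z2) + 121 * sqrt ?t)"
    using push'[OF z(1) t(1,2)] push'[OF z(2) t(1,3)] mid by (simp add: algebra_simps)
  also have "\<dots> \<le> C * (400 * (sqrt (1 - norm z1) + sqrt (1 - norm z2) + sqrt ?d))"
  proof (intro mult_left_mono C)
    have "sqrt ?t \<le> sqrt (3\<^sup>2 * ?d)" by (rule real_sqrt_le_mono) simp
    then have "sqrt ?t \<le> 3 * sqrt ?d" by (simp add: real_sqrt_mult)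
    moreover have "0 \<le> sqrt (1 - norm z1)" "0 \<le> sqrt (1 - norm z2)" "0 \<le> sqrt ?d" using z by auto
    ultimately show "2 * sqrt (1 - norm z1) + sqrt (1 - norm z2) + 121 * sqrt ?t
        \<le> 400 * (sqrt (1 - norm z1) + sqrt (1 - norm z2) + sqrt ?d)" unfolding distrib_left by linarith
  qed
  finally show ?thesis by (simp add: mult.assoc mult.left_commute)
qed

section \<open>Integrals over squares\<close>

text \<open>The square with centre \<open>z\<close> and half side \<open>h\<close>. Squares are boxes, over which parameter integrals may be
differentiated.\<close>

definition cell :: "complex \<Rightarrow> real \<Rightarrow> complex set" where
  "cell z h = cbox (z - Complex h h) (z + Complex h h)"

lemma mem_cell: "w \<in> cell z h \<longleftrightarrow> \<bar>Re (w - z)\<bar> \<le> h \<and> \<bar>Im (w - z)\<bar> \<le> h"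
  by (auto simp: cell_def in_cbox_complex_iff abs_le_iff)

lemma cball_subset_cell: "cball z h \<subseteq> cell z h"
proof
  fix w assume "w \<in> cball z h"
  then have "norm (w - z) \<le> h" by (simp add: dist_norm norm_minus_commute)
  then show "w \<in> cell z h"
    unfolding mem_cell using abs_Re_le_cmod[of "w - z"] abs_Im_le_cmod[of "w - z"] by linarith
qed

lemma cell_subset_ball:
  assumes "h > 0"
  shows "cell z h \<subseteq> ball z (2 * h)"
proof
  fix w assume "w \<in> cell z h"
  then have *: "\<bar>Re (w - z)\<bar> \<le> h" "\<bar>Im (w - z)\<bar> \<le> h" unfolding mem_cell by auto
  have "(norm (w - z))\<^sup>2 \<le> h\<^sup>2 + h\<^sup>2"
    unfolding cmod_power2 by (intro add_mono) (use * in \<open>simp_all add: abs_le_square_iff[symmetric]\<close>)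
  also have "\<dots> < (2 * h)\<^sup>2" using assms by (simp add: power2_eq_square)
  finally have "norm (w - z) < 2 * h" using assms by (intro power2_less_imp_less[of _ "2*h"]) auto
  then show "w \<in> ball z (2 * h)" by (simp add: dist_norm norm_minus_commute)
qed

lemma compact_cell: "compact (cell z h)"
  by (simp add: cell_def compact_cbox)

lemma set_integral_cell:
  fixes f :: "complex \<Rightarrow> real"
  assumes "continuous_on (cell z h) f"
  shows "(LINT w:cell z h|lborel. f w) = integral (cell z h) f"
  by (rule set_borel_integral_eq_integral)
     (use borel_integrable_compact[OF compact_cell assms] in \<open>simp add: set_integrable_def\<close>)

lemma integrable_on_cell:
  fixes f :: "complex \<Rightarrow> real"
  assumes "continuous_on (cell z h) f"
  shows "f integrable_on (cell z h)"
  using assms unfolding cell_def by (rule integrable_continuous)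

text \<open>The integral of \<open>T\<close> does not change under translation of \<open>T\<close>, and its derivative with respect
to the translation is the integral of the directional derivative.\<close>

lemma integral_directional_derivative_zero:
  fixes T :: "complex \<Rightarrow> real"
  assumes T: "smooth_on T UNIV" and supp: "\<And>z. z \<notin> ball z0 r \<Longrightarrow> T z = 0"
    and r: "r < h" and b: "norm b = 1"
  shows "integral (cell z0 h) (\<lambda>z. frechet_derivative T (at z) b) = 0"
proof -
  let ?U = "{-(h - r)<..<h - r}" and ?D = "\<lambda>z. frechet_derivative T (at z) b"
  have cT: "continuous_on UNIV T" by (rule smooth_on_imp_continuous_on[OF T])
  have cD: "continuous_on UNIV ?D"
    by (rule smooth_on_imp_continuous_on[OF smooth_on_frechet_derivative[OF T]])
  have lin: "linear (frechet_derivative T (at z))" for z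
    using smooth_on_differentiable[OF T] linear_frechet_derivative by blast
  have "((\<lambda>t. integral (cbox (z0 - Complex h h) (z0 + Complex h h)) (\<lambda>z. T (z + t *\<^sub>R b))) has_field_derivative
      integral (cbox (z0 - Complex h h) (z0 + Complex h h)) (\<lambda>z. ?D (z + 0 *\<^sub>R b))) (at 0 within ?U)"
  proof (rule leibniz_rule_field_derivative)
    fix t z
    have "((\<lambda>t. z + t *\<^sub>R b) has_derivative (\<lambda>s. s *\<^sub>R b)) (at t within ?U)"
      by (auto intro!: derivative_eq_intros)
    moreover have "(T has_derivative frechet_derivative T (at (z + t *\<^sub>R b))) (at (z + t *\<^sub>R b))"
      by (rule has_derivative_frechet[OF smooth_on_differentiable[OF T]]) simp
    ultimately have "((\<lambda>t. T (z + t *\<^sub>R b)) has_derivative (\<lambda>s. frechet_derivative T (at (z + t *\<^sub>R b)) (s *\<^sub>R b))) (at t within ?U)"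
      by (rule has_derivative_compose)
    then show "((\<lambda>t. T (z + t *\<^sub>R b)) has_field_derivative ?D (z + t *\<^sub>R b)) (at t within ?U)"
      by (simp add: has_field_derivative_def linear_cmul[OF lin] mult_commute_abs)
  next
    fix t show "(\<lambda>z. T (z + t *\<^sub>R b)) integrable_on cbox (z0 - Complex h h) (z0 + Complex h h)"
      by (intro integrable_continuous continuous_on_compose2[OF cT] continuous_intros) auto
  next
    show "continuous_on (?U \<times> cbox (z0 - Complex h h) (z0 + Complex h h)) (\<lambda>(t, z). ?D (z + t *\<^sub>R b))"
      unfolding split_beta by (intro continuous_on_compose2[OF cD] continuous_intros) auto
  qed (use r in auto)
  then have D: "((\<lambda>t. integral (cell z0 h) (\<lambda>z. T (z + t *\<^sub>R b))) has_field_derivative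
      integral (cell z0 h) ?D) (at 0)"
    using r at_within_open[of 0 ?U] by (simp add: cell_def)
  have "integral (cell z0 h) (\<lambda>z. T (z + t *\<^sub>R b)) = (LINT z|lborel. T z)" if t: "t \<in> ?U" for t
  proof -
    have ct: "continuous_on (cell z0 h) (\<lambda>z. T (z + t *\<^sub>R b))"
      by (intro continuous_on_compose2[OF cT] continuous_intros) auto
    have ind: "indicator (cell z0 h) z *\<^sub>R T (z + t *\<^sub>R b) = T (t *\<^sub>R b + 1 *\<^sub>R z)" for z
    proof (cases "z \<in> cell z0 h")
      case False
      then have "z \<notin> cball z0 h" using cball_subset_cell by blast
      then have n: "h < norm (z - z0)" by (simp add: dist_norm norm_minus_commute)
      have "norm (z - z0) \<le> norm (z + t *\<^sub>R b - z0) + norm (t *\<^sub>R b)"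
        using norm_triangle_ineq4[of "z + t *\<^sub>R b - z0" "t *\<^sub>R b"] by simp
      then have "r < norm (z + t *\<^sub>R b - z0)" using n t b by auto
      then have "T (z + t *\<^sub>R b) = 0" by (intro supp) (simp add: dist_norm norm_minus_commute)
      then show ?thesis by (simp add: add.commute)
    qed (simp add: add.commute)
    have "integral (cell z0 h) (\<lambda>z. T (z + t *\<^sub>R b)) = (LINT z|lborel. T (t *\<^sub>R b + 1 *\<^sub>R z))"
      unfolding set_integral_cell[OF ct, symmetric] set_lebesgue_integral_def ind ..
    also have "\<dots> = (LINT z|lborel. T z)"
      using lborel_integral_affine[of 1 T "t *\<^sub>R b"] by simp
    finally show ?thesis .
  qed
  then have "((\<lambda>t. integral (cell z0 h) (\<lambda>z. T (z + t *\<^sub>R b))) has_field_derivative 0) (at 0)"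
    using r by (intro has_field_derivative_transform_within_open[OF DERIV_const[of "LINT z|lborel. T z"], of ?U]) auto
  then show ?thesis using D DERIV_unique by blast
qed

lemma integration_by_parts_bump:
  fixes H :: "complex \<Rightarrow> real"
  assumes H: "smooth_on H (ball z0 (2 * h))" and r: "0 < r" "r < h" and b: "norm b = 1"
  shows "integral (cell z0 h) (\<lambda>z. frechet_derivative (bump z0 r) (at z) b * H z
      + bump z0 r z * frechet_derivative H (at z) b) = 0"
proof -
  let ?B = "ball z0 (2 * h)"
  define T where "T = (\<lambda>z. if z \<in> ?B then bump z0 r z * H z else 0)"
  have h: "h > 0" using r by simp
  have sB: "smooth_on (\<lambda>z. bump z0 r z * H z) ?B"
    by (intro smooth_on_bilinear[OF bounded_bilinear_mult] smooth_on_bump H) auto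
  have T0: "T z = 0" if "z \<notin> ball z0 r" for z
    using bump_outside[OF r(1) that] unfolding T_def by simp
  have "smooth_on T UNIV"
  proof (rule smooth_on_local)
    fix z
    show "\<exists>S. open S \<and> z \<in> S \<and> smooth_on T S"
    proof (cases "z \<in> ?B")
      case True
      have "smooth_on T ?B" by (rule smooth_on_cong[OF _ _ sB]) (auto simp: T_def)
      then show ?thesis using True by blast
    next
      case False
      have "smooth_on T (- cball z0 r)"
        by (rule smooth_on_cong[OF _ _ smooth_on_const[of 0]]) (use T0 in auto)
      then show ?thesis using False r by (intro exI[of _ "- cball z0 r"]) auto
    qed
  qed
  from integral_directional_derivative_zero[OF this T0 r(2) b]
  have "integral (cell z0 h) (\<lambda>z. frechet_derivative T (at z) b) = 0" .
  moreover have "frechet_derivative T (at z) b = frechet_derivative (bump z0 r) (at z) b * H z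
      + bump z0 r z * frechet_derivative H (at z) b" if "z \<in> cell z0 h" for z
  proof -
    have z: "z \<in> ?B" using that cell_subset_ball[OF h] by blast
    have "((\<lambda>z. bump z0 r z * H z) has_derivative
        (\<lambda>k. bump z0 r z * frechet_derivative H (at z) k + frechet_derivative (bump z0 r) (at z) k * H z)) (at z)"
      by (intro has_derivative_mult has_derivative_frechet smooth_on_differentiable[OF H z]
          smooth_on_differentiable[OF smooth_on_bump[OF open_UNIV]]) auto
    then have "(T has_derivative
        (\<lambda>k. bump z0 r z * frechet_derivative H (at z) k + frechet_derivative (bump z0 r) (at z) k * H z)) (at z)"
      by (rule has_derivative_transform_within_open[of _ _ z UNIV ?B T]) (use z in \<open>auto simp: T_def\<close>)
    from frechet_derivative_eqI[OF this] show ?thesis by simp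
  qed
  ultimately show ?thesis using integral_cong[of "cell z0 h"] by (metis (no_types, lifting))
qed

lemma fundamental_lemma_bump:
  fixes Q :: "complex \<Rightarrow> real"
  assumes h: "h > 0" and Q: "continuous_on (cell z0 h) Q"
    and zero: "\<And>r. 0 < r \<Longrightarrow> r < h \<Longrightarrow> integral (cell z0 h) (\<lambda>z. bump z0 r z * Q z) = 0"
  shows "Q z0 = 0"
proof (rule ccontr)
  assume "Q z0 \<noteq> 0"
  define \<sigma> where "\<sigma> = sgn (Q z0)"
  have pos: "\<sigma> * Q z0 > 0" using \<open>Q z0 \<noteq> 0\<close> unfolding \<sigma>_def by (auto simp: sgn_if)
  have z0: "z0 \<in> cell z0 h" using h by (simp add: mem_cell)
  have "continuous_on (cell z0 h) (\<lambda>z. \<sigma> * Q z)" by (intro continuous_intros Q)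
  then obtain d where d: "d > 0" "\<And>z. z \<in> cell z0 h \<Longrightarrow> dist z z0 < d \<Longrightarrow> dist (\<sigma> * Q z) (\<sigma> * Q z0) < \<sigma> * Q z0"
    unfolding continuous_on_iff using z0 pos by metis
  define r where "r = min d h / 2"
  have r: "0 < r" "r < h" "r < d" using d(1) h unfolding r_def by auto
  let ?f = "\<lambda>z. \<sigma> * (bump z0 r z * Q z)"
  have cf: "continuous_on (cell z0 h) ?f"
    by (intro continuous_intros Q continuous_on_subset[OF smooth_on_imp_continuous_on[OF smooth_on_bump[OF open_UNIV]]]) auto
  have nonneg: "0 \<le> ?f z" if "z \<in> cell z0 h" for z
  proof (cases "z \<in> ball z0 r")
    case True
    then have "dist (\<sigma> * Q z) (\<sigma> * Q z0) < \<sigma> * Q z0" using d(2)[OF that] r by (simp add: dist_commute)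
    then have "0 < \<sigma> * Q z" by (simp add: dist_real_def abs_less_iff)
    then have "0 \<le> bump z0 r z * (\<sigma> * Q z)" using bump_nonneg by (metis less_imp_le mult_nonneg_nonneg)
    then show ?thesis by (simp add: mult.left_commute)
  next
    case False
    then show ?thesis using bump_outside[OF r(1) False] by simp
  qed
  have "(?f has_integral 0) (cell z0 h)"
  proof -
    have "integral (cell z0 h) ?f = 0" using zero[OF r(1,2)] by simp
    then show ?thesis using integrable_integral[OF integrable_on_cell[OF cf]] by (simp only:)
  qed
  then have "?f z0 = 0"
    unfolding cell_def
  proof (rule has_integral_0_cbox_imp_0[rotated 2])
    show "continuous_on (cbox (z0 - Complex h h) (z0 + Complex h h)) ?f" using cf by (simp add: cell_def)
    show "0 \<le> ?f z" if "z \<in> box (z0 - Complex h h) (z0 + Complex h h)" for z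
      using nonneg[of z] that box_subset_cbox unfolding cell_def by blast
    show "box (z0 - Complex h h) (z0 + Complex h h) \<noteq> {}"
      using h by (auto simp: box_ne_empty Basis_complex_def)
    show "z0 \<in> cbox (z0 - Complex h h) (z0 + Complex h h)" using z0 by (simp add: cell_def)
  qed
  then show False using pos bump_center_pos[OF r(1), of z0] by auto
qed

section \<open>The first variation of the energy\<close>

definition gcoef :: "('m, 'n::finite) riemannian \<Rightarrow> ('m, 'n) chart \<Rightarrow> 'n \<Rightarrow> 'n \<Rightarrow> real ^ 'n \<Rightarrow> real" where
  "gcoef M c i j x = gram M c x $ i $ j"

lemma ginner_gcoef:
  "ginner M c x v w = (\<Sum>i\<in>UNIV. \<Sum>j\<in>UNIV. v $ i * gcoef M c i j x * w $ j)"
  by (simp add: ginner_def inner_vec_def matrix_vector_mult_def gcoef_def sum_distrib_left mult.assoc)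

lemma smooth_on_gcoef:
  assumes "riemannian_manifold M" "c \<in> charts M"
  shows "smooth_on (gcoef M c i j) (cimage c)"
proof -
  have o: "open (cimage c)" using is_chart_facts(2) riemannian_chart assms by blast
  have "smooth_on (gram M c) (cimage c)" using assms unfolding riemannian_manifold_def by blast
  from smooth_on_bounded_linear_compose[OF bounded_linear_vec_nth[of i] o this]
  have "smooth_on (\<lambda>x. gram M c x $ i) (cimage c)" .
  from smooth_on_bounded_linear_compose[OF bounded_linear_vec_nth[of j] o this]
  have "smooth_on (\<lambda>x. gram M c x $ i $ j) (cimage c)" .
  then show ?thesis by (simp add: gcoef_def[abs_def])
qed

lemma gcoef_sym:
  assumes "riemannian_manifold M" "c \<in> charts M" "x \<in> cimage c"
  shows "gcoef M c i j x = gcoef M c j i x"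
proof -
  have "transpose (gram M c x) = gram M c x" using assms unfolding riemannian_manifold_def by blast
  then have "transpose (gram M c x) $ j $ i = gram M c x $ j $ i" by simp
  then show ?thesis by (simp add: gcoef_def transpose_def)
qed

text \<open>The variation is \<open>y + t \<psi> v\<close> in the chart, glued to \<open>u\<close> outside the support of the bump \<open>\<psi>\<close>. Its energy over the
square has derivative \<open>0\<close> by harmonicity, and the derivative is computed under the integral.\<close>

lemma first_variation:
  fixes M :: "('m::{t2_space,second_countable_topology}, 'n::finite) riemannian" and v :: "real ^ 'n"
  assumes R: "riemannian_manifold M" and c: "c \<in> charts M" and harm: "harmonic M u"
    and h: "h > 0" "cball z0 (2 * h) \<subseteq> unit_disc \<inter> u -` cdom c"
    and r: "0 < r" "r < h"
  defines "y \<equiv> cmap c \<circ> u"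
  defines "p \<equiv> \<lambda>b i \<zeta>. frechet_derivative y (at \<zeta>) b $ i"
    and "\<psi> \<equiv> bump z0 r"
  defines "\<psi>' \<equiv> \<lambda>b \<zeta>. frechet_derivative \<psi> (at \<zeta>) b"
  shows "integral (cell z0 h) (\<lambda>\<zeta>. \<Sum>b\<in>Basis. \<Sum>i\<in>UNIV. \<Sum>j\<in>UNIV.
      (\<psi>' b \<zeta> * v $ i) * gcoef M c i j (y \<zeta>) * p b j \<zeta>
      + p b i \<zeta> * (\<psi> \<zeta> * frechet_derivative (gcoef M c i j) (at (y \<zeta>)) v) * p b j \<zeta>
      + p b i \<zeta> * gcoef M c i j (y \<zeta>) * (\<psi>' b \<zeta> * v $ j)) = 0"
proof -
  note ch = is_chart_facts[OF riemannian_chart[OF R c]]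
  have su: "smooth_map M unit_disc u" using harm unfolding harmonic_def by blast
  let ?\<Omega> = "unit_disc \<inter> u -` cdom c" and ?B = "ball z0 (2 * h)" and ?K = "cell z0 h"
  have KB: "?K \<subseteq> ?B" by (rule cell_subset_ball[OF h(1)])
  have B\<Omega>: "?B \<subseteq> ?\<Omega>" using h(2) by auto
  have sy: "smooth_on y ?\<Omega>" unfolding y_def by (rule smooth_map_chart[OF su c])
  have s\<psi>: "smooth_on \<psi> S" if "open S" for S unfolding \<psi>_def by (rule smooth_on_bump[OF that])
  have \<psi>0: "\<psi> \<zeta> = 0" if "\<zeta> \<notin> ball z0 r" for \<zeta> unfolding \<psi>_def by (rule bump_outside[OF r(1) that])
  have yc: "y \<zeta> \<in> cimage c" if "\<zeta> \<in> ?\<Omega>" for \<zeta> using that unfolding y_def by auto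
  have cy: "continuous_on (cball z0 (2*h)) y"
    by (rule continuous_on_subset[OF smooth_on_imp_continuous_on[OF sy] h(2)])
  have "compact (y ` cball z0 (2*h))" by (rule compact_continuous_image[OF cy compact_cball])
  moreover have "y ` cball z0 (2*h) \<subseteq> cimage c" using yc h(2) by blast
  ultimately obtain d where d: "d > 0" "(\<Union>x\<in>y ` cball z0 (2*h). ball x d) \<subseteq> cimage c"
    by (rule compact_subset_open_imp_ball_epsilon_subset[OF _ ch(2)])
  \<comment> \<open>for \<open>\<bar>t\<bar> < \<epsilon>\<close> the varied map stays in the image of the chart, as bumps are at most \<open>1\<close>\<close>
  define \<epsilon> where "\<epsilon> = d / (norm v + 1)"
  let ?I = "{-\<epsilon><..<\<epsilon>}"
  have \<epsilon>: "\<epsilon> > 0" using d(1) unfolding \<epsilon>_def by (simp add: add_nonneg_pos)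
  define G where "G = (\<lambda>q::real \<times> complex. y (snd q) + (fst q * \<psi> (snd q)) *\<^sub>R v)"
  have Gc: "G (t, \<zeta>) \<in> cimage c" if t: "t \<in> ?I" and \<zeta>: "\<zeta> \<in> ?B" for t \<zeta>
  proof -
    have "\<bar>t * \<psi> \<zeta>\<bar> \<le> \<bar>t\<bar> * 1"
      using bump_le_1[of z0 r \<zeta>] bump_nonneg[of z0 r \<zeta>] unfolding \<psi>_def abs_mult
      by (intro mult_left_mono) auto
    then have "norm ((t * \<psi> \<zeta>) *\<^sub>R v) \<le> (\<bar>t\<bar> * 1) * norm v"
      unfolding norm_scaleR by (rule mult_right_mono) simp
    also have "\<dots> \<le> \<bar>t\<bar> * (norm v + 1)" by (simp add: mult_left_mono)
    also have "\<dots> < \<epsilon> * (norm v + 1)" using t by (intro mult_strict_right_mono) (auto simp: add_nonneg_pos)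
    also have "\<dots> = d"
    proof -
      have "norm v + 1 \<noteq> 0" using norm_ge_zero[of v] by linarith
      then show ?thesis unfolding \<epsilon>_def by simp
    qed
    finally have "G (t, \<zeta>) \<in> ball (y \<zeta>) d" by (simp add: G_def dist_norm)
    then show ?thesis using d(2) \<zeta> by force
  qed
  have oIB: "open (?I \<times> ?B)" by (intro open_Times) auto
  have sG: "smooth_on G (?I \<times> ?B)"
  proof -
    have "smooth_on (\<lambda>q::real \<times> complex. y (snd q)) (?I \<times> ?B)"
      by (rule smooth_on_compose[OF oIB open_ball _ smooth_on_bounded_linear[OF bounded_linear_snd]
          smooth_on_subset[OF sy B\<Omega>]]) auto
    moreover have "smooth_on (\<lambda>q::real \<times> complex. \<psi> (snd q)) (?I \<times> ?B)"
      by (rule smooth_on_compose[OF oIB open_ball _ smooth_on_bounded_linear[OF bounded_linear_snd]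
          s\<psi>[OF open_ball]]) auto
    ultimately show ?thesis unfolding G_def
      by (intro smooth_on_add oIB smooth_on_bilinear[OF bounded_bilinear_scaleR] smooth_on_const
          smooth_on_bilinear[OF bounded_bilinear_mult] smooth_on_bounded_linear[OF bounded_linear_fst])
  qed
  have F1: "smooth_map M (?I \<times> ?B) (\<lambda>q. cinv c (G q))"
    by (rule smooth_map_compose[OF R smooth_map_cinv[OF R c] sG _ oIB ch(2)]) (use Gc in auto)
  define F where "F = (\<lambda>q. if snd q \<in> ?B then cinv c (G q) else u (snd q))"
  have F1u: "cinv c (G (t, \<zeta>)) = u \<zeta>" if "\<zeta> \<in> ?B" "t = 0 \<or> \<zeta> \<notin> ball z0 r" for t \<zeta>
    using that \<psi>0[of \<zeta>] B\<Omega> ch(5) by (auto simp: G_def y_def)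
  have smF: "smooth_map M (?I \<times> unit_disc) F"
    unfolding F_def
    by (rule smooth_map_glue[OF R _ _ su _ _ _ _ F1, where K = "cball z0 r"]) (use B\<Omega> F1u r in auto)
  have DE: "((\<lambda>t. energy M ?K (\<lambda>\<zeta>. F (t, \<zeta>))) has_real_derivative 0) (at 0)"
  proof -
    have K1: "?K \<subseteq> unit_disc" using KB B\<Omega> by blast
    have F0: "\<forall>\<zeta>\<in>unit_disc. F (0, \<zeta>) = u \<zeta>" using F1u unfolding F_def by auto
    have FK: "\<forall>t\<in>?I. \<forall>\<zeta>\<in>unit_disc - ?K. F (t, \<zeta>) = u \<zeta>"
    proof (intro ballI)
      fix t \<zeta> assume "t \<in> ?I" and \<zeta>: "\<zeta> \<in> unit_disc - ?K"
      have "\<zeta> \<notin> cball z0 h" using \<zeta> cball_subset_cell by blast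
      then have "\<zeta> \<notin> ball z0 r" using r by simp
      then show "F (t, \<zeta>) = u \<zeta>" using F1u[of \<zeta> t] unfolding F_def by auto
    qed
    show ?thesis
      using harm \<epsilon> compact_cell K1 smF F0 FK unfolding harmonic_def by blast
  qed
  let ?P = "\<lambda>t \<zeta> b i. p b i \<zeta> + t * (\<psi>' b \<zeta> * v $ i)"
  let ?E = "\<lambda>t \<zeta>. \<Sum>b\<in>Basis. \<Sum>i\<in>UNIV. \<Sum>j\<in>UNIV. ?P t \<zeta> b i * gcoef M c i j (G (t, \<zeta>)) * ?P t \<zeta> b j"
  let ?E' = "\<lambda>t \<zeta>. \<Sum>b\<in>Basis. \<Sum>i\<in>UNIV. \<Sum>j\<in>UNIV.
      (\<psi>' b \<zeta> * v $ i) * gcoef M c i j (G (t, \<zeta>)) * ?P t \<zeta> b j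
      + ?P t \<zeta> b i * (\<psi> \<zeta> * frechet_derivative (gcoef M c i j) (at (G (t, \<zeta>))) v) * ?P t \<zeta> b j
      + ?P t \<zeta> b i * gcoef M c i j (G (t, \<zeta>)) * (\<psi>' b \<zeta> * v $ j)"
  have cp: "continuous_on ?B (\<lambda>\<zeta>. p b i \<zeta>)" for b i
  proof -
    have "smooth_on (\<lambda>\<zeta>. frechet_derivative y (at \<zeta>) b) ?B"
      by (rule smooth_on_subset[OF smooth_on_frechet_derivative[OF sy] B\<Omega>])
    from smooth_on_imp_continuous_on[OF this] show ?thesis
      unfolding p_def by (intro continuous_intros)
  qed
  have c\<psi>: "continuous_on S (\<psi>' b)" for b S
    unfolding \<psi>'_def
    by (rule continuous_on_subset[OF smooth_on_imp_continuous_on[OF smooth_on_frechet_derivative[OF s\<psi>[OF open_UNIV]]]]) auto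
  have c\<psi>0: "continuous_on S \<psi>" for S
    by (rule continuous_on_subset[OF smooth_on_imp_continuous_on[OF s\<psi>[OF open_UNIV]]]) auto
  have cpK: "continuous_on (?I \<times> ?K) (\<lambda>q. p b i (snd q))" for b i
    by (intro continuous_on_compose2[OF cp] continuous_intros) (use KB in auto)
  have c\<psi>K: "continuous_on (?I \<times> ?K) (\<lambda>q. \<psi>' b (snd q))" "continuous_on (?I \<times> ?K) (\<lambda>q. \<psi> (snd q))" for b
    by (intro continuous_on_compose2[OF c\<psi>[of UNIV]] continuous_on_compose2[OF c\<psi>0[of UNIV]] continuous_intros; simp)+
  have cG: "continuous_on (?I \<times> ?K) G"
    by (rule continuous_on_subset[OF smooth_on_imp_continuous_on[OF sG]]) (use KB in auto)
  have GK: "G q \<in> cimage c" if "q \<in> ?I \<times> ?K" for q using Gc KB that by (cases q) auto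
  have cg: "continuous_on (?I \<times> ?K) (\<lambda>q. gcoef M c i j (G q))" for i j
    by (rule continuous_on_compose2[OF smooth_on_imp_continuous_on[OF smooth_on_gcoef[OF R c]] cG])
       (use GK in auto)
  have cg': "continuous_on (?I \<times> ?K) (\<lambda>q. frechet_derivative (gcoef M c i j) (at (G q)) v)" for i j
    by (rule continuous_on_compose2[OF smooth_on_imp_continuous_on[OF smooth_on_frechet_derivative[OF smooth_on_gcoef[OF R c]]] cG])
       (use GK in auto)
  have cE: "continuous_on (?I \<times> ?K) (\<lambda>q. ?E (fst q) (snd q))"
    using cg by (intro continuous_intros cpK c\<psi>K) simp_all
  have cE': "continuous_on (?I \<times> ?K) (\<lambda>q. ?E' (fst q) (snd q))"
    using cg cg' by (intro continuous_intros cpK c\<psi>K) simp_all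
  have cEt: "continuous_on ?K (?E t)" if "t \<in> ?I" for t
  proof -
    have "continuous_on ?K (\<lambda>\<zeta>. (t, \<zeta>))" by (intro continuous_intros)
    moreover have "(\<lambda>\<zeta>. (t, \<zeta>)) ` ?K \<subseteq> ?I \<times> ?K" using that by auto
    ultimately show ?thesis using continuous_on_compose2[OF cE, of ?K "\<lambda>\<zeta>. (t, \<zeta>)"] by simp
  qed
  have DG: "((\<lambda>s. G (s, \<zeta>)) has_derivative (\<lambda>s. s *\<^sub>R (\<psi> \<zeta> *\<^sub>R v))) (at t within S)" for t \<zeta> S
    unfolding G_def by (auto intro!: derivative_eq_intros)
  have Dg: "((\<lambda>s. gcoef M c i j (G (s, \<zeta>))) has_field_derivative
      \<psi> \<zeta> * frechet_derivative (gcoef M c i j) (at (G (t, \<zeta>))) v) (at t within S)"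
    if "G (t, \<zeta>) \<in> cimage c" for t \<zeta> S i j
  proof -
    let ?L = "frechet_derivative (gcoef M c i j) (at (G (t, \<zeta>)))"
    have df: "gcoef M c i j differentiable (at (G (t, \<zeta>)))"
      by (rule smooth_on_differentiable[OF smooth_on_gcoef[OF R c] that])
    have "((\<lambda>s. gcoef M c i j (G (s, \<zeta>))) has_derivative (\<lambda>s. ?L (s *\<^sub>R (\<psi> \<zeta> *\<^sub>R v)))) (at t within S)"
      by (rule has_derivative_compose[OF DG has_derivative_frechet[OF df]])
    moreover have "(\<lambda>s. ?L (s *\<^sub>R (\<psi> \<zeta> *\<^sub>R v))) = (*) (\<psi> \<zeta> * ?L v)"
      using linear_cmul[OF linear_frechet_derivative[OF df]] by (auto simp: mult_ac)
    ultimately show ?thesis by (simp only: has_field_derivative_def)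
  qed
  have "((\<lambda>t. integral (cbox (z0 - Complex h h) (z0 + Complex h h)) (?E t)) has_field_derivative
      integral (cbox (z0 - Complex h h) (z0 + Complex h h)) (?E' 0)) (at 0 within ?I)"
  proof (rule leibniz_rule_field_derivative)
    fix t \<zeta> assume t: "t \<in> ?I" and "\<zeta> \<in> cbox (z0 - Complex h h) (z0 + Complex h h)"
    then have G: "G (t, \<zeta>) \<in> cimage c" using GK[of "(t, \<zeta>)"] by (simp add: cell_def)
    show "((\<lambda>t. ?E t \<zeta>) has_field_derivative ?E' t \<zeta>) (at t within ?I)"
      by (intro DERIV_sum) (auto intro!: derivative_eq_intros Dg[OF G] simp: algebra_simps)
  next
    fix t assume "t \<in> ?I"
    then show "?E t integrable_on cbox (z0 - Complex h h) (z0 + Complex h h)"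
      using integrable_on_cell[OF cEt] by (simp add: cell_def)
  next
    show "continuous_on (?I \<times> cbox (z0 - Complex h h) (z0 + Complex h h)) (\<lambda>(t, \<zeta>). ?E' t \<zeta>)"
      using cE' by (simp add: cell_def split_beta)
  qed (use \<epsilon> in auto)
  then have D': "((\<lambda>t. integral ?K (?E t)) has_field_derivative integral ?K (?E' 0)) (at 0)"
    using \<epsilon> at_within_open[of 0 ?I] by (simp add: cell_def)
  have "energy M ?K (\<lambda>\<zeta>. F (t, \<zeta>)) = integral ?K (?E t)" if t: "t \<in> ?I" for t
  proof -
    have pb: "(\<Sum>b\<in>Basis. pullback M (\<lambda>\<zeta>. F (t, \<zeta>)) \<zeta> b b) = ?E t \<zeta>" if \<zeta>: "\<zeta> \<in> ?K" for \<zeta>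
    proof -
      have \<zeta>B: "\<zeta> \<in> ?B" using \<zeta> KB by blast
      have sF: "smooth_map M ?B (\<lambda>\<zeta>. F (t, \<zeta>))"
      proof -
        have "smooth_on (\<lambda>\<zeta>::complex. (t, 0) + (0, \<zeta>)) ?B"
          by (intro smooth_on_add smooth_on_const smooth_on_bounded_linear bounded_linear_Pair
              bounded_linear_zero bounded_linear_ident) auto
        then have "smooth_on (\<lambda>\<zeta>::complex. (t, \<zeta>)) ?B" by simp
        then show ?thesis
          by (rule smooth_map_compose[OF R smF]) (use t B\<Omega> in \<open>auto intro!: open_Times\<close>)
      qed
      have Fc: "F (t, \<zeta>) \<in> cdom c" and FG: "cmap c (F (t, \<zeta>)) = G (t, \<zeta>)" if "\<zeta> \<in> ?B" for \<zeta>
        using that ch(6,7) Gc[OF t that] unfolding F_def by auto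
      have "((\<lambda>\<zeta>. y \<zeta> + (t * \<psi> \<zeta>) *\<^sub>R v) has_derivative
          (\<lambda>k. frechet_derivative y (at \<zeta>) k + (t * frechet_derivative \<psi> (at \<zeta>) k) *\<^sub>R v)) (at \<zeta>)"
        by (intro has_derivative_add has_derivative_scaleR_left has_derivative_mult_right
            has_derivative_frechet[OF smooth_on_differentiable[OF sy subsetD[OF B\<Omega> \<zeta>B]]]
            has_derivative_frechet[OF smooth_on_differentiable[OF s\<psi>[OF open_UNIV]]]) simp
      then have "((cmap c \<circ> (\<lambda>\<zeta>. F (t, \<zeta>))) has_derivative
          (\<lambda>k. frechet_derivative y (at \<zeta>) k + (t * frechet_derivative \<psi> (at \<zeta>) k) *\<^sub>R v)) (at \<zeta>)"
        by (rule has_derivative_transform_within_open[of _ _ \<zeta> UNIV ?B])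
           (use \<zeta>B FG in \<open>auto simp: G_def\<close>)
      from frechet_derivative_eqI[OF this]
      show ?thesis
        using pullback_in_chart[OF R c Fc[OF \<zeta>B] open_ball \<zeta>B sF]
        by (simp add: FG[OF \<zeta>B] ginner_gcoef p_def \<psi>'_def mult.assoc)
    qed
    have "energy M ?K (\<lambda>\<zeta>. F (t, \<zeta>)) = (LINT \<zeta>:?K|lborel. ?E t \<zeta>)"
      unfolding energy_def
      by (rule set_lebesgue_integral_cong) (use pb compact_cell[of z0 h] in \<open>auto intro: borel_compact\<close>)
    also have "\<dots> = integral ?K (?E t)" by (rule set_integral_cell[OF cEt[OF t]])
    finally show ?thesis .
  qed
  then have "((\<lambda>t. integral ?K (?E t)) has_field_derivative 0) (at 0)"
    using \<epsilon> by (intro has_field_derivative_transform_within_open[OF DE, of ?I]) auto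
  then have "integral ?K (?E' 0) = 0" using D' DERIV_unique by blast
  then show ?thesis by (simp add: G_def)
qed

section \<open>The Euler-Lagrange equation\<close>

lemma smooth_on_sum:
  "open S \<Longrightarrow> finite I \<Longrightarrow> (\<And>i. i \<in> I \<Longrightarrow> smooth_on (f i) S) \<Longrightarrow> smooth_on (\<lambda>x. \<Sum>i\<in>I. f i x) S"
  unfolding smooth_on_def using Ck_on_sum by blast

text \<open>Integrating by parts in the first variation moves the derivative off the bump. The resulting factor
of the bump vanishes at the centre, as bumps of arbitrarily small support are admitted. The equation is
kept in divergence form and tested with a fixed vector \<open>v\<close>, so that the inverse of the metric does not occur.\<close>

lemma euler_lagrange:
  fixes M :: "('m::{t2_space,second_countable_topology}, 'n::finite) riemannian" and v :: "real ^ 'n"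
  assumes R: "riemannian_manifold M" and c: "c \<in> charts M" and harm: "harmonic M u"
    and z0: "z0 \<in> unit_disc \<inter> u -` cdom c"
  defines "y \<equiv> cmap c \<circ> u"
  defines "p \<equiv> \<lambda>b i \<zeta>. frechet_derivative y (at \<zeta>) b $ i"
    and "s \<equiv> \<lambda>b. frechet_derivative (\<lambda>\<zeta>. frechet_derivative y (at \<zeta>) b) (at z0) b"
    and "g \<equiv> gcoef M c"
  defines "g' \<equiv> \<lambda>i j v. frechet_derivative (g i j) (at (y z0)) v"
  shows "(\<Sum>b\<in>Basis. \<Sum>i\<in>UNIV. \<Sum>j\<in>UNIV. p b i z0 * g' i j v * p b j z0)
    = 2 * (\<Sum>b\<in>Basis. \<Sum>i\<in>UNIV. \<Sum>j\<in>UNIV.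
        v $ i * (g' i j (frechet_derivative y (at z0) b) * p b j z0 + g i j (y z0) * (s b $ j)))"
proof -
  note ch = is_chart_facts[OF riemannian_chart[OF R c]]
  have su: "smooth_map M unit_disc u" using harm unfolding harmonic_def by blast
  let ?\<Omega> = "unit_disc \<inter> u -` cdom c"
  have o\<Omega>: "open ?\<Omega>" by (rule open_chart_preimage[OF R c _ su]) simp
  then obtain e where e: "e > 0" "cball z0 e \<subseteq> ?\<Omega>" using z0 open_contains_cball by blast
  define h where "h = e / 2"
  have h: "h > 0" "cball z0 (2 * h) \<subseteq> ?\<Omega>" using e unfolding h_def by simp_all
  let ?B = "ball z0 (2 * h)" and ?K = "cell z0 h"
  have B\<Omega>: "?B \<subseteq> ?\<Omega>" using h(2) by auto
  have KB: "?K \<subseteq> ?B" by (rule cell_subset_ball[OF h(1)])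
  have z0B: "z0 \<in> ?B" using h by simp
  have sy: "smooth_on y ?B"
    using smooth_on_subset[OF smooth_map_chart[OF su c] B\<Omega>] unfolding y_def .
  have yc: "y \<zeta> \<in> cimage c" if "\<zeta> \<in> ?B" for \<zeta> using that B\<Omega> unfolding y_def by auto
  have sg: "smooth_on (\<lambda>\<zeta>. g i j (y \<zeta>)) ?B" for i j
    unfolding g_def by (rule smooth_on_compose[OF open_ball ch(2) _ sy smooth_on_gcoef[OF R c]]) (use yc in auto)
  have sg': "smooth_on (\<lambda>\<zeta>. frechet_derivative (g i j) (at (y \<zeta>)) v) ?B" for i j
    unfolding g_def
    by (rule smooth_on_compose[OF open_ball ch(2) _ sy smooth_on_frechet_derivative[OF smooth_on_gcoef[OF R c]]]) (use yc in auto)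
  have sp: "smooth_on (p b j) ?B" for b j
    unfolding p_def
    by (rule smooth_on_bounded_linear_compose[OF bounded_linear_vec_nth open_ball smooth_on_frechet_derivative[OF sy]])
  \<comment> \<open>the terms of the first variation in which the bump is differentiated; by symmetry of the metric they are equal in pairs, which gives the factor 2\<close>
  define H where "H = (\<lambda>b \<zeta>. \<Sum>i\<in>UNIV. \<Sum>j\<in>UNIV. v $ i * (g i j (y \<zeta>) * p b j \<zeta>))"
  have sH: "smooth_on (H b) ?B" for b
    unfolding H_def
    by (intro smooth_on_sum smooth_on_bilinear[OF bounded_bilinear_mult] smooth_on_const sg sp) auto
  define Q1 where "Q1 = (\<lambda>b \<zeta>. \<Sum>i\<in>UNIV. \<Sum>j\<in>UNIV. p b i \<zeta> * (frechet_derivative (g i j) (at (y \<zeta>)) v * p b j \<zeta>))"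
  have sQ1: "smooth_on (Q1 b) ?B" for b
    unfolding Q1_def
    by (intro smooth_on_sum smooth_on_bilinear[OF bounded_bilinear_mult] sg' sp) auto
  let ?DH = "\<lambda>b \<zeta>. frechet_derivative (H b) (at \<zeta>) b"
  define Q where "Q = (\<lambda>\<zeta>. \<Sum>b\<in>Basis. Q1 b \<zeta> - 2 * ?DH b \<zeta>)"
  have cQ1: "continuous_on ?K (Q1 b)" and cH: "continuous_on ?K (H b)" and cDH: "continuous_on ?K (?DH b)" for b
    using smooth_on_imp_continuous_on[OF sQ1] smooth_on_imp_continuous_on[OF sH]
      smooth_on_imp_continuous_on[OF smooth_on_frechet_derivative[OF sH]] continuous_on_subset KB by blast+
  have "Q z0 = 0"
  proof (rule fundamental_lemma_bump[OF h(1)])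
    show "continuous_on ?K Q" unfolding Q_def by (intro continuous_intros cQ1 cDH)
    fix r assume r: "0 < r" "r < h"
    let ?\<psi> = "bump z0 r" and ?\<psi>' = "\<lambda>b \<zeta>. frechet_derivative (bump z0 r) (at \<zeta>) b"
    have c\<psi>: "continuous_on ?K ?\<psi>"
      by (rule continuous_on_subset[OF smooth_on_imp_continuous_on[OF smooth_on_bump[OF open_UNIV]]]) auto
    have c\<psi>': "continuous_on ?K (?\<psi>' b)" for b
      by (rule continuous_on_subset[OF smooth_on_imp_continuous_on[OF smooth_on_frechet_derivative[OF smooth_on_bump[OF open_UNIV]]]]) auto
    have eq: "(\<Sum>b\<in>Basis. \<Sum>i\<in>UNIV. \<Sum>j\<in>UNIV.
        (?\<psi>' b \<zeta> * v $ i) * g i j (y \<zeta>) * p b j \<zeta>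
        + p b i \<zeta> * (?\<psi> \<zeta> * frechet_derivative (g i j) (at (y \<zeta>)) v) * p b j \<zeta>
        + p b i \<zeta> * g i j (y \<zeta>) * (?\<psi>' b \<zeta> * v $ j))
      = ?\<psi> \<zeta> * Q \<zeta> + (\<Sum>b\<in>Basis. 2 * (?\<psi>' b \<zeta> * H b \<zeta> + ?\<psi> \<zeta> * ?DH b \<zeta>))" if "\<zeta> \<in> ?K" for \<zeta>
    proof -
      have gs: "g i j (y \<zeta>) = g j i (y \<zeta>)" for i j
        unfolding g_def using gcoef_sym[OF R c yc] that KB by blast
      have "(\<Sum>i\<in>UNIV. \<Sum>j\<in>UNIV. (?\<psi>' b \<zeta> * v $ i) * g i j (y \<zeta>) * p b j \<zeta>) = ?\<psi>' b \<zeta> * H b \<zeta>" for b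
        unfolding H_def by (simp add: sum_distrib_left mult.assoc)
      moreover have "(\<Sum>i\<in>UNIV. \<Sum>j\<in>UNIV. p b i \<zeta> * (?\<psi> \<zeta> * frechet_derivative (g i j) (at (y \<zeta>)) v) * p b j \<zeta>) = ?\<psi> \<zeta> * Q1 b \<zeta>" for b
        unfolding Q1_def by (simp add: sum_distrib_left mult.assoc mult.left_commute)
      moreover have "(\<Sum>i\<in>UNIV. \<Sum>j\<in>UNIV. p b i \<zeta> * g i j (y \<zeta>) * (?\<psi>' b \<zeta> * v $ j)) = ?\<psi>' b \<zeta> * H b \<zeta>" for b
      proof -
        have "(\<Sum>i\<in>UNIV. \<Sum>j\<in>UNIV. p b i \<zeta> * g i j (y \<zeta>) * (?\<psi>' b \<zeta> * v $ j))
            = (\<Sum>j\<in>UNIV. \<Sum>i\<in>UNIV. p b i \<zeta> * g i j (y \<zeta>) * (?\<psi>' b \<zeta> * v $ j))" by (rule sum.swap)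
        also have "\<dots> = ?\<psi>' b \<zeta> * H b \<zeta>"
          unfolding H_def sum_distrib_left
        proof (intro sum.cong refl)
          fix i j
          show "p b j \<zeta> * g j i (y \<zeta>) * (?\<psi>' b \<zeta> * v $ i) = ?\<psi>' b \<zeta> * (v $ i * (g i j (y \<zeta>) * p b j \<zeta>))"
            unfolding gs[of i j] by (simp add: mult_ac)
        qed
        finally show ?thesis .
      qed
      ultimately show ?thesis
        unfolding Q_def sum.distrib by (simp add: sum_distrib_left sum.distrib[symmetric] algebra_simps)
    qed
    let ?I = "\<lambda>b \<zeta>. ?\<psi>' b \<zeta> * H b \<zeta> + ?\<psi> \<zeta> * ?DH b \<zeta>"
    have cI: "continuous_on ?K (?I b)" for b by (intro continuous_intros c\<psi> c\<psi>' cH cDH)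
    have c\<psi>Q: "continuous_on ?K (\<lambda>\<zeta>. ?\<psi> \<zeta> * Q \<zeta>)" unfolding Q_def by (intro continuous_intros c\<psi> cQ1 cDH)
    let ?Lh = "\<lambda>\<zeta>. \<Sum>b\<in>Basis. \<Sum>i\<in>UNIV. \<Sum>j\<in>UNIV.
        (?\<psi>' b \<zeta> * v $ i) * g i j (y \<zeta>) * p b j \<zeta>
        + p b i \<zeta> * (?\<psi> \<zeta> * frechet_derivative (g i j) (at (y \<zeta>)) v) * p b j \<zeta>
        + p b i \<zeta> * g i j (y \<zeta>) * (?\<psi>' b \<zeta> * v $ j)"
    have "0 = integral ?K ?Lh"
      using first_variation[OF R c harm h r, of v] unfolding p_def y_def g_def by (rule sym)
    also have "\<dots> = integral ?K (\<lambda>\<zeta>. ?\<psi> \<zeta> * Q \<zeta> + (\<Sum>b\<in>Basis. 2 * ?I b \<zeta>))"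
      by (rule Henstock_Kurzweil_Integration.integral_cong) (rule eq)
    also have "\<dots> = integral ?K (\<lambda>\<zeta>. ?\<psi> \<zeta> * Q \<zeta>) + (\<Sum>b\<in>Basis. 2 * integral ?K (?I b))"
    proof -
      have "integral ?K (\<lambda>\<zeta>. ?\<psi> \<zeta> * Q \<zeta> + (\<Sum>b\<in>Basis. 2 * ?I b \<zeta>))
          = integral ?K (\<lambda>\<zeta>. ?\<psi> \<zeta> * Q \<zeta>) + integral ?K (\<lambda>\<zeta>. \<Sum>b\<in>Basis. 2 * ?I b \<zeta>)"
        by (intro Henstock_Kurzweil_Integration.integral_add integrable_on_cell continuous_intros c\<psi>Q cI c\<psi> c\<psi>' cH cDH)
      also have "integral ?K (\<lambda>\<zeta>. \<Sum>b\<in>Basis. 2 * ?I b \<zeta>) = (\<Sum>b\<in>Basis. integral ?K (\<lambda>\<zeta>. 2 * ?I b \<zeta>))"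
        by (intro Henstock_Kurzweil_Integration.integral_sum integrable_on_cell continuous_intros c\<psi> c\<psi>' cH cDH) auto
      also have "\<dots> = (\<Sum>b\<in>Basis. 2 * integral ?K (?I b))"
        by (intro sum.cong refl Henstock_Kurzweil_Integration.integral_mult_right)
      finally show ?thesis .
    qed
    also have "(\<Sum>b\<in>Basis. 2 * integral ?K (?I b)) = 0"
      by (intro sum.neutral ballI) (use integration_by_parts_bump[OF sH r] in simp)
    finally show "integral ?K (\<lambda>\<zeta>. ?\<psi> \<zeta> * Q \<zeta>) = 0" by simp
  qed
  moreover have "?DH b z0 = (\<Sum>i\<in>UNIV. \<Sum>j\<in>UNIV.
      v $ i * (g' i j (frechet_derivative y (at z0) b) * p b j z0 + g i j (y z0) * (s b $ j)))" for b
  proof -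
    have Dy: "(y has_derivative frechet_derivative y (at z0)) (at z0)"
      by (rule has_derivative_frechet[OF smooth_on_differentiable[OF sy z0B]])
    have Dg: "((\<lambda>\<zeta>. g i j (y \<zeta>)) has_derivative (\<lambda>k. g' i j (frechet_derivative y (at z0) k))) (at z0)" for i j
      unfolding g'_def g_def
      by (rule has_derivative_compose[OF Dy has_derivative_frechet[OF smooth_on_differentiable[OF smooth_on_gcoef[OF R c] yc[OF z0B]]]])
    have "((\<lambda>\<zeta>. frechet_derivative y (at \<zeta>) b) has_derivative
        frechet_derivative (\<lambda>\<zeta>. frechet_derivative y (at \<zeta>) b) (at z0)) (at z0)"
      by (rule has_derivative_frechet[OF smooth_on_differentiable[OF smooth_on_frechet_derivative[OF sy] z0B]])
    from bounded_linear.has_derivative[OF bounded_linear_vec_nth this]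
    have Dp: "(p b j has_derivative (\<lambda>k. frechet_derivative (\<lambda>\<zeta>. frechet_derivative y (at \<zeta>) b) (at z0) k $ j)) (at z0)" for j
      unfolding p_def .
    have "(H b has_derivative (\<lambda>k. \<Sum>i\<in>UNIV. \<Sum>j\<in>UNIV. v $ i *
        (g i j (y z0) * frechet_derivative (\<lambda>\<zeta>. frechet_derivative y (at \<zeta>) b) (at z0) k $ j
         + g' i j (frechet_derivative y (at z0) k) * p b j z0))) (at z0)"
      unfolding H_def
      by (intro has_derivative_sum has_derivative_mult_right has_derivative_mult Dg Dp)
    from frechet_derivative_eqI[OF this] show ?thesis by (simp add: s_def add.commute)
  qed
  ultimately show ?thesis
    unfolding Q_def Q1_def g'_def by (simp add: sum_subtractf sum_distrib_left mult.assoc)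
qed

section \<open>From the Laplacian to circle averages\<close>

definition laplacian :: "(complex \<Rightarrow> 'b::real_normed_vector) \<Rightarrow> complex \<Rightarrow> 'b" where
  "laplacian S z = (\<Sum>b\<in>Basis. frechet_derivative (\<lambda>w. frechet_derivative S (at w) b) (at z) b)"

lemma linear_complex_split:
  fixes D :: "complex \<Rightarrow> 'b::real_vector"
  assumes "linear D"
  shows "D h = Re h *\<^sub>R D 1 + Im h *\<^sub>R D \<i>"
proof -
  have "h = Re h *\<^sub>R 1 + Im h *\<^sub>R \<i>" by (simp add: complex_eq_iff)
  then show ?thesis using assms by (metis linear_add linear_cmul)
qed

text \<open>Along the segment from \<open>z\<close> to \<open>z + h\<close> the first derivatives are expanded to first order and the
mean value theorem is applied to the remainder. The two mixed second
derivatives contribute their mean to the coefficient of the product \<open>Re h * Im h\<close>.\<close>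

lemma smooth_peano:
  fixes S :: "complex \<Rightarrow> real"
  assumes S: "smooth_on S \<Omega>" and \<Omega>: "open \<Omega>" "z \<in> \<Omega>" and \<epsilon>: "\<epsilon> > 0"
  defines "A \<equiv> \<lambda>b w. frechet_derivative S (at w) b"
  defines "A' \<equiv> \<lambda>b. frechet_derivative (A b) (at z)"
  shows "\<exists>\<delta>>0. \<forall>h. norm h < \<delta> \<longrightarrow> \<bar>S (z + h) - S z
    - qform (A 1 z) (A \<i> z) (A' 1 1 / 2) ((A' 1 \<i> + A' \<i> 1) / 2) (A' \<i> \<i> / 2) h\<bar> \<le> \<epsilon> * (norm h)\<^sup>2"
proof -
  have linS: "linear (frechet_derivative S (at w))" if "w \<in> \<Omega>" for w
    using smooth_on_differentiable[OF S that] linear_frechet_derivative by blast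
  have DA: "(A b has_derivative A' b) (at z)" for b
    unfolding A'_def A_def
    by (rule has_derivative_frechet[OF smooth_on_differentiable[OF smooth_on_frechet_derivative[OF S] \<Omega>(2)]])
  have linA: "linear (A' b)" for b using DA has_derivative_linear by blast
  have "\<exists>d>0. \<forall>w. norm (w - z) < d \<longrightarrow> norm (A b w - A b z - A' b (w - z)) \<le> \<epsilon> / 2 * norm (w - z)" for b
    using DA[of b, unfolded has_derivative_at_alt] \<epsilon> by (auto dest!: spec[of _ "\<epsilon>/2"])
  then obtain d where d: "\<And>b. d b > 0"
    "\<And>b w. norm (w - z) < d b \<Longrightarrow> norm (A b w - A b z - A' b (w - z)) \<le> \<epsilon> / 2 * norm (w - z)" by metis
  obtain e where e: "e > 0" "ball z e \<subseteq> \<Omega>" using \<Omega> open_contains_ball by blast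
  define \<delta> where "\<delta> = Min {d 1, d \<i>, e}"
  have \<delta>: "\<delta> > 0" "\<delta> \<le> d 1" "\<delta> \<le> d \<i>" "\<delta> \<le> e" unfolding \<delta>_def using d e by auto
  show ?thesis
  proof (intro exI[of _ \<delta>] conjI \<delta>(1) allI impI)
    fix h :: complex assume h: "norm h < \<delta>"
    define D2 where "D2 = Re h * A' 1 h + Im h * A' \<i> h"
    define f where "f = (\<lambda>t. S (z + t *\<^sub>R h) - S z - t * (Re h * A 1 z + Im h * A \<i> z) - t\<^sup>2 / 2 * D2)"
    define f' where "f' = (\<lambda>t. (Re h * A 1 (z + t *\<^sub>R h) + Im h * A \<i> (z + t *\<^sub>R h))
        - (Re h * A 1 z + Im h * A \<i> z) - t * D2)"
    have small: "norm (t *\<^sub>R h) < \<delta>" if "0 \<le> t" "t \<le> 1" for t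
      using mult_right_mono[of t 1 "norm h"] that h by simp
    have df: "(f has_real_derivative f' t) (at t)" if t: "0 \<le> t" "t \<le> 1" for t
    proof -
      have in\<Omega>: "z + t *\<^sub>R h \<in> \<Omega>" using small[OF t] \<delta> e by (auto simp: dist_norm)
      have "((\<lambda>t. z + t *\<^sub>R h) has_derivative (\<lambda>s. s *\<^sub>R h)) (at t)" by (auto intro!: derivative_eq_intros)
      from has_derivative_compose[OF this has_derivative_frechet[OF smooth_on_differentiable[OF S in\<Omega>]]]
      have "((\<lambda>t. S (z + t *\<^sub>R h)) has_derivative (\<lambda>s. frechet_derivative S (at (z + t *\<^sub>R h)) (s *\<^sub>R h))) (at t)" .
      moreover have "(\<lambda>s. frechet_derivative S (at (z + t *\<^sub>R h)) (s *\<^sub>R h))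
          = (*) (Re h * A 1 (z + t *\<^sub>R h) + Im h * A \<i> (z + t *\<^sub>R h))"
        using linear_cmul[OF linS[OF in\<Omega>]] linear_complex_split[OF linS[OF in\<Omega>], of h]
        by (auto simp: A_def mult.commute)
      ultimately have "((\<lambda>t. S (z + t *\<^sub>R h)) has_real_derivative
          (Re h * A 1 (z + t *\<^sub>R h) + Im h * A \<i> (z + t *\<^sub>R h))) (at t)"
        by (simp add: has_field_derivative_def)
      then show ?thesis unfolding f_def f'_def by (auto intro!: derivative_eq_intros)
    qed
    obtain \<xi> where \<xi>: "0 < \<xi>" "\<xi> < 1" "f 1 - f 0 = (1 - 0) * f' \<xi>"
      using MVT2[of 0 1 f f'] df by auto
    let ?k = "\<xi> *\<^sub>R h"
    have "norm ?k < d 1" "norm ?k < d \<i>" using small[of \<xi>] \<xi> \<delta> by auto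
    then have b: "\<bar>A 1 (z + ?k) - A 1 z - \<xi> * A' 1 h\<bar> \<le> \<epsilon> / 2 * norm h"
        "\<bar>A \<i> (z + ?k) - A \<i> z - \<xi> * A' \<i> h\<bar> \<le> \<epsilon> / 2 * norm h"
    proof -
      have "\<epsilon> / 2 * norm ?k \<le> \<epsilon> / 2 * norm h"
        using \<xi> \<epsilon> mult_right_mono[of \<xi> 1 "norm h"] by (intro mult_left_mono) auto
      then show "\<bar>A 1 (z + ?k) - A 1 z - \<xi> * A' 1 h\<bar> \<le> \<epsilon> / 2 * norm h"
        "\<bar>A \<i> (z + ?k) - A \<i> z - \<xi> * A' \<i> h\<bar> \<le> \<epsilon> / 2 * norm h"
        using d(2)[of "z + ?k" 1] d(2)[of "z + ?k" \<i>] \<open>norm ?k < d 1\<close> \<open>norm ?k < d \<i>\<close>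
        by (auto simp: linear_cmul[OF linA])
    qed
    have "f' \<xi> = Re h * (A 1 (z + ?k) - A 1 z - \<xi> * A' 1 h) + Im h * (A \<i> (z + ?k) - A \<i> z - \<xi> * A' \<i> h)"
      unfolding f'_def D2_def by (simp add: algebra_simps)
    also have "\<bar>\<dots>\<bar> \<le> \<bar>Re h\<bar> * (\<epsilon> / 2 * norm h) + \<bar>Im h\<bar> * (\<epsilon> / 2 * norm h)"
      by (rule order_trans[OF abs_triangle_ineq]) (unfold abs_mult, intro add_mono mult_left_mono b abs_ge_zero)
    also have "\<dots> \<le> norm h * (\<epsilon> / 2 * norm h) + norm h * (\<epsilon> / 2 * norm h)"
      using \<epsilon> by (intro add_mono mult_right_mono abs_Re_le_cmod abs_Im_le_cmod) auto
    finally have "\<bar>f 1 - f 0\<bar> \<le> \<epsilon> * (norm h)\<^sup>2" using \<xi> by (simp add: power2_eq_square mult_ac)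
    moreover have "f 1 - f 0 = S (z + h) - S z
        - qform (A 1 z) (A \<i> z) (A' 1 1 / 2) ((A' 1 \<i> + A' \<i> 1) / 2) (A' \<i> \<i> / 2) h"
      unfolding f_def D2_def qform_def
      by (simp add: linear_complex_split[OF linA, of _ h] power2_eq_square field_simps)
    ultimately show "\<bar>S (z + h) - S z
        - qform (A 1 z) (A \<i> z) (A' 1 1 / 2) ((A' 1 \<i> + A' \<i> 1) / 2) (A' \<i> \<i> / 2) h\<bar> \<le> \<epsilon> * (norm h)\<^sup>2"
      by simp
  qed
qed

lemma circle_average_laplacian:
  fixes S :: "complex \<Rightarrow> real"
  assumes S: "smooth_on S \<Omega>" and \<Omega>: "open \<Omega>" "z \<in> \<Omega>" and \<eta>: "\<eta> > 0"
  shows "\<forall>\<^sub>F r in at_right 0. \<bar>circle_average S z r - S z - laplacian S z / 4 * r\<^sup>2\<bar> \<le> \<eta> * r\<^sup>2"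
proof -
  obtain e where e: "e > 0" "ball z e \<subseteq> \<Omega>" using \<Omega> open_contains_ball by blast
  have int: "\<forall>\<^sub>F r in at_right 0. circle_integrable S z r"
    using eventually_at_right_0_less[OF e(1)]
  proof eventually_elim
    case (elim r)
    show ?case
      by (rule circle_integrable_continuous, rule continuous_on_subset[OF smooth_on_imp_continuous_on[OF S]])
         (use elim e in force)+
  qed
  have "(laplacian S z / 4) = (frechet_derivative (\<lambda>w. frechet_derivative S (at w) 1) (at z) 1 / 2
      + frechet_derivative (\<lambda>w. frechet_derivative S (at w) \<i>) (at z) \<i> / 2) / 2"
    by (simp add: laplacian_def Basis_complex_def)
  then show ?thesis
    using circle_average_peano[OF smooth_peano[OF S \<Omega>] int \<eta>] by (simp only:)
qed

text \<open>Both averages in the definition are computed from Laplacians: that of \<open>v \<bullet> y\<close> is \<open>v \<bullet> \<Delta>y\<close>, and that of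
\<open>\<bar>y - y z\<bar>\<^sup>2\<close> at \<open>z\<close> is twice the energy density.\<close>

lemma nearly_harmonic_of_laplacian_bound:
  fixes y :: "complex \<Rightarrow> 'b::euclidean_space"
  assumes y: "smooth_on y \<Omega>" and \<Omega>: "open \<Omega>" "z \<in> \<Omega>" and C: "C \<ge> 0"
    and le: "norm (laplacian y z) \<le> C * (\<Sum>b\<in>Basis. (norm (frechet_derivative y (at z) b))\<^sup>2)"
  shows "nearly_harmonic C y z"
  unfolding nearly_harmonic_def
proof (intro allI impI)
  fix v :: 'b and \<eta> :: real assume \<eta>: "\<eta> > 0"
  let ?E = "\<Sum>b\<in>Basis. (norm (frechet_derivative y (at z) b))\<^sup>2"
  have Dy: "(y has_derivative frechet_derivative y (at w)) (at w)" if "w \<in> \<Omega>" for w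
    by (rule has_derivative_frechet[OF smooth_on_differentiable[OF y that]])
  have Dyb: "((\<lambda>w. frechet_derivative y (at w) b) has_derivative
      frechet_derivative (\<lambda>w. frechet_derivative y (at w) b) (at z)) (at z)" for b
    by (rule has_derivative_frechet[OF smooth_on_differentiable[OF smooth_on_frechet_derivative[OF y] \<Omega>(2)]])
  have s1: "smooth_on (\<lambda>w. v \<bullet> y w) \<Omega>"
    by (rule smooth_on_bounded_linear_compose[OF bounded_linear_inner_right \<Omega>(1) y])
  have s2: "smooth_on (\<lambda>w. (norm (y w - y z))\<^sup>2) \<Omega>"
  proof -
    have d: "smooth_on (\<lambda>w. y w + (- y z)) \<Omega>" by (intro smooth_on_add \<Omega> y smooth_on_const)
    show ?thesis using smooth_on_bilinear[OF bounded_bilinear_inner \<Omega>(1) d d]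
      by (simp add: power2_norm_eq_inner)
  qed
  have l1: "laplacian (\<lambda>w. v \<bullet> y w) z = v \<bullet> laplacian y z"
  proof -
    have "frechet_derivative (\<lambda>w. frechet_derivative (\<lambda>w. v \<bullet> y w) (at w) b) (at z) b
        = v \<bullet> frechet_derivative (\<lambda>w. frechet_derivative y (at w) b) (at z) b" for b
    proof -
      have "frechet_derivative (\<lambda>w. frechet_derivative (\<lambda>w. v \<bullet> y w) (at w) b) (at z)
          = frechet_derivative (\<lambda>w. v \<bullet> frechet_derivative y (at w) b) (at z)"
        by (rule frechet_derivative_cong_open[OF \<Omega>])
           (simp add: frechet_derivative_eqI[OF has_derivative_inner_right[OF Dy]])
      then show ?thesis
        using frechet_derivative_eqI[OF has_derivative_inner_right[OF Dyb[of b], of v]] by simp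
    qed
    then show ?thesis by (simp add: laplacian_def inner_sum_right)
  qed
  have l2: "laplacian (\<lambda>w. (norm (y w - y z))\<^sup>2) z = 2 * ?E"
  proof -
    have "frechet_derivative (\<lambda>w. frechet_derivative (\<lambda>w. (norm (y w - y z))\<^sup>2) (at w) b) (at z) b
        = 2 * (norm (frechet_derivative y (at z) b))\<^sup>2" for b
    proof -
      have D2: "((\<lambda>w. (norm (y w - y z))\<^sup>2) has_derivative
          (\<lambda>k. 2 * ((y w - y z) \<bullet> frechet_derivative y (at w) k))) (at w)" if "w \<in> \<Omega>" for w
        unfolding power2_norm_eq_inner
        by (rule has_derivative_eq_rhs, (rule derivative_intros Dy that)+) (auto simp: inner_commute)
      have "frechet_derivative (\<lambda>w. frechet_derivative (\<lambda>w. (norm (y w - y z))\<^sup>2) (at w) b) (at z)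
          = frechet_derivative (\<lambda>w. 2 * ((y w - y z) \<bullet> frechet_derivative y (at w) b)) (at z)"
        by (rule frechet_derivative_cong_open[OF \<Omega>]) (simp add: frechet_derivative_eqI[OF D2])
      moreover have "((\<lambda>w. 2 * ((y w - y z) \<bullet> frechet_derivative y (at w) b)) has_derivative
          (\<lambda>k. 2 * (frechet_derivative y (at z) k \<bullet> frechet_derivative y (at z) b))) (at z)"
        by (rule has_derivative_eq_rhs, (rule derivative_intros Dy \<Omega>(2) Dyb)+) auto
      ultimately show ?thesis by (simp add: frechet_derivative_eqI power2_norm_eq_inner)
    qed
    then show ?thesis by (simp add: laplacian_def sum_distrib_left)
  qed
  define k where "k = C * norm v + 1"
  have k: "k > 0" using C unfolding k_def by (simp add: add_nonneg_pos)
  have "\<forall>\<^sub>F r in at_right 0. \<bar>circle_average (\<lambda>w. v \<bullet> y w) z r - v \<bullet> y z - v \<bullet> laplacian y z / 4 * r\<^sup>2\<bar> \<le> (\<eta> / 2) * r\<^sup>2"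
    using circle_average_laplacian[OF s1 \<Omega>, of "\<eta> / 2"] \<eta> unfolding l1 by simp
  moreover have "\<forall>\<^sub>F r in at_right 0. \<bar>circle_average (\<lambda>w. (norm (y w - y z))\<^sup>2) z r - ?E / 2 * r\<^sup>2\<bar> \<le> (\<eta> / 2 / k) * r\<^sup>2"
    using circle_average_laplacian[OF s2 \<Omega>, of "\<eta> / 2 / k"] \<eta> k unfolding l2 by simp
  ultimately show "\<forall>\<^sub>F r in at_right 0. \<bar>circle_average (\<lambda>w. v \<bullet> y w) z r - v \<bullet> y z\<bar>
      \<le> C * norm v * circle_average (\<lambda>w. (norm (y w - y z))\<^sup>2) z r + \<eta> * r\<^sup>2"
  proof eventually_elim
    case (elim r)
    let ?D = "circle_average (\<lambda>w. (norm (y w - y z))\<^sup>2) z r"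
    have "\<bar>v \<bullet> laplacian y z\<bar> \<le> norm v * (C * ?E)"
      using Cauchy_Schwarz_ineq2[of v "laplacian y z"] mult_left_mono[OF le, of "norm v"] by simp
    then have "\<bar>v \<bullet> laplacian y z / 4 * r\<^sup>2\<bar> \<le> norm v * (C * ?E) / 4 * r\<^sup>2"
      unfolding abs_mult by (intro mult_mono) auto
    also have "\<dots> \<le> C * norm v * (?E / 2 * r\<^sup>2)"
      using C by (simp add: sum_nonneg mult_nonneg_nonneg)
    also have "\<dots> \<le> C * norm v * (?D + (\<eta> / 2 / k) * r\<^sup>2)"
      using elim(2) C by (intro mult_left_mono) (auto simp: abs_le_iff)
    also have "\<dots> \<le> C * norm v * ?D + (\<eta> / 2) * r\<^sup>2"
    proof -
      have "C * norm v * (\<eta> / 2 / k) \<le> k * (\<eta> / 2 / k)"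
        using \<eta> k unfolding k_def by (intro mult_right_mono) auto
      also have "\<dots> = \<eta> / 2" using k by simp
      finally have "C * norm v * (\<eta> / 2 / k) * r\<^sup>2 \<le> \<eta> / 2 * r\<^sup>2" by (rule mult_right_mono) simp
      then show ?thesis by (simp add: distrib_left mult.assoc)
    qed
    finally show ?case using elim(1) by linarith
  qed
qed

section \<open>Harmonic discs are nearly harmonic in charts\<close>

lemma compact_continuous_bounded:
  fixes f :: "'a::topological_space \<Rightarrow> real"
  assumes "compact K" "continuous_on K f"
  shows "\<exists>B\<ge>0. \<forall>x\<in>K. \<bar>f x\<bar> \<le> B"
proof -
  have "bounded (f ` K)" using compact_continuous_image[OF assms(2,1)] compact_imp_bounded by blast
  then obtain B where "\<forall>x\<in>K. norm (f x) \<le> B" by (auto simp: bounded_iff)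
  then show ?thesis by (intro exI[of _ "max B 0"]) auto
qed

text \<open>The Euler-Lagrange equation tested with the Laplacian itself bounds \<open>g(\<Delta>y, \<Delta>y)\<close> by \<open>\<bar>\<Delta>y\<bar>\<close> times the
energy density; on compact sets the metric is uniformly positive and has bounded derivatives.\<close>

lemma laplacian_le_energy_density:
  fixes M :: "('m::{t2_space,second_countable_topology}, 'n::finite) riemannian"
  assumes R: "riemannian_manifold M" and c: "c \<in> charts M" and K: "compact K" "K \<subseteq> cimage c"
  shows "\<exists>C\<ge>0. \<forall>u z. harmonic M u \<longrightarrow> z \<in> unit_disc \<inter> u -` cdom c \<longrightarrow> cmap c (u z) \<in> K \<longrightarrow>
    norm (laplacian (cmap c \<circ> u) z) \<le> C * (\<Sum>b\<in>Basis. (norm (frechet_derivative (cmap c \<circ> u) (at z) b))\<^sup>2)"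
proof (cases "K = {}")
  case True
  then show ?thesis by (intro exI[of _ 0]) auto
next
  case False
  let ?g = "gcoef M c" and ?D = "\<lambda>i j x. frechet_derivative (gcoef M c i j) (at x)"
  have sg: "smooth_on (?g i j) (cimage c)" for i j by (rule smooth_on_gcoef[OF R c])
  have "\<exists>B\<ge>0. \<forall>x\<in>K. \<bar>?D i j x k\<bar> \<le> B" for i j k
    by (rule compact_continuous_bounded[OF K(1)])
       (rule continuous_on_subset[OF smooth_on_imp_continuous_on[OF smooth_on_frechet_derivative[OF sg]] K(2)])
  then obtain B1 where B1: "\<And>i j k. B1 i j k \<ge> 0" "\<And>i j k x. x \<in> K \<Longrightarrow> \<bar>?D i j x k\<bar> \<le> B1 i j k" by metis
  define B where "B = (\<Sum>i\<in>UNIV. \<Sum>j\<in>UNIV. \<Sum>k\<in>Basis. B1 i j k)"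
  have B0: "B \<ge> 0" unfolding B_def by (intro sum_nonneg B1)
  have B: "\<bar>?D i j x h\<bar> \<le> B * norm h" if x: "x \<in> K" for i j x h
  proof -
    have df: "?g i j differentiable (at x)" using smooth_on_differentiable[OF sg] x K(2) by blast
    have "\<bar>?D i j x h\<bar> = \<bar>\<Sum>k\<in>Basis. (h \<bullet> k) *\<^sub>R ?D i j x k\<bar>"
      by (subst frechet_derivative_sum_Basis[OF df]) simp
    also have "\<dots> \<le> (\<Sum>k\<in>Basis. norm h * B1 i j k)"
      by (rule order_trans[OF sum_abs], rule sum_mono)
         (auto simp: abs_mult intro!: mult_mono Basis_le_norm B1 x)
    also have "\<dots> = norm h * (\<Sum>k\<in>Basis. B1 i j k)" by (simp add: sum_distrib_left)
    also have "\<dots> \<le> norm h * B"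
    proof (rule mult_left_mono)
      have "(\<Sum>k\<in>Basis. B1 i j k) \<le> (\<Sum>j\<in>UNIV. \<Sum>k\<in>Basis. B1 i j k)"
        by (rule member_le_sum[where f = "\<lambda>j. \<Sum>k\<in>Basis. B1 i j k"]) (auto intro!: sum_nonneg B1)
      also have "\<dots> \<le> B" unfolding B_def
        by (rule member_le_sum[where f = "\<lambda>i. \<Sum>j\<in>UNIV. \<Sum>k\<in>Basis. B1 i j k"]) (auto intro!: sum_nonneg B1)
      finally show "(\<Sum>k\<in>Basis. B1 i j k) \<le> B" .
    qed simp
    finally show ?thesis by (simp add: mult.commute)
  qed
  have "\<exists>c0>0. \<forall>x\<in>K. \<forall>v. c0 * (norm v)\<^sup>2 \<le> ginner M c x v v"
  proof -
    let ?S = "K \<times> sphere (0::real^'n) 1"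
    have "compact ?S" using K by (intro compact_Times) auto
    moreover have "axis undefined 1 \<in> sphere (0::real^'n) 1" by simp
    then have "?S \<noteq> {}" using False by auto
    moreover have "continuous_on ?S (\<lambda>q. ginner M c (fst q) (snd q) (snd q))"
      unfolding ginner_gcoef
      by (intro continuous_intros continuous_on_compose2[OF smooth_on_imp_continuous_on[OF sg]])
         (use K(2) in auto)
    ultimately obtain q where q: "q \<in> ?S"
      "\<forall>q'\<in>?S. ginner M c (fst q) (snd q) (snd q) \<le> ginner M c (fst q') (snd q') (snd q')"
      using continuous_attains_inf[of ?S "\<lambda>q. ginner M c (fst q) (snd q) (snd q)"] by blast
    let ?c0 = "ginner M c (fst q) (snd q) (snd q)"
    have "snd q \<noteq> 0" "fst q \<in> cimage c" using q(1) K(2) by auto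
    then have c0: "?c0 > 0" using R c unfolding riemannian_manifold_def by blast
    have "?c0 * (norm v)\<^sup>2 \<le> ginner M c x v v" if x: "x \<in> K" for x v
    proof (cases "v = 0")
      case True
      then show ?thesis by (simp add: ginner_def)
    next
      case False
      let ?e = "(1 / norm v) *\<^sub>R v"
      have "(x, ?e) \<in> ?S" using x False by simp
      then have "?c0 \<le> ginner M c x ?e ?e" using q(2) by force
      also have "\<dots> = ginner M c x v v / (norm v)\<^sup>2"
        by (simp add: ginner_def matrix_vector_mult_scaleR power2_eq_square)
      finally show ?thesis using False by (simp add: field_simps)
    qed
    then show ?thesis using c0 by blast
  qed
  then obtain c0 where c0: "c0 > 0" "\<And>x v. x \<in> K \<Longrightarrow> c0 * (norm v)\<^sup>2 \<le> ginner M c x v v" by blast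
  let ?n = "real CARD('n)"
  define C where "C = 3 * ?n\<^sup>2 * B / (2 * c0)"
  show ?thesis
  proof (intro exI[of _ C] conjI allI impI)
    show "0 \<le> C" unfolding C_def using B0 c0 by simp
    fix u :: "complex \<Rightarrow> 'm" and z
    assume harm: "harmonic M u" and z: "z \<in> unit_disc \<inter> u -` cdom c" and zK: "cmap c (u z) \<in> K"
    let ?y = "cmap c \<circ> u"
    let ?Dy = "\<lambda>b. frechet_derivative ?y (at z) b"
    let ?s = "\<lambda>b. frechet_derivative (\<lambda>\<zeta>. frechet_derivative ?y (at \<zeta>) b) (at z) b"
    let ?L = "laplacian ?y z" and ?E = "\<Sum>b\<in>Basis. (norm (?Dy b))\<^sup>2"
    have yK: "?y z \<in> K" using zK by simp
    have comp: "\<bar>x $ i\<bar> \<le> norm x" for x :: "real^'n" and i by (rule component_le_norm_cart)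
    have EL: "(\<Sum>b\<in>Basis. \<Sum>i\<in>UNIV. \<Sum>j\<in>UNIV. ?Dy b $ i * ?D i j (?y z) ?L * ?Dy b $ j)
      = 2 * (\<Sum>b\<in>Basis. \<Sum>i\<in>UNIV. \<Sum>j\<in>UNIV.
        ?L $ i * (?D i j (?y z) (?Dy b) * ?Dy b $ j + ?g i j (?y z) * (?s b $ j)))"
      by (rule euler_lagrange[OF R c harm z])
    have split: "(\<Sum>b\<in>Basis. \<Sum>i\<in>UNIV. \<Sum>j\<in>UNIV.
        ?L $ i * (?D i j (?y z) (?Dy b) * ?Dy b $ j + ?g i j (?y z) * (?s b $ j)))
      = (\<Sum>b\<in>Basis. \<Sum>i\<in>UNIV. \<Sum>j\<in>UNIV. ?L $ i * ?D i j (?y z) (?Dy b) * ?Dy b $ j) + ginner M c (?y z) ?L ?L"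
    proof -
      have "ginner M c (?y z) ?L ?L = (\<Sum>i\<in>UNIV. \<Sum>j\<in>UNIV. \<Sum>b\<in>Basis. ?L $ i * ?g i j (?y z) * ?s b $ j)"
        unfolding ginner_gcoef by (simp add: laplacian_def sum_distrib_left)
      also have "\<dots> = (\<Sum>i\<in>UNIV. \<Sum>b\<in>Basis. \<Sum>j\<in>UNIV. ?L $ i * ?g i j (?y z) * ?s b $ j)"
        by (intro sum.cong refl sum.swap)
      also have "\<dots> = (\<Sum>b\<in>Basis. \<Sum>i\<in>UNIV. \<Sum>j\<in>UNIV. ?L $ i * ?g i j (?y z) * ?s b $ j)"
        by (rule sum.swap)
      finally show ?thesis by (simp add: sum.distrib[symmetric] algebra_simps)
    qed
    have b1: "\<bar>\<Sum>b\<in>Basis. \<Sum>i\<in>UNIV. \<Sum>j\<in>UNIV. ?Dy b $ i * ?D i j (?y z) ?L * ?Dy b $ j\<bar> \<le> ?n\<^sup>2 * B * norm ?L * ?E"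
    proof -
      have "\<bar>\<Sum>b\<in>Basis. \<Sum>i\<in>UNIV. \<Sum>j\<in>UNIV. ?Dy b $ i * ?D i j (?y z) ?L * ?Dy b $ j\<bar>
        \<le> (\<Sum>b\<in>Basis. \<Sum>i\<in>(UNIV::'n set). \<Sum>j\<in>(UNIV::'n set). norm (?Dy b) * (B * norm ?L) * norm (?Dy b))"
        by (rule order_trans[OF sum_abs] sum_mono)+
           (auto simp: abs_mult intro!: mult_mono comp B yK zK mult_nonneg_nonneg B0)
      also have "\<dots> = ?n\<^sup>2 * B * norm ?L * ?E"
        by (simp add: sum_distrib_left power2_eq_square mult_ac)
      finally show ?thesis .
    qed
    have b2: "\<bar>\<Sum>b\<in>Basis. \<Sum>i\<in>UNIV. \<Sum>j\<in>UNIV. ?L $ i * ?D i j (?y z) (?Dy b) * ?Dy b $ j\<bar> \<le> ?n\<^sup>2 * B * norm ?L * ?E"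
    proof -
      have "\<bar>\<Sum>b\<in>Basis. \<Sum>i\<in>UNIV. \<Sum>j\<in>UNIV. ?L $ i * ?D i j (?y z) (?Dy b) * ?Dy b $ j\<bar>
        \<le> (\<Sum>b\<in>Basis. \<Sum>i\<in>(UNIV::'n set). \<Sum>j\<in>(UNIV::'n set). norm ?L * (B * norm (?Dy b)) * norm (?Dy b))"
        by (rule order_trans[OF sum_abs] sum_mono)+
           (auto simp: abs_mult intro!: mult_mono comp B yK zK mult_nonneg_nonneg B0)
      also have "\<dots> = ?n\<^sup>2 * B * norm ?L * ?E"
        by (simp add: sum_distrib_left power2_eq_square mult_ac)
      finally show ?thesis .
    qed
    have "2 * (c0 * (norm ?L)\<^sup>2) \<le> 2 * ginner M c (?y z) ?L ?L" using c0(2)[OF yK] by simp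
    also have "\<dots> \<le> 3 * (?n\<^sup>2 * B * norm ?L * ?E)"
    proof -
      have "2 * G \<le> 3 * T" if "X = 2 * (S + G)" "\<bar>X\<bar> \<le> T" "\<bar>S\<bar> \<le> T" for G S T X :: real
      proof -
        have "2 * G = X - 2 * S" using that(1) by simp
        moreover have "X \<le> T" "- S \<le> T" using that(2,3) by (simp_all add: abs_le_iff)
        ultimately show ?thesis by simp
      qed
      from this[OF EL[unfolded split] b1 b2] show ?thesis .
    qed
    finally have main: "2 * (c0 * (norm ?L)\<^sup>2) \<le> 3 * (?n\<^sup>2 * B * norm ?L * ?E)" .
    show "norm ?L \<le> C * ?E"
    proof (cases "?L = 0")
      case True
      then show ?thesis using \<open>0 \<le> C\<close> by (simp add: sum_nonneg)
    next
      case False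
      then have L: "norm ?L > 0" by simp
      have "norm ?L * (2 * c0 * norm ?L) \<le> norm ?L * (3 * ?n\<^sup>2 * B * ?E)"
        using main by (simp add: power2_eq_square mult_ac)
      then have "2 * c0 * norm ?L \<le> 3 * ?n\<^sup>2 * B * ?E" using L by simp
      then show ?thesis unfolding C_def using c0(1) by (simp add: field_simps)
    qed
  qed
qed

theorem nearly_harmonic_in_chart:
  fixes M :: "('m::{t2_space,second_countable_topology}, 'n::finite) riemannian"
  assumes R: "riemannian_manifold M" and c: "c \<in> charts M" and K: "compact K" "K \<subseteq> cimage c"
  shows "\<exists>C\<ge>0. \<forall>u z. harmonic M u \<longrightarrow> z \<in> unit_disc \<inter> u -` cdom c \<longrightarrow> cmap c (u z) \<in> K \<longrightarrow>
    nearly_harmonic C (cmap c \<circ> u) z"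
proof -
  obtain C where C: "C \<ge> 0" "\<And>u z. harmonic M u \<Longrightarrow> z \<in> unit_disc \<inter> u -` cdom c \<Longrightarrow> cmap c (u z) \<in> K \<Longrightarrow>
    norm (laplacian (cmap c \<circ> u) z) \<le> C * (\<Sum>b\<in>Basis. (norm (frechet_derivative (cmap c \<circ> u) (at z) b))\<^sup>2)"
    using laplacian_le_energy_density[OF R c K] by blast
  have "nearly_harmonic C (cmap c \<circ> u) z"
    if harm: "harmonic M u" and z: "z \<in> unit_disc \<inter> u -` cdom c" "cmap c (u z) \<in> K" for u z
  proof -
    have su: "smooth_map M unit_disc u" using harm unfolding harmonic_def by blast
    show ?thesis
      by (rule nearly_harmonic_of_laplacian_bound[OF smooth_map_chart[OF su c] open_chart_preimage[OF R c _ su] z(1) C(1) C(2)[OF harm z]])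
         simp
  qed
  then show ?thesis using C(1) by blast
qed

section \<open>Strong convexity of the squared distance in a chart\<close>

lemma smooth_C2_bounds:
  fixes f :: "'a::euclidean_space \<Rightarrow> 'b::euclidean_space"
  assumes f: "smooth_on f S" and S: "open S" "x \<in> S"
  shows "\<exists>s>0. \<exists>B\<ge>1. cball x s \<subseteq> S \<and>
    (\<forall>a\<in>cball x s. \<forall>h. norm (frechet_derivative f (at a) h) \<le> B * norm h) \<and>
    (\<forall>a\<in>cball x s. \<forall>b\<in>cball x s. norm (f a - f b) \<le> B * norm (a - b) \<and>
      norm (f a - f b - frechet_derivative f (at b) (a - b)) \<le> B * (norm (a - b))\<^sup>2)"
proof -
  obtain s where s: "s > 0" "cball x s \<subseteq> S" using S open_contains_cball by blast
  let ?K = "cball x s"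
  have bd: "\<exists>B\<ge>0. \<forall>a\<in>?K. \<forall>h. norm (frechet_derivative g (at a) h) \<le> B * norm h"
    if g: "smooth_on g S" for g :: "'a \<Rightarrow> 'b"
  proof -
    have "\<exists>B\<ge>0. \<forall>a\<in>?K. \<bar>norm (frechet_derivative g (at a) k)\<bar> \<le> B" for k
      by (rule compact_continuous_bounded[OF compact_cball])
         (intro continuous_on_norm continuous_on_subset[OF smooth_on_imp_continuous_on[OF smooth_on_frechet_derivative[OF g]] s(2)])
    then obtain B1 where B1: "\<And>k. B1 k \<ge> 0" "\<And>k a. a \<in> ?K \<Longrightarrow> norm (frechet_derivative g (at a) k) \<le> B1 k"
      by (metis abs_norm_cancel)
    have "norm (frechet_derivative g (at a) h) \<le> (\<Sum>k\<in>Basis. B1 k) * norm h" if a: "a \<in> ?K" for a h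
    proof -
      have df: "g differentiable (at a)" using smooth_on_differentiable[OF g] a s by blast
      have "norm (frechet_derivative g (at a) h) = norm (\<Sum>k\<in>Basis. (h \<bullet> k) *\<^sub>R frechet_derivative g (at a) k)"
        by (subst frechet_derivative_sum_Basis[OF df]) simp
      also have "\<dots> \<le> (\<Sum>k\<in>Basis. norm h * B1 k)"
        by (rule order_trans[OF norm_sum], rule sum_mono)
           (auto intro!: mult_mono Basis_le_norm B1 a)
      finally show ?thesis by (simp add: sum_distrib_left mult.commute)
    qed
    then show ?thesis using B1(1) by (intro exI[of _ "\<Sum>k\<in>Basis. B1 k"]) (auto intro: sum_nonneg)
  qed
  have lip: "norm (g a - g b) \<le> B * norm (a - b)"
    if g: "smooth_on g S" and B: "\<forall>a\<in>?K. \<forall>h. norm (frechet_derivative g (at a) h) \<le> B * norm h"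
      and ab: "a \<in> ?K" "b \<in> ?K" for g :: "'a \<Rightarrow> 'b" and B a b
  proof (rule differentiable_bound[OF convex_cball _ _ ab])
    fix w assume w: "w \<in> ?K"
    show "(g has_derivative frechet_derivative g (at w)) (at w within ?K)"
      using has_derivative_frechet[OF smooth_on_differentiable[OF g]] w s has_derivative_at_withinI by blast
    show "onorm (frechet_derivative g (at w)) \<le> B" using B w by (intro onorm_le) blast
  qed
  obtain B1 where B1: "B1 \<ge> 0" "\<forall>a\<in>?K. \<forall>h. norm (frechet_derivative f (at a) h) \<le> B1 * norm h"
    using bd[OF f] by blast
  have "\<forall>k. \<exists>B\<ge>0. \<forall>a\<in>?K. \<forall>h. norm (frechet_derivative (\<lambda>w. frechet_derivative f (at w) k) (at a) h) \<le> B * norm h"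
    using bd[OF smooth_on_frechet_derivative[OF f]] by blast
  then obtain B2 where B2: "\<And>k. B2 k \<ge> 0" "\<And>k. \<forall>a\<in>?K. \<forall>h. norm (frechet_derivative (\<lambda>w. frechet_derivative f (at w) k) (at a) h) \<le> B2 k * norm h"
    by metis
  define B3 where "B3 = (\<Sum>k\<in>Basis. B2 k)"
  have B30: "B3 \<ge> 0" unfolding B3_def by (intro sum_nonneg B2)
  have lipD: "norm (frechet_derivative f (at a) h - frechet_derivative f (at b) h) \<le> B3 * norm (a - b) * norm h"
    if ab: "a \<in> ?K" "b \<in> ?K" for a b h
  proof -
    have df: "f differentiable (at a)" "f differentiable (at b)" using smooth_on_differentiable[OF f] ab s by blast+
    have "linear (\<lambda>h. frechet_derivative f (at a) h - frechet_derivative f (at b) h)"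
      by (intro linear_compose_sub linear_frechet_derivative df)
    from linear_sum_Basis[OF this, of h]
    have "frechet_derivative f (at a) h - frechet_derivative f (at b) h
        = (\<Sum>k\<in>Basis. (h \<bullet> k) *\<^sub>R (frechet_derivative f (at a) k - frechet_derivative f (at b) k))" .
    also have "norm \<dots> \<le> (\<Sum>k\<in>Basis. norm h * (B2 k * norm (a - b)))"
      by (rule order_trans[OF norm_sum], rule sum_mono)
         (auto intro!: mult_mono Basis_le_norm lip[OF smooth_on_frechet_derivative[OF f] B2(2) ab])
    finally show ?thesis by (simp add: B3_def sum_distrib_left sum_distrib_right mult_ac)
  qed
  have second: "norm (f a - f b - frechet_derivative f (at b) (a - b)) \<le> B3 * (norm (a - b))\<^sup>2"
    if ab: "a \<in> ?K" "b \<in> ?K" for a b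
  proof -
    let ?L = "frechet_derivative f (at b)"
    have linL: "bounded_linear ?L"
      using has_derivative_frechet[OF smooth_on_differentiable[OF f]] ab s has_derivative_bounded_linear by blast
    have seg: "closed_segment b a \<subseteq> ?K" using ab by (simp add: closed_segment_subset)
    have "norm ((f a - ?L a) - (f b - ?L b)) \<le> (B3 * norm (a - b)) * norm (a - b)"
    proof (rule differentiable_bound[of "closed_segment b a" "\<lambda>w. f w - ?L w" "\<lambda>w h. frechet_derivative f (at w) h - ?L h"])
      fix w assume w: "w \<in> closed_segment b a"
      have "((\<lambda>w. f w - ?L w) has_derivative (\<lambda>h. frechet_derivative f (at w) h - ?L h)) (at w)"
        by (intro has_derivative_diff has_derivative_frechet smooth_on_differentiable[OF f]
            bounded_linear_imp_has_derivative[OF linL]) (use w seg s in auto)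
      then show "((\<lambda>w. f w - ?L w) has_derivative (\<lambda>h. frechet_derivative f (at w) h - ?L h)) (at w within closed_segment b a)"
        by (rule has_derivative_at_withinI)
      show "onorm (\<lambda>h. frechet_derivative f (at w) h - ?L h) \<le> B3 * norm (a - b)"
      proof (rule onorm_le)
        fix h
        have "norm (frechet_derivative f (at w) h - ?L h) \<le> B3 * norm (w - b) * norm h"
          using lipD[of w b h] w seg ab by blast
        also have "\<dots> \<le> B3 * norm (a - b) * norm h"
          using segment_bound(1)[OF w] B30 by (intro mult_right_mono mult_left_mono) (auto simp: norm_minus_commute)
        finally show "norm (frechet_derivative f (at w) h - ?L h) \<le> B3 * norm (a - b) * norm h" .
      qed
    qed auto
    moreover have "(f a - ?L a) - (f b - ?L b) = f a - f b - ?L (a - b)"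
      using linear_diff[OF bounded_linear.linear[OF linL]] by simp
    ultimately show ?thesis by (simp add: power2_eq_square mult.assoc)
  qed
  let ?B = "1 + B1 + B3"
  have "B1 * t \<le> ?B * t" "B3 * t \<le> ?B * t" if "t \<ge> 0" for t
    using that B1 B30 by (auto intro!: mult_right_mono)
  then have "\<forall>a\<in>?K. \<forall>h. norm (frechet_derivative f (at a) h) \<le> ?B * norm h"
    "\<forall>a\<in>?K. \<forall>b\<in>?K. norm (f a - f b) \<le> ?B * norm (a - b) \<and>
      norm (f a - f b - frechet_derivative f (at b) (a - b)) \<le> ?B * (norm (a - b))\<^sup>2"
    using B1(2) lip[OF f B1(2)] second by (meson norm_ge_zero order_trans zero_le_power2)+
  then show ?thesis using s B1(1) B30 by (intro exI[of _ s] exI[of _ ?B] conjI) auto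
qed

text \<open>Expanding \<open>\<tau> b\<close> around \<open>a\<close> leaves the error \<open>2 \<tau> a \<bullet> O(\<bar>b - a\<bar>\<^sup>2)\<close>, which is small as \<open>\<tau> a\<close> is near \<open>0\<close>,
while \<open>\<bar>\<tau> b - \<tau> a\<bar>\<^sup>2\<close> is comparable to \<open>\<bar>b - a\<bar>\<^sup>2\<close> because \<open>\<tau>\<close> has a smooth inverse. The slope \<open>l\<close> is
explicitly small near the zero of \<open>\<tau>\<close>; this is what makes nearly harmonic maps see the square term only.\<close>

lemma strongly_convex_square:
  fixes \<tau> \<sigma> :: "'a::euclidean_space \<Rightarrow> 'a"
  assumes \<tau>: "smooth_on \<tau> S" "open S" "x \<in> S" "\<tau> x = 0"
    and \<sigma>: "smooth_on \<sigma> T" "open T" "\<tau> ` S \<subseteq> T" "\<And>a. a \<in> S \<Longrightarrow> \<sigma> (\<tau> a) = a"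
  shows "\<exists>s>0. \<exists>c0>0. \<exists>L\<ge>0. cball x s \<subseteq> S \<and> (\<forall>a\<in>cball x s. \<exists>l. norm l \<le> L * norm (a - x) \<and>
    (\<forall>b\<in>cball x s. (norm (\<tau> a))\<^sup>2 + l \<bullet> (b - a) + c0 * (norm (b - a))\<^sup>2 \<le> (norm (\<tau> b))\<^sup>2))"
proof -
  obtain s1 B where s1: "s1 > 0" and B: "B \<ge> 1" and s1S: "cball x s1 \<subseteq> S"
    and D: "\<And>a h. a \<in> cball x s1 \<Longrightarrow> norm (frechet_derivative \<tau> (at a) h) \<le> B * norm h"
    and lip: "\<And>a b. a \<in> cball x s1 \<Longrightarrow> b \<in> cball x s1 \<Longrightarrow> norm (\<tau> a - \<tau> b) \<le> B * norm (a - b)"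
    and sec: "\<And>a b. a \<in> cball x s1 \<Longrightarrow> b \<in> cball x s1 \<Longrightarrow>
      norm (\<tau> a - \<tau> b - frechet_derivative \<tau> (at b) (a - b)) \<le> B * (norm (a - b))\<^sup>2"
    using smooth_C2_bounds[OF \<tau>(1-3)] by blast
  have "0 \<in> T" using \<tau>(3,4) \<sigma>(3) by force
  then obtain s2 B' where s2: "s2 > 0" and B': "B' \<ge> 1"
    and lip': "\<And>a b. a \<in> cball 0 s2 \<Longrightarrow> b \<in> cball 0 s2 \<Longrightarrow> norm (\<sigma> a - \<sigma> b) \<le> B' * norm (a - b)"
    using smooth_C2_bounds[OF \<sigma>(1,2)] by blast
  let ?n = "real DIM('a)"
  define c0 where "c0 = 1 / (2 * B'\<^sup>2)"
  define s where "s = Min {s1, s2 / B, c0 / (2 * B\<^sup>2)}"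
  have c0: "c0 > 0" unfolding c0_def using B' by simp
  have "s2 / B > 0" "c0 / (2 * B\<^sup>2) > 0" using s2 B c0 by auto
  then have s: "s > 0" "s \<le> s1" "s \<le> s2 / B" "s \<le> c0 / (2 * B\<^sup>2)" unfolding s_def using s1 by auto
  have sub: "a \<in> cball x s1" if "a \<in> cball x s" for a using that s by auto
  have \<tau>0: "norm (\<tau> a) \<le> B * norm (a - x)" if "a \<in> cball x s" for a
    using lip[of a x] sub[OF that] s1 \<tau>(4) by simp
  have \<tau>s: "\<tau> a \<in> cball 0 s2" if a: "a \<in> cball x s" for a
  proof -
    have "B * norm (a - x) \<le> B * s" using a B by (intro mult_left_mono) (auto simp: dist_norm norm_minus_commute)
    also have "\<dots> \<le> s2" using s B by (simp add: field_simps)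
    finally show ?thesis using \<tau>0[OF a] by simp
  qed
  show ?thesis
  proof (rule exI[of _ s], rule conjI[OF s(1)], rule exI[of _ c0], rule conjI[OF c0],
      rule exI[of _ "2 * ?n * B\<^sup>2"], intro conjI ballI)
    show "0 \<le> 2 * ?n * B\<^sup>2" by simp
    show "cball x s \<subseteq> S" using sub s1S by blast
    fix a assume a: "a \<in> cball x s"
    let ?L = "frechet_derivative \<tau> (at a)"
    define l where "l = (\<Sum>k\<in>Basis. (2 * (\<tau> a \<bullet> ?L k)) *\<^sub>R k)"
    have df: "\<tau> differentiable (at a)" using smooth_on_differentiable[OF \<tau>(1)] sub[OF a] s1S by blast
    have l: "l \<bullet> h = 2 * (\<tau> a \<bullet> ?L h)" for h
      by (subst frechet_derivative_sum_Basis[OF df, of h])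
         (simp add: l_def inner_sum_left inner_sum_right sum_distrib_left inner_commute mult_ac)
    show "\<exists>l. norm l \<le> 2 * ?n * B\<^sup>2 * norm (a - x) \<and>
      (\<forall>b\<in>cball x s. (norm (\<tau> a))\<^sup>2 + l \<bullet> (b - a) + c0 * (norm (b - a))\<^sup>2 \<le> (norm (\<tau> b))\<^sup>2)"
    proof (intro exI[of _ l] conjI ballI)
      have "norm l \<le> (\<Sum>k\<in>(Basis::'a set). 2 * (B * norm (a - x)) * B)"
        unfolding l_def
      proof (rule order_trans[OF norm_sum], rule sum_mono)
        fix k :: 'a assume k: "k \<in> Basis"
        have "\<bar>\<tau> a \<bullet> ?L k\<bar> \<le> norm (\<tau> a) * norm (?L k)" by (rule Cauchy_Schwarz_ineq2)
        also have "\<dots> \<le> (B * norm (a - x)) * B"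
          using \<tau>0[OF a] D[OF sub[OF a], of k] k B by (intro mult_mono) auto
        finally show "norm ((2 * (\<tau> a \<bullet> ?L k)) *\<^sub>R k) \<le> 2 * (B * norm (a - x)) * B" using k by simp
      qed
      then show "norm l \<le> 2 * ?n * B\<^sup>2 * norm (a - x)" by (simp add: power2_eq_square mult_ac)
      fix b assume b: "b \<in> cball x s"
      let ?d = "norm (b - a)"
      have "?d = norm (\<sigma> (\<tau> b) - \<sigma> (\<tau> a))" using \<sigma>(4) sub[OF a] sub[OF b] s1S by (simp add: subsetD)
      also have "\<dots> \<le> B' * norm (\<tau> b - \<tau> a)" by (rule lip'[OF \<tau>s[OF b] \<tau>s[OF a]])
      finally have "?d\<^sup>2 \<le> (B' * norm (\<tau> b - \<tau> a))\<^sup>2" by (intro power_mono) auto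
      then have 1: "2 * c0 * ?d\<^sup>2 \<le> (norm (\<tau> b - \<tau> a))\<^sup>2"
        unfolding c0_def using B' by (simp add: power_mult_distrib field_simps)
      let ?R = "\<tau> b - \<tau> a - ?L (b - a)"
      have "\<bar>2 * (\<tau> a \<bullet> ?R)\<bar> \<le> 2 * (norm (\<tau> a) * norm ?R)" using Cauchy_Schwarz_ineq2[of "\<tau> a" ?R] by simp
      also have "\<dots> \<le> 2 * ((B * s) * (B * ?d\<^sup>2))"
      proof -
        have "B * norm (a - x) \<le> B * s" using a B by (intro mult_left_mono) (auto simp: dist_norm norm_minus_commute)
        then have "norm (\<tau> a) \<le> B * s" using \<tau>0[OF a] by simp
        then have "norm (\<tau> a) * norm ?R \<le> (B * s) * (B * ?d\<^sup>2)"
          by (rule mult_mono[OF _ sec[OF sub[OF b] sub[OF a]]]) (use B s in auto)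
        then show ?thesis by simp
      qed
      also have "\<dots> = (2 * B\<^sup>2 * s) * ?d\<^sup>2" by (simp add: power2_eq_square)
      also have "\<dots> \<le> c0 * ?d\<^sup>2" using s(4) B by (intro mult_right_mono) (auto simp: field_simps)
      finally have 2: "- c0 * ?d\<^sup>2 \<le> 2 * (\<tau> a \<bullet> ?R)" by (simp add: abs_le_iff)
      have "(norm (\<tau> b))\<^sup>2 = (norm (\<tau> a))\<^sup>2 + 2 * (\<tau> a \<bullet> (\<tau> b - \<tau> a)) + (norm (\<tau> b - \<tau> a))\<^sup>2"
        using norm_sq_expand[of "\<tau> b" 0 "\<tau> a"] by simp
      also have "2 * (\<tau> a \<bullet> (\<tau> b - \<tau> a)) = l \<bullet> (b - a) + 2 * (\<tau> a \<bullet> ?R)"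
        unfolding l by (simp add: inner_diff_right)
      finally show "(norm (\<tau> a))\<^sup>2 + l \<bullet> (b - a) + c0 * ?d\<^sup>2 \<le> (norm (\<tau> b))\<^sup>2" using 1 2 by simp
    qed
  qed
qed

section \<open>Riemannian distance in a chart\<close>

lemma rdist_le_chart_dist:
  fixes M :: "('m::{t2_space,second_countable_topology}, 'n::finite) riemannian"
  assumes R: "riemannian_manifold M" and c: "c \<in> charts M" and K: "cball x s \<subseteq> cimage c"
  shows "\<exists>B\<ge>0. \<forall>a\<in>cball x s. \<forall>b\<in>cball x s. rdist M (cinv c a) (cinv c b) \<le> ennreal (B * norm (a - b))"
proof -
  note ch = is_chart_facts[OF riemannian_chart[OF R c]]
  let ?K = "cball x s" and ?n = "real CARD('n)"
  have "\<exists>B\<ge>0. \<forall>a\<in>?K. \<bar>gcoef M c i j a\<bar> \<le> B" for i j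
    by (rule compact_continuous_bounded[OF compact_cball])
       (rule continuous_on_subset[OF smooth_on_imp_continuous_on[OF smooth_on_gcoef[OF R c]] K])
  then obtain B1 where B1: "\<And>i j. B1 i j \<ge> 0" "\<And>i j a. a \<in> ?K \<Longrightarrow> \<bar>gcoef M c i j a\<bar> \<le> B1 i j" by metis
  define B where "B = (\<Sum>i\<in>UNIV. \<Sum>j\<in>UNIV. B1 i j)"
  have B0: "B \<ge> 0" unfolding B_def by (intro sum_nonneg B1)
  have gle: "ginner M c a v v \<le> B * (norm v)\<^sup>2" if a: "a \<in> ?K" for a v
  proof -
    have "v $ i * gcoef M c i j a * v $ j \<le> norm v * B1 i j * norm v" for i j
    proof -
      have "v $ i * gcoef M c i j a * v $ j \<le> \<bar>v $ i\<bar> * \<bar>gcoef M c i j a\<bar> * \<bar>v $ j\<bar>"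
        by (metis abs_ge_self abs_mult)
      also have "\<dots> \<le> norm v * B1 i j * norm v"
        by (intro mult_mono component_le_norm_cart B1 a) (auto intro: B1 mult_nonneg_nonneg)
      finally show ?thesis .
    qed
    then have "ginner M c a v v \<le> (\<Sum>i\<in>UNIV. \<Sum>j\<in>UNIV. norm v * B1 i j * norm v)"
      unfolding ginner_gcoef by (intro sum_mono)
    also have "\<dots> = B * (norm v)\<^sup>2"
      unfolding B_def by (simp add: sum_distrib_left sum_distrib_right power2_eq_square mult_ac)
    finally show ?thesis .
  qed
  have "rdist M (cinv c a) (cinv c b) \<le> ennreal (sqrt B * norm (a - b))" if ab: "a \<in> ?K" "b \<in> ?K" for a b
  proof -
    let ?G = "\<lambda>t::real. a + t *\<^sub>R (b - a)"
    let ?k = "\<lambda>t. cinv c (?G t)"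
    have GK: "?G t \<in> ?K" if "t \<in> {0..1}" for t
    proof -
      have "?G t = (1 - t) *\<^sub>R a + t *\<^sub>R b" by (simp add: algebra_simps)
      then show ?thesis using convexD[OF convex_cball ab, of "1 - t" t] that by simp
    qed
    have GI: "?G t \<in> cimage c" if "t \<in> {0..1}" for t using subsetD[OF K GK[OF that]] .
    have kc: "cmap c (?k t) = ?G t" if "t \<in> {0<..<1}" for t by (rule ch(6)[OF GI]) (use that in simp)
    have cont: "continuous_on {0..1} ?k"
      by (rule continuous_on_compose2[OF ch(4)], intro continuous_intros) (use GI in blast)
    have sm: "smooth_map M {0<..<1} ?k"
    proof (rule smooth_map_compose[OF R smooth_map_cinv[OF R c]])
      show "smooth_on ?G {0<..<1}"
        by (intro smooth_on_add smooth_on_const smooth_on_bounded_linear bounded_linear_scaleR_left) auto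
      show "?G ` {0<..<1} \<subseteq> cimage c" using GI by (intro image_subsetI) simp
    qed (use ch(2) in simp_all)
    have pb: "pullback M ?k t 1 1 \<le> B * (norm (b - a))\<^sup>2" if t: "t \<in> {0<..<1}" for t
    proof -
      have GIt: "?G t \<in> cimage c" by (rule GI) (use t in simp)
      have "(?G has_derivative (\<lambda>h. h *\<^sub>R (b - a))) (at t)" by (auto intro!: derivative_eq_intros)
      then have "((cmap c \<circ> ?k) has_derivative (\<lambda>h. h *\<^sub>R (b - a))) (at t)"
        by (rule has_derivative_transform_within_open[of _ _ t UNIV "{0<..<1}"])
           (use t kc in simp_all)
      from frechet_derivative_eqI[OF this]
      have "pullback M ?k t 1 1 = ginner M c (?G t) (b - a) (b - a)"
        using pullback_in_chart[OF R c ch(7)[OF GIt] _ t sm, of 1 1] kc[OF t] by simp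
      also have "\<dots> \<le> B * (norm (b - a))\<^sup>2" by (rule gle[OF GK]) (use t in auto)
      finally show ?thesis .
    qed
    have "rdist M (cinv c a) (cinv c b) \<le> curve_length M ?k"
      unfolding rdist_def
      by (rule INF_lower) (use cont sm in \<open>auto intro!: exI[of _ "{}"]\<close>)
    also have "\<dots> \<le> (\<integral>\<^sup>+t. ennreal (sqrt B * norm (a - b)) * indicator {0<..<1::real} t \<partial>lborel)"
      unfolding curve_length_def
    proof (rule nn_integral_mono)
      fix t :: real
      show "ennreal (sqrt (pullback M ?k t 1 1)) * indicator {0<..<1} t
          \<le> ennreal (sqrt B * norm (a - b)) * indicator {0<..<1} t"
      proof (cases "t \<in> {0<..<1}")
        case True
        have "sqrt (pullback M ?k t 1 1) \<le> sqrt (B * (norm (b - a))\<^sup>2)" by (rule real_sqrt_le_mono[OF pb[OF True]])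
        then have "sqrt (pullback M ?k t 1 1) \<le> sqrt B * norm (a - b)" by (simp add: real_sqrt_mult norm_minus_commute)
        then show ?thesis using True by (simp add: ennreal_leI)
      qed simp
    qed
    also have "\<dots> = ennreal (sqrt B * norm (a - b))" by (simp add: nn_integral_cmult_indicator)
    finally show ?thesis .
  qed
  then show ?thesis using B0 by (intro exI[of _ "sqrt B"]) auto
qed

section \<open>Submean value properties of MPSH functions along discs\<close>

text \<open>For integrable real functions the two extended integrals are finite, so that their difference is the
integral.\<close>

lemma circle_mean_eq_average:
  assumes G: "circle_integrable G z r" and f: "\<And>\<theta>. f (z + of_real r * cis \<theta>) = ereal (G (z + of_real r * cis \<theta>))"
  shows "circle_mean f z r = ereal (circle_average G z r)"
proof -
  let ?H = "\<lambda>\<theta>. indicator {0..2*pi} \<theta> *\<^sub>R G (z + of_real r * cis \<theta>)"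
  have int: "integrable lborel ?H" using G unfolding circle_integrable_def set_integrable_def .
  have 1: "(\<integral>\<^sup>+\<theta>\<in>{0..2*pi}. e2ennreal (f (z + of_real r * cis \<theta>)) \<partial>lborel) = (\<integral>\<^sup>+\<theta>. ennreal (?H \<theta>) \<partial>lborel)"
    unfolding f by (intro nn_integral_cong) (auto simp: indicator_def e2ennreal_ereal)
  have 2: "(\<integral>\<^sup>+\<theta>\<in>{0..2*pi}. e2ennreal (- f (z + of_real r * cis \<theta>)) \<partial>lborel) = (\<integral>\<^sup>+\<theta>. ennreal (- ?H \<theta>) \<partial>lborel)"
    unfolding f by (intro nn_integral_cong) (auto simp: indicator_def e2ennreal_ereal)
  have fin: "(\<integral>\<^sup>+\<theta>. ennreal (?H \<theta>) \<partial>lborel) \<noteq> \<infinity>" "(\<integral>\<^sup>+\<theta>. ennreal (- ?H \<theta>) \<partial>lborel) \<noteq> \<infinity>"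
    using int unfolding real_integrable_def by auto
  have e: "enn2ereal X = ereal (enn2real X)" if "X \<noteq> \<infinity>" for X
    using that by (cases X) (auto simp: enn2ereal_ennreal)
  have "circle_mean f z r = (ereal (enn2real (\<integral>\<^sup>+\<theta>. ennreal (?H \<theta>) \<partial>lborel))
      - ereal (enn2real (\<integral>\<^sup>+\<theta>. ennreal (- ?H \<theta>) \<partial>lborel))) / ereal (2 * pi)"
    unfolding circle_mean_def 1 2 e[OF fin(1)] e[OF fin(2)] ..
  also have "\<dots> = ereal ((LINT \<theta>|lborel. ?H \<theta>) / (2 * pi))"
    unfolding real_lebesgue_integral_def[OF int] by simp
  finally show ?thesis by (simp add: circle_average_def set_lebesgue_integral_def)
qed

text \<open>The restriction of \<open>u\<close> to a small round disc with image in \<open>W\<close> is an admissible competitor in the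
definition of an MPSH function, and its circle averages are those of \<open>u\<close>.\<close>

lemma MPSH_almost_submean:
  fixes M :: "('m::{t2_space,second_countable_topology}, 'n::finite) riemannian"
  assumes R: "riemannian_manifold M" and u: "conformal_harmonic_immersed_disc M u"
    and g: "MPSH M W g" and z: "z \<in> unit_disc" "u z \<in> W"
    and G: "\<And>w. w \<in> unit_disc \<Longrightarrow> u w \<in> W \<Longrightarrow> g (u w) = ereal (G w)"
    and int: "\<forall>\<^sub>F r in at_right 0. circle_integrable G z r"
  shows "almost_submean G z"
proof -
  have W: "open W" using g unfolding MPSH_def by blast
  have "continuous_on unit_disc u"
    using u unfolding conformal_harmonic_immersed_disc_def conformal_def smooth_map_def by blast
  then have "open (unit_disc \<inter> u -` W)" by (rule continuous_open_preimage[OF _ open_ball W])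
  moreover have "z \<in> unit_disc \<inter> u -` W" using z by simp
  ultimately obtain d where d: "d > 0" "ball z d \<subseteq> unit_disc \<inter> u -` W"
    by (meson open_contains_ball)
  let ?u = "\<lambda>x. u (z + d *\<^sub>R x)"
  have "conformal_harmonic_immersed_disc M ?u"
    by (rule conformal_harmonic_immersed_disc_affine[OF R u d(1)]) (use d in auto)
  moreover have in_ball: "z + d *\<^sub>R x \<in> ball z d" if "x \<in> unit_disc" for x
    using that d(1) by (simp add: dist_norm)
  then have "?u ` unit_disc \<subseteq> W" using d(2) by blast
  ultimately have sub: "subharmonic_on unit_disc (g \<circ> ?u)" using g unfolding MPSH_def by blast
  have le: "G z \<le> circle_average G z r" if r: "circle_integrable G z r" "0 < r" "r < d" for r
  proof -
    have eq: "(g \<circ> ?u) (0 + of_real (r / d) * cis \<theta>) = ereal (G (z + of_real r * cis \<theta>))" for \<theta>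
    proof -
      have "z + d *\<^sub>R (of_real (r / d) * cis \<theta>) = z + of_real r * cis \<theta>"
        using d(1) by (simp add: scaleR_conv_of_real)
      moreover have "z + of_real r * cis \<theta> \<in> ball z d" using r by (simp add: dist_norm norm_mult)
      moreover from this have "z + of_real r * cis \<theta> \<in> unit_disc" "u (z + of_real r * cis \<theta>) \<in> W"
        using d(2) by blast+
      ultimately show ?thesis using G by simp
    qed
    have "(g \<circ> ?u) 0 \<le> circle_mean (g \<circ> ?u) 0 (r / d)"
    proof -
      have "r / d < 1" using r d by simp
      then have "r / d > 0" "cball (0::complex) (r / d) \<subseteq> unit_disc"
        using r d by (auto intro: le_less_trans simp del: divide_less_eq_1 divide_less_eq_1_pos)
      then show ?thesis using sub unfolding subharmonic_on_def by blast
    qed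
    also have "circle_mean (g \<circ> ?u) 0 (r / d) = circle_mean (\<lambda>w. ereal (G w)) z r"
      unfolding circle_mean_def eq ..
    also have "\<dots> = ereal (circle_average G z r)" by (rule circle_mean_eq_average[OF r(1)]) simp
    finally show ?thesis using G z by simp
  qed
  show ?thesis
    unfolding almost_submean_def
  proof (intro conjI int allI impI)
    fix \<eta> :: real assume "\<eta> > 0"
    show "\<forall>\<^sub>F r in at_right 0. G z \<le> circle_average G z r + \<eta> * r\<^sup>2"
      using int eventually_at_right_0_less[OF d(1)]
    proof eventually_elim
      case (elim r)
      have "0 \<le> \<eta> * r\<^sup>2" using \<open>\<eta> > 0\<close> by simp
      then show ?case using le[of r] elim by linarith
    qed
  qed
qed

lemma subharmonic_on_usc_real:
  assumes f: "subharmonic_on S f" and S: "open S" and w: "\<And>z. z \<in> S \<Longrightarrow> f z = ereal (w z)"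
  shows "usc_real S w"
  unfolding usc_real_def
proof (intro ballI allI impI)
  fix z c assume z: "z \<in> S" and c: "w z < c"
  have "openin (top_of_set S) {x\<in>S. f x < ereal c}" using f unfolding subharmonic_on_def usc_on_def by blast
  then have o: "open {x\<in>S. f x < ereal c}" using S by (rule openin_open_trans)
  have "z \<in> {x\<in>S. f x < ereal c}" using z c w by simp
  then have "\<forall>\<^sub>F x in at z. x \<in> {x\<in>S. f x < ereal c}" using o eventually_at_in_open' by blast
  then have "\<forall>\<^sub>F x in at z. w x < c" by eventually_elim (use w in auto)
  then show "\<forall>\<^sub>F x in at z within S. w x < c" using filter_leD[OF at_le[OF subset_UNIV]] by blast
qed

section \<open>Hoelder estimates above and below the distance to the circle\<close>

text \<open>With \<open>\<delta> = 1 - \<bar>z1\<bar>\<close>, the coupling estimate on a disc of radius \<open>\<delta> / 2\<close>, where \<open>w \<le> 2 C \<delta>\<close>, gives the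
single steps of the chain.\<close>

lemma coarse_holder:
  fixes Y :: "complex \<Rightarrow> 'b::real_inner"
  assumes a: "norm a = 1" and r: "0 < r" "r \<le> 1/2" and A: "A \<ge> 0" and C: "C \<ge> 0"
    and usc: "usc_real unit_disc w"
    and w: "\<And>z. z \<in> unit_disc \<Longrightarrow> dist z a < r \<Longrightarrow> 0 \<le> w z \<and> w z \<le> C * (1 - norm z)"
    and Y: "continuous_on (unit_disc \<inter> ball a r) Y"
    and sub: "\<And>z z'. z \<in> unit_disc \<inter> ball a r \<Longrightarrow> z' \<in> unit_disc \<inter> ball a r \<Longrightarrow>
      almost_submean (\<lambda>z. A * w z - (norm (Y z - Y z'))\<^sup>2) z"
  shows "\<exists>K\<ge>0. \<forall>z1\<in>unit_disc \<inter> ball a (r / 40). \<forall>z2\<in>unit_disc \<inter> ball a (r / 40).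
    norm (Y z1 - Y z2) \<le> K * (sqrt (1 - norm z1) + sqrt (1 - norm z2) + sqrt (dist z1 z2))"
proof -
  let ?s = "r / 2" and ?C = "4 * sqrt (A * C)"
  have step: "norm (Y z1 - Y z2) \<le> ?C * sqrt (1 - norm z1)"
    if z: "z1 \<in> unit_disc" "z2 \<in> unit_disc" "dist z1 a < ?s" "dist z2 a < ?s"
      and d: "dist z1 z2 \<le> (1 - norm z1) / 4" for z1 z2
  proof -
    define \<delta> where "\<delta> = 1 - norm z1"
    let ?m = "(z1 + z2) / 2" and ?R = "\<delta> / 2"
    have \<delta>: "0 < \<delta>" "\<delta> < ?s"
      using z(1,3) a norm_triangle_ineq2[of a z1] unfolding \<delta>_def by (simp_all add: dist_norm norm_minus_commute)
    have "?m - z1 = (z2 - z1) / 2" by (simp add: field_simps)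
    then have "dist ?m z1 = dist z2 z1 / 2" by (simp only: dist_norm norm_divide) simp
    then have m: "dist ?m z1 \<le> \<delta> / 8" using d unfolding \<delta>_def by (simp add: dist_commute)
    have cb: "z \<in> unit_disc" "dist z a < r" "1 - norm z \<le> 2 * \<delta>" if "z \<in> cball ?m ?R" for z
    proof -
      have "dist z z1 \<le> dist z ?m + dist ?m z1" by (rule dist_triangle)
      then have dz: "dist z z1 \<le> 5 * \<delta> / 8" using that m by (simp add: dist_commute)
      have "norm z \<le> norm z1 + dist z z1" "norm z1 \<le> norm z + dist z z1"
        using norm_triangle_ineq2[of z z1] norm_triangle_ineq2[of z1 z] by (simp_all add: dist_norm norm_minus_commute)
      then show "z \<in> unit_disc" "1 - norm z \<le> 2 * \<delta>" using dz \<delta> unfolding \<delta>_def by auto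
      show "dist z a < r" using dist_triangle[of z a z1] dz \<delta> z(3) by simp
    qed
    have cbs: "cball ?m ?R \<subseteq> unit_disc \<inter> ball a r" using cb by (auto simp: dist_commute)
    have "(norm (Y z1 - Y z2))\<^sup>2 \<le> 8 * A * (C * (2 * \<delta>))"
    proof (rule coupling_estimate[where R = ?R])
      show "dist z1 z2 \<le> ?R / 2" using d unfolding \<delta>_def by simp
      show "usc_real (cball ?m ?R) w" by (rule usc_real_subset[OF usc]) (use cbs in auto)
      show "continuous_on (cball ?m ?R) Y" by (rule continuous_on_subset[OF Y cbs])
      fix z assume z': "z \<in> cball ?m ?R"
      show "0 \<le> w z \<and> w z \<le> C * (2 * \<delta>)"
        using w[OF cb(1,2)[OF z']] mult_left_mono[OF cb(3)[OF z'] C] by simp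
    next
      fix q z assume q: "q \<in> {Y z1, Y z2}" and z': "z \<in> ball ?m ?R"
      have zz: "z \<in> unit_disc \<inter> ball a r" using z' cbs ball_subset_cball by blast
      have "z1 \<in> unit_disc \<inter> ball a r" "z2 \<in> unit_disc \<inter> ball a r" using z r by (auto simp: dist_commute)
      then show "almost_submean (\<lambda>z. A * w z - (norm (Y z - q))\<^sup>2) z" using q sub[OF zz] by auto
    qed (use \<delta> A in auto)
    also have "\<dots> = (?C * sqrt \<delta>)\<^sup>2" using A C \<delta> by (simp add: power_mult_distrib)
    finally show ?thesis
      unfolding \<delta>_def[symmetric] by (rule power2_le_imp_le) (use A C \<delta> in simp)
  qed
  have "norm (Y z1 - Y z2) \<le> 400 * ?C * (sqrt (1 - norm z1) + sqrt (1 - norm z2) + sqrt (dist z1 z2))"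
    if "z1 \<in> unit_disc \<inter> ball a (r / 40)" "z2 \<in> unit_disc \<inter> ball a (r / 40)" for z1 z2
    by (rule hardy_littlewood_chain[OF a, of ?s]) (use r step A C that in \<open>auto simp: dist_commute\<close>)
  then show ?thesis using A C by (intro exI[of _ "400 * ?C"]) auto
qed

text \<open>If \<open>\<bar>z1 - z2\<bar>\<close> is at least half the distance of both points to the circle, the coarse estimate already is
a Hoelder estimate. Otherwise the coarse estimate bounds the oscillation on a disc of radius \<open>\<delta> / 2\<close>
by a multiple of \<open>\<surd>\<delta>\<close>, and the interior estimate, scaled to this disc, turns \<open>\<surd>\<delta> \<cdot> \<surd>(\<bar>z1 - z2\<bar> / \<delta>)\<close> into
\<open>\<surd>\<bar>z1 - z2\<bar>\<close>.\<close>

lemma fine_holder: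
  fixes y :: "complex \<Rightarrow> 'b::real_inner"
  assumes a: "norm a = 1" and r: "0 < r" and K: "K \<ge> 0" and C: "C \<ge> 0"
    and coarse: "\<And>z1 z2. z1 \<in> unit_disc \<inter> ball a r \<Longrightarrow> z2 \<in> unit_disc \<inter> ball a r \<Longrightarrow>
      norm (y z1 - y z2) \<le> K * (sqrt (1 - norm z1) + sqrt (1 - norm z2) + sqrt (dist z1 z2))"
    and y: "continuous_on (unit_disc \<inter> ball a r) y"
    and nh: "\<And>z. z \<in> unit_disc \<inter> ball a r \<Longrightarrow> nearly_harmonic C y z"
  shows "\<exists>t>0. t \<le> r \<and> (\<exists>H\<ge>0. \<forall>z1\<in>unit_disc \<inter> ball a t. \<forall>z2\<in>unit_disc \<inter> ball a t.
    norm (y z1 - y z2) \<le> H * sqrt (dist z1 z2))"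
proof -
  \<comment> \<open>radius so small that the oscillation \<open>4 * K * sqrt \<delta>\<close> meets the smallness condition of the interior estimate\<close>
  define e where "e = 1 / (256 * C * K + 1)"
  have CK: "C * K \<ge> 0" using C K by simp
  then have e: "e > 0" unfolding e_def by (simp add: add_nonneg_pos)
  define t where "t = min (r / 2) (e\<^sup>2)"
  have t: "0 < t" "t \<le> r / 2" "t \<le> e\<^sup>2" using r e unfolding t_def by auto
  have near: "norm (y z1 - y z2) \<le> 64 * K * sqrt (dist z1 z2)"
    if z1: "z1 \<in> unit_disc \<inter> ball a t" and d: "dist z1 z2 \<le> (1 - norm z1) / 2" for z1 z2
  proof -
    define \<delta> where "\<delta> = 1 - norm z1"
    have \<delta>: "0 < \<delta>" "\<delta> < t"
      using z1 a norm_triangle_ineq2[of a z1] unfolding \<delta>_def by (auto simp: dist_norm)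
    let ?R = "\<delta> / 2" and ?\<omega> = "4 * K * sqrt \<delta>"
    have cb: "z \<in> unit_disc \<inter> ball a r" "1 - norm z \<le> 3 / 2 * \<delta>" if "z \<in> cball z1 ?R" for z
    proof -
      have dz: "dist z z1 \<le> \<delta> / 2" using that by (simp add: dist_commute)
      have "norm z \<le> norm z1 + dist z z1" "norm z1 \<le> norm z + dist z z1"
        using norm_triangle_ineq2[of z z1] norm_triangle_ineq2[of z1 z] by (simp_all add: dist_norm norm_minus_commute)
      then show "1 - norm z \<le> 3 / 2 * \<delta>" using dz unfolding \<delta>_def by simp
      have "norm z < 1" using \<open>norm z \<le> norm z1 + dist z z1\<close> dz \<delta> unfolding \<delta>_def by simp
      moreover have "dist a z < r" using dist_triangle[of a z z1] dz \<delta> z1 t by (simp add: dist_commute)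
      ultimately show "z \<in> unit_disc \<inter> ball a r" by simp
    qed
    have "norm (y z2 - y z1) \<le> 8 * ?\<omega> * sqrt (dist z2 z1 / ?R)"
    proof (rule nearly_harmonic_holder_half[of ?R _ _ C])
      show "continuous_on (cball z1 ?R) y" by (rule continuous_on_subset[OF y]) (use cb in blast)
      show "nearly_harmonic C y z" if "z \<in> ball z1 ?R" for z using nh cb[of z] that by auto
      show "64 * C * ?\<omega> \<le> 1"
      proof -
        have "sqrt \<delta> \<le> e" using \<delta> t e by (intro real_le_lsqrt) auto
        then have "256 * (C * K) * sqrt \<delta> \<le> 256 * (C * K) * e" using CK by (intro mult_left_mono) auto
        also have "\<dots> \<le> 1" using CK unfolding e_def by (simp add: divide_le_eq mult.assoc)
        finally show ?thesis by (simp add: mult_ac)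
      qed
      show "norm (y z - y z1) \<le> ?\<omega>" if z: "z \<in> cball z1 ?R" for z
      proof -
        have "norm (y z - y z1) \<le> K * (sqrt (1 - norm z) + sqrt (1 - norm z1) + sqrt (dist z z1))"
          by (rule coarse) (use cb[OF z] z1 t in auto)
        also have "\<dots> \<le> K * (3 / 2 * sqrt \<delta> + sqrt \<delta> + sqrt \<delta>)"
        proof (intro mult_left_mono add_mono K)
          have "sqrt (1 - norm z) \<le> sqrt ((3 / 2)\<^sup>2 * \<delta>)"
            using cb(2)[OF z] \<delta> by (intro real_sqrt_le_mono) (simp add: power2_eq_square)
          then show "sqrt (1 - norm z) \<le> 3 / 2 * sqrt \<delta>" by (simp add: real_sqrt_mult)
          show "sqrt (1 - norm z1) \<le> sqrt \<delta>" unfolding \<delta>_def ..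
          show "sqrt (dist z z1) \<le> sqrt \<delta>" using z \<delta> by (intro real_sqrt_le_mono) (simp add: dist_commute)
        qed
        also have "\<dots> \<le> ?\<omega>" using K \<delta> by (simp add: algebra_simps)
        finally show ?thesis .
      qed
    qed (use \<delta> K C d in \<open>auto simp: \<delta>_def\<close>)
    also have "\<dots> = 32 * K * (sqrt \<delta> * sqrt (dist z1 z2 / ?R))" by (simp add: dist_commute)
    also have "sqrt \<delta> * sqrt (dist z1 z2 / ?R) = sqrt (2 * dist z1 z2)"
      using \<delta> by (simp flip: real_sqrt_mult)
    also have "\<dots> \<le> sqrt (2\<^sup>2 * dist z1 z2)" by (intro real_sqrt_le_mono) simp
    also have "\<dots> = 2 * sqrt (dist z1 z2)" by (simp add: real_sqrt_mult)
    finally show ?thesis using K by (simp add: norm_minus_commute mult_left_mono)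
  qed
  have "norm (y z1 - y z2) \<le> 64 * K * sqrt (dist z1 z2)"
    if z1: "z1 \<in> unit_disc \<inter> ball a t" and z2: "z2 \<in> unit_disc \<inter> ball a t" for z1 z2
  proof -
    consider "dist z1 z2 \<le> (1 - norm z1) / 2" | "dist z2 z1 \<le> (1 - norm z2) / 2"
      | "1 - norm z1 \<le> 2 * dist z1 z2" "1 - norm z2 \<le> 2 * dist z1 z2"
      by (fastforce simp: dist_commute)
    then show ?thesis
    proof cases
      case 1
      then show ?thesis by (rule near[OF z1])
    next
      case 2
      then show ?thesis using near[OF z2] by (simp add: dist_commute norm_minus_commute)
    next
      case 3
      have le: "sqrt b \<le> 2 * sqrt (dist z1 z2)" if "b \<le> 2 * dist z1 z2" for b
      proof -
        have "sqrt b \<le> sqrt (2\<^sup>2 * dist z1 z2)" using that by (intro real_sqrt_le_mono) (simp add: order_trans)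
        then show ?thesis by (simp add: real_sqrt_mult)
      qed
      have "norm (y z1 - y z2) \<le> K * (sqrt (1 - norm z1) + sqrt (1 - norm z2) + sqrt (dist z1 z2))"
        by (rule coarse) (use z1 z2 t in auto)
      also have "\<dots> \<le> K * (64 * sqrt (dist z1 z2))"
      proof (intro mult_left_mono K)
        have "0 \<le> sqrt (dist z1 z2)" by simp
        then show "sqrt (1 - norm z1) + sqrt (1 - norm z2) + sqrt (dist z1 z2) \<le> 64 * sqrt (dist z1 z2)"
          using le[OF 3(1)] le[OF 3(2)] by linarith
      qed
      finally show ?thesis by (simp add: mult_ac)
    qed
  qed
  then show ?thesis using t K r by (intro exI[of _ t] conjI exI[of _ "64 * K"]) auto
qed

section \<open>Functions dominated by a strictly MPSH function\<close>

lemma almost_submean_const: "almost_submean (\<lambda>w. c) z"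
  by (rule almost_submean_harmonic_qform[where p = 0 and q = 0 and a = 0 and b = 0]) (simp add: qform_def)

text \<open>The submean part \<open>A (w - e f)\<close> is split off; the remainder \<open>A e f - \<beta>\<close> is bounded below by a quadratic polynomial
in \<open>y\<close>, in which the strongly convex \<open>f\<close> supplies the square term as soon as \<open>A\<close> is large.\<close>

lemma almost_submean_of_strict_domination:
  fixes y :: "complex \<Rightarrow> 'b::real_inner" and w f \<beta> :: "complex \<Rightarrow> real"
  assumes nh: "nearly_harmonic C y z" and C: "C \<ge> 0" and S: "open S" "z \<in> S" "continuous_on S y"
    and e: "e > 0" and strict: "almost_submean (\<lambda>z. w z - e * f z) z"
    and f: "continuous_on S f" "C * norm lf \<le> c0 / 2"
      "\<And>b. b \<in> S \<Longrightarrow> f z + lf \<bullet> (y b - y z) + c0 * (norm (y b - y z))\<^sup>2 \<le> f b"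
    and \<beta>: "continuous_on S \<beta>" "norm l \<le> \<Lambda>"
      "\<And>b. b \<in> S \<Longrightarrow> \<beta> b \<le> \<beta> z + l \<bullet> (y b - y z) + \<kappa> * (norm (y b - y z))\<^sup>2"
    and A: "A \<ge> 0" "2 * (\<kappa> + C * \<Lambda>) \<le> A * e * c0"
  shows "almost_submean (\<lambda>z. A * w z - \<beta> z) z"
proof -
  have "almost_submean (\<lambda>z. A * e * f z - \<beta> z) z"
  proof (rule almost_submean_of_quadratic_minorant[OF nh S, where l = "(A * e) *\<^sub>R lf - l" and \<kappa> = "A * e * c0 - \<kappa>"])
    have Ae: "A * e \<ge> 0" using A e by simp
    have "norm ((A * e) *\<^sub>R lf - l) \<le> A * e * norm lf + \<Lambda>"
      by (rule order_trans[OF norm_triangle_ineq4]) (use Ae \<beta>(2) in \<open>simp add: abs_of_nonneg\<close>)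
    then have "C * norm ((A * e) *\<^sub>R lf - l) \<le> C * (A * e * norm lf + \<Lambda>)" using C by (rule mult_left_mono)
    also have "\<dots> = (A * e) * (C * norm lf) + C * \<Lambda>" by (simp add: algebra_simps)
    also have "\<dots> \<le> (A * e) * (c0 / 2) + C * \<Lambda>" using mult_left_mono[OF f(2) Ae] by simp
    also have "\<dots> \<le> A * e * c0 - \<kappa>" using A(2) by simp
    finally show "C * norm ((A * e) *\<^sub>R lf - l) \<le> A * e * c0 - \<kappa>" .
    obtain d where d: "d > 0" "ball z d \<subseteq> S" using S(1,2) open_contains_ball by blast
    show "\<forall>\<^sub>F r in at_right 0. circle_integrable (\<lambda>z. A * e * f z - \<beta> z) z r"
      using eventually_at_right_0_less[OF d(1)]
    proof eventually_elim
      case (elim r)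
      then have "sphere z r \<subseteq> S" using d by force
      then show ?case
        using elim continuous_on_subset[OF f(1)] continuous_on_subset[OF \<beta>(1)]
        by (intro circle_integrable_continuous continuous_intros) auto
    qed
    fix b assume b: "b \<in> S"
    have "A * e * (f z + lf \<bullet> (y b - y z) + c0 * (norm (y b - y z))\<^sup>2) \<le> A * e * f b"
      using f(3)[OF b] Ae by (rule mult_left_mono)
    then show "(A * e * f z - \<beta> z) + ((A * e) *\<^sub>R lf - l) \<bullet> (y b - y z) + (A * e * c0 - \<kappa>) * (norm (y b - y z))\<^sup>2
        \<le> A * e * f b - \<beta> b"
      using \<beta>(3)[OF b] by (simp add: inner_diff_left distrib_left left_diff_distrib)
  qed
  then have "almost_submean (\<lambda>z. A * (w z - e * f z) + (A * e * f z - \<beta> z)) z"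
    by (intro almost_submean_add almost_submean_scale strict A)
  then show ?thesis by (simp add: algebra_simps)
qed

text \<open>The kink of the truncation at \<open>t = S\<close> bends downwards after squaring, because \<open>q \<ge> 0\<close>; so a parabola
with coefficient \<open>1\<close> lies above the graph at every point. This permits the truncated distance in place of a
smooth cutoff function.\<close>

lemma square_of_truncation_semiconcave:
  fixes S q t0 :: real
  assumes "0 \<le> q" "q \<le> S" "0 \<le> t0"
  shows "\<exists>b. \<bar>b\<bar> \<le> 2 * S \<and> (\<forall>t. (max 0 (S - t) - q)\<^sup>2 \<le> (max 0 (S - t0) - q)\<^sup>2 + b * (t - t0) + (t - t0)\<^sup>2)"
proof (cases "t0 < S")
  case True
  show ?thesis
  proof (intro exI[of _ "- 2 * (S - t0 - q)"] conjI allI)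
    show "\<bar>- 2 * (S - t0 - q)\<bar> \<le> 2 * S" using assms True by (auto simp: abs_le_iff)
    fix t
    have rhs: "(max 0 (S - t0) - q)\<^sup>2 + - 2 * (S - t0 - q) * (t - t0) + (t - t0)\<^sup>2 = (S - t - q)\<^sup>2"
      using True by (simp add: power2_eq_square algebra_simps)
    have "\<bar>max 0 (S - t) - q\<bar> \<le> \<bar>S - t - q\<bar>" using assms by (auto simp: max_def)
    then show "(max 0 (S - t) - q)\<^sup>2 \<le> (max 0 (S - t0) - q)\<^sup>2 + - 2 * (S - t0 - q) * (t - t0) + (t - t0)\<^sup>2"
      unfolding rhs by (simp add: abs_le_square_iff)
  qed
next
  case False
  show ?thesis
  proof (intro exI[of _ 0] conjI allI)
    show "\<bar>0\<bar> \<le> 2 * S" using assms by simp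
    fix t
    have "(max 0 (S - t) - q)\<^sup>2 \<le> q\<^sup>2 + (t - t0)\<^sup>2"
    proof (cases "t < S")
      case True
      have "(S - t - q)\<^sup>2 = q\<^sup>2 + (S - t)\<^sup>2 - 2 * (q * (S - t))" by (simp add: power2_eq_square algebra_simps)
      also have "\<dots> \<le> q\<^sup>2 + (S - t)\<^sup>2" using True assms by simp
      also have "(S - t)\<^sup>2 \<le> (t0 - t)\<^sup>2" using True False by (intro power_mono) auto
      finally show ?thesis using True by (simp add: power2_commute[of t0 t])
    qed simp
    then show "(max 0 (S - t) - q)\<^sup>2 \<le> (max 0 (S - t0) - q)\<^sup>2 + 0 * (t - t0) + (t - t0)\<^sup>2"
      using False by simp
  qed
qed

lemma truncated_distance_quadratic:
  fixes x a b :: "'b::real_inner"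
  assumes q: "0 \<le> q" "q \<le> S" and a: "norm (a - x) \<le> s" and s: "0 \<le> s"
  shows "\<exists>l. norm l \<le> 4 * S * s \<and> (\<forall>b. norm (b - x) \<le> s \<longrightarrow>
    (max 0 (S - (norm (b - x))\<^sup>2) - q)\<^sup>2 \<le> (max 0 (S - (norm (a - x))\<^sup>2) - q)\<^sup>2
      + l \<bullet> (b - a) + (2 * S + 16 * s\<^sup>2) * (norm (b - a))\<^sup>2)"
proof -
  obtain k where k: "\<bar>k\<bar> \<le> 2 * S"
    "\<And>t. (max 0 (S - t) - q)\<^sup>2 \<le> (max 0 (S - (norm (a - x))\<^sup>2) - q)\<^sup>2 + k * (t - (norm (a - x))\<^sup>2) + (t - (norm (a - x))\<^sup>2)\<^sup>2"
    using square_of_truncation_semiconcave[OF q, of "(norm (a - x))\<^sup>2"] by auto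
  show ?thesis
  proof (intro exI[of _ "(2 * k) *\<^sub>R (a - x)"] conjI allI impI)
    have "\<bar>2 * k\<bar> * norm (a - x) \<le> (4 * S) * s" using k(1) a by (intro mult_mono) auto
    then show "norm ((2 * k) *\<^sub>R (a - x)) \<le> 4 * S * s" by simp
    fix b assume b: "norm (b - x) \<le> s"
    let ?d = "norm (b - a)" and ?t = "(norm (b - x))\<^sup>2 - (norm (a - x))\<^sup>2"
    have t: "?t = 2 * ((a - x) \<bullet> (b - a)) + ?d\<^sup>2" using norm_sq_expand[of b x a] by simp
    have d: "?d \<le> 2 * s" using norm_triangle_ineq4[of "b - x" "a - x"] a b by simp
    have "\<bar>(a - x) \<bullet> (b - a)\<bar> \<le> s * ?d"
      using Cauchy_Schwarz_ineq2[of "a - x" "b - a"] mult_right_mono[OF a, of ?d] by simp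
    moreover have "?d\<^sup>2 \<le> 2 * s * ?d" using mult_right_mono[OF d, of ?d] by (simp add: power2_eq_square)
    moreover have "0 \<le> ?d\<^sup>2" by simp
    ultimately have "\<bar>?t\<bar> \<le> 4 * s * ?d" unfolding t abs_le_iff by linarith
    then have "?t\<^sup>2 \<le> (4 * s * ?d)\<^sup>2" using s by (simp add: abs_le_square_iff[symmetric] abs_mult)
    then have t2: "?t\<^sup>2 \<le> 16 * s\<^sup>2 * ?d\<^sup>2" by (simp add: power_mult_distrib)
    have "k * ?t = (2 * k) * ((a - x) \<bullet> (b - a)) + k * ?d\<^sup>2" unfolding t by (simp add: algebra_simps)
    also have "k * ?d\<^sup>2 \<le> 2 * S * ?d\<^sup>2" using k(1) by (intro mult_right_mono) auto
    finally show "(max 0 (S - (norm (b - x))\<^sup>2) - q)\<^sup>2 \<le> (max 0 (S - (norm (a - x))\<^sup>2) - q)\<^sup>2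
      + ((2 * k) *\<^sub>R (a - x)) \<bullet> (b - a) + (2 * S + 16 * s\<^sup>2) * ?d\<^sup>2"
      using k(2)[of "(norm (b - x))\<^sup>2"] t2 by (simp add: distrib_right)
  qed
qed

section \<open>Hoelder extension of the disc\<close>

theorem theorem3p3:
  fixes M :: "('m::{t2_space, second_countable_topology}, 'n::finite) riemannian"
    and \<rho> :: "'m \<Rightarrow> ereal"
    and u :: "complex \<Rightarrow> 'm"
    and \<gamma> :: "complex set"
    and a :: complex
    and p :: 'm
  assumes "riemannian_manifold M"
    and "CARD('n) \<ge> 2"
    and "MPSH M UNIV \<rho>"
    and "conformal_harmonic_immersed_disc M u"
    and "\<forall>\<zeta>\<in>unit_disc. \<rho> (u \<zeta>) \<ge> 0"
    and "open_arc \<gamma>"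
    and "\<forall>b\<in>\<gamma>. ((\<lambda>\<zeta>. \<rho> (u \<zeta>)) \<longlongrightarrow> 0) (at b within unit_disc)"
    and "a \<in> \<gamma>"
    and "p \<in> cluster_set u a"
    and "\<exists>V. open V \<and> p \<in> V \<and> strictly_MPSH M V \<rho>"
  shows "\<exists>W U. open W \<and> a \<in> W \<and>
           (\<forall>\<zeta>\<in>W \<inter> unit_disc. U \<zeta> = u \<zeta>) \<and>
           holder_continuous_on M (1/2) (W \<inter> (unit_disc \<union> \<gamma>)) U"
proof -
  note R = assms(1)
  obtain V where V: "open V" "p \<in> V" "strictly_MPSH M V \<rho>" using assms(10) by blast
  obtain x e W where x: "normal_coordinates M p x" and e: "e > 0" and W: "open W" "p \<in> W" "W \<subseteq> V \<inter> cdom x"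
    and mp: "MPSH M W (\<lambda>q. \<rho> q - ereal (e * (norm (cmap x q))\<^sup>2))"
    using V(2,3) unfolding strictly_MPSH_def by blast
  have xc: "compatible_chart M x" "p \<in> cdom x" "cmap x p = 0"
    using x unfolding normal_coordinates_def by auto
  obtain c where c: "c \<in> charts M" "p \<in> cdom c" using riemannian_chart_exists[OF R] by blast
  have isc: "is_chart c" by (rule riemannian_chart[OF R c(1)])
  have isx: "is_chart x" using xc(1) unfolding compatible_chart_def by blast
  note chc = is_chart_facts[OF isc] and chx = is_chart_facts[OF isx]
  define yp where "yp = cmap c p"
  define S0 where "S0 = cmap c ` (cdom c \<inter> W)"
  have S0eq: "S0 = cimage c \<inter> cinv c -` W"
    unfolding S0_def using chc(5,6,7) by (force simp: image_iff)
  have oS0: "open S0" unfolding S0eq by (rule continuous_open_preimage[OF chc(4,2) W(1)])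
  have ypS0: "yp \<in> S0" unfolding yp_def S0_def using c W by blast
  define \<tau> where "\<tau> = transition c x"
  have \<tau>: "\<tau> (cmap c q) = cmap x q" if "q \<in> cdom c" for q
    unfolding \<tau>_def transition_def using chc(5)[OF that] by simp
  have s\<tau>: "smooth_on \<tau> S0"
  proof (rule smooth_on_subset)
    show "smooth_on \<tau> (overlap c x)" using xc(1) c(1) unfolding compatible_chart_def \<tau>_def by blast
    show "S0 \<subseteq> overlap c x" unfolding S0_def using W(3) by blast
  qed
  have s\<sigma>: "smooth_on (transition x c) (overlap x c)"
    using xc(1) c(1) unfolding compatible_chart_def by blast
  have \<tau>T: "\<tau> ` S0 \<subseteq> overlap x c"
  proof
    fix b assume "b \<in> \<tau> ` S0"
    then obtain q where "q \<in> cdom c" "q \<in> W" "b = cmap x q" unfolding S0_def using \<tau> by auto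
    then show "b \<in> overlap x c" using W(3) by blast
  qed
  have \<sigma>\<tau>: "transition x c (\<tau> b) = b" if b: "b \<in> S0" for b
  proof -
    obtain q where "q \<in> cdom c" "q \<in> W" "b = cmap c q" using b unfolding S0_def by blast
    then show ?thesis using \<tau> chx(5)[of q] W(3) by (auto simp: transition_def)
  qed
  have \<tau>0: "\<tau> yp = 0" unfolding yp_def using \<tau>[OF c(2)] xc(3) by simp
  obtain s c0 L where s: "s > 0" and c0: "c0 > 0" and L: "L \<ge> 0" and sS0: "cball yp s \<subseteq> S0"
    and conv: "\<And>b. b \<in> cball yp s \<Longrightarrow> \<exists>l. norm l \<le> L * norm (b - yp) \<and>
      (\<forall>b'\<in>cball yp s. (norm (\<tau> b))\<^sup>2 + l \<bullet> (b' - b) + c0 * (norm (b' - b))\<^sup>2 \<le> (norm (\<tau> b'))\<^sup>2)"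
    using strongly_convex_square[OF s\<tau> oS0 ypS0 \<tau>0 s\<sigma> open_overlap[OF isx isc] \<tau>T \<sigma>\<tau>] by blast
  have sc: "cball yp s \<subseteq> cimage c" using sS0 unfolding S0eq by blast
  obtain C where C: "C \<ge> 0" and nhC: "\<And>u z. harmonic M u \<Longrightarrow> z \<in> unit_disc \<inter> u -` cdom c \<Longrightarrow>
      cmap c (u z) \<in> cball yp s \<Longrightarrow> nearly_harmonic C (cmap c \<circ> u) z"
    using nearly_harmonic_in_chart[OF R c(1) compact_cball sc] by blast
  have harm: "harmonic M u" and su: "smooth_map M unit_disc u"
    using assms(4) unfolding conformal_harmonic_immersed_disc_def conformal_def by auto
  have cu: "continuous_on unit_disc u" by (rule smooth_map_continuous[OF su])
  define y where "y = cmap c \<circ> u"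
  define w where "w = (\<lambda>z. real_of_ereal (\<rho> (u z)))"
  have \<rho>w: "\<rho> (u z) = ereal (w z)" "w z \<ge> 0" if "z \<in> unit_disc" for z
  proof -
    have "\<rho> (u z) \<noteq> \<infinity>" "\<rho> (u z) \<ge> 0" using assms(3,5) that unfolding MPSH_def by auto
    then show "\<rho> (u z) = ereal (w z)" "w z \<ge> 0" unfolding w_def by (cases "\<rho> (u z)"; simp)+
  qed
  have subh: "subharmonic_on unit_disc (\<rho> \<circ> u)" using assms(3,4) unfolding MPSH_def by blast
  have uscw: "usc_real unit_disc w"
    by (rule subharmonic_on_usc_real[OF subh open_ball]) (simp add: \<rho>w)
  have wint: "\<forall>\<^sub>F r in at_right 0. circle_integrable w z r" if z: "z \<in> unit_disc" for z
  proof -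
    obtain d where d: "d > 0" "ball z d \<subseteq> unit_disc" by (rule openE[OF open_ball z])
    show ?thesis
      using eventually_at_right_0_less[OF d(1)]
    proof eventually_elim
      case (elim r)
      have sp: "sphere z r \<subseteq> unit_disc" using elim d by force
      show ?case by (rule usc_real_circle_integrable[OF usc_real_subset[OF uscw sp], of 0]) (use elim \<rho>w sp in auto)
    qed
  qed
  have asubw: "almost_submean w z" if "z \<in> unit_disc" for z
    by (rule MPSH_almost_submean[OF R assms(4,3) that UNIV_I \<rho>w(1) wint[OF that]])
  \<comment> \<open>on the ball of radius \<open>s'\<close> the slopes of \<open>\<bar>\<tau>\<bar>\<^sup>2\<close> are so small that they use up at most half of the square term \<open>c0\<close>\<close>
  define s' where "s' = min s (c0 / (2 * (C * L + 1)))"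
  have CL: "C * L \<ge> 0" using C L by simp
  then have CL1: "C * L + 1 > 0" by linarith
  have s': "0 < s'" "s' \<le> s" "C * (L * s') \<le> c0 / 2"
  proof -
    show "0 < s'" "s' \<le> s" unfolding s'_def using s c0 CL1 by auto
    have "(C * L + 1) * s' \<le> (C * L + 1) * (c0 / (2 * (C * L + 1)))"
      unfolding s'_def using CL1 by (intro mult_left_mono) auto
    also have "\<dots> = c0 / 2"
    proof -
      have "k * (c0 / (2 * k)) = c0 / 2" if "k > 0" for k :: real using that by simp
      from this[OF CL1] show ?thesis .
    qed
    finally show "C * (L * s') \<le> c0 / 2" using \<open>0 < s'\<close> by (simp add: algebra_simps)
  qed
  define G where "G = unit_disc \<inter> u -` cdom c \<inter> y -` ball yp s'"
  have o\<Omega>: "open (unit_disc \<inter> u -` cdom c)" by (rule open_chart_preimage[OF R c(1) open_ball su])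
  have cy\<Omega>: "continuous_on (unit_disc \<inter> u -` cdom c) y"
    unfolding y_def by (rule smooth_on_imp_continuous_on[OF smooth_map_chart[OF su c(1)]])
  have oG: "open G" unfolding G_def by (rule continuous_open_preimage[OF cy\<Omega> o\<Omega> open_ball])
  have cyG: "continuous_on G y" by (rule continuous_on_subset[OF cy\<Omega>]) (auto simp: G_def)
  have Gd: "z \<in> unit_disc" "u z \<in> cdom c" "y z \<in> ball yp s'" "y z \<in> cball yp s" "y z \<in> S0" "u z = cinv c (y z)" "u z \<in> W"
    if "z \<in> G" for z
  proof -
    show 1: "z \<in> unit_disc" "u z \<in> cdom c" "y z \<in> ball yp s'" using that unfolding G_def by auto
    then show 2: "y z \<in> cball yp s" using s' by auto
    then show 3: "y z \<in> S0" using sS0 by blast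
    show 4: "u z = cinv c (y z)" unfolding y_def using chc(5)[OF 1(2)] by simp
    show "u z \<in> W" using 3 4 unfolding S0eq by simp
  qed
  define f where "f = (\<lambda>z. (norm (cmap x (u z)))\<^sup>2)"
  have f\<tau>: "f z = (norm (\<tau> (y z)))\<^sup>2" if "z \<in> G" for z
    unfolding f_def y_def using \<tau>[OF Gd(2)[OF that]] by simp
  have cf: "continuous_on G f"
  proof -
    have "continuous_on G (\<lambda>z. (norm (\<tau> (y z)))\<^sup>2)"
      by (intro continuous_intros continuous_on_compose2[OF smooth_on_imp_continuous_on[OF s\<tau>] cyG])
         (use Gd(5) in blast)
    then show ?thesis using f\<tau> continuous_on_cong[of G G f] by simp
  qed
  have strict: "almost_submean (\<lambda>z. w z - e * f z) z" if z: "z \<in> G" for z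
  proof (rule MPSH_almost_submean[OF R assms(4) mp Gd(1)[OF z] Gd(7)[OF z]])
    fix b assume "b \<in> unit_disc"
    then show "\<rho> (u b) - ereal (e * (norm (cmap x (u b)))\<^sup>2) = ereal (w b - e * f b)"
      using \<rho>w(1) by (simp add: f_def)
  next
    obtain d where d: "d > 0" "ball z d \<subseteq> G" using oG z open_contains_ball by blast
    show "\<forall>\<^sub>F r in at_right 0. circle_integrable (\<lambda>z. w z - e * f z) z r"
      using wint[OF Gd(1)[OF z]] eventually_at_right_0_less[OF d(1)]
    proof eventually_elim
      case (elim r)
      have "sphere z r \<subseteq> G" using d elim by force
      then have "circle_integrable f z r" using elim by (intro circle_integrable_continuous continuous_on_subset[OF cf]) auto
      from circle_integrable_add[OF elim(1) circle_integrable_scale[OF this, of "- e"]] show ?case by simp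
    qed
  qed
  have nhG: "nearly_harmonic C y z" if z: "z \<in> G" for z
    unfolding y_def
  proof (rule nhC[OF harm])
    show "z \<in> unit_disc \<inter> u -` cdom c" using Gd(1,2)[OF z] by simp
    show "cmap c (u z) \<in> cball yp s" using Gd(4)[OF z] by (simp add: y_def)
  qed
  \<comment> \<open>\<open>A\<close> depends only on the bounds \<open>\<Lambda>\<close> and \<open>\<kappa>\<close> for the slope and the curvature of \<open>\<beta>\<close>, neither on \<open>\<beta>\<close> nor on the point\<close>
  have key: "\<exists>A\<ge>0. \<forall>z\<in>G. \<forall>\<beta>. continuous_on G \<beta> \<longrightarrow>
      (\<exists>l. norm l \<le> \<Lambda> \<and> (\<forall>b\<in>G. \<beta> b \<le> \<beta> z + l \<bullet> (y b - y z) + \<kappa> * (norm (y b - y z))\<^sup>2)) \<longrightarrow>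
      almost_submean (\<lambda>z. A * w z - \<beta> z) z" if \<kappa>\<Lambda>: "\<kappa> \<ge> 0" "\<Lambda> \<ge> 0" for \<kappa> \<Lambda>
  proof (intro exI[of _ "2 * (\<kappa> + C * \<Lambda>) / (e * c0)"] conjI ballI allI impI)
    show A0: "0 \<le> 2 * (\<kappa> + C * \<Lambda>) / (e * c0)" using \<kappa>\<Lambda> C e c0 by simp
    fix z \<beta> assume z: "z \<in> G" and \<beta>: "continuous_on G \<beta>"
      and "\<exists>l. norm l \<le> \<Lambda> \<and> (\<forall>b\<in>G. \<beta> b \<le> \<beta> z + l \<bullet> (y b - y z) + \<kappa> * (norm (y b - y z))\<^sup>2)"
    then obtain l where l: "norm l \<le> \<Lambda>" "\<And>b. b \<in> G \<Longrightarrow> \<beta> b \<le> \<beta> z + l \<bullet> (y b - y z) + \<kappa> * (norm (y b - y z))\<^sup>2" by blast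
    obtain lf where lf: "norm lf \<le> L * norm (y z - yp)"
      "\<And>b. b \<in> cball yp s \<Longrightarrow> (norm (\<tau> (y z)))\<^sup>2 + lf \<bullet> (b - y z) + c0 * (norm (b - y z))\<^sup>2 \<le> (norm (\<tau> b))\<^sup>2"
      using conv[OF Gd(4)[OF z]] by blast
    show "almost_submean (\<lambda>z. 2 * (\<kappa> + C * \<Lambda>) / (e * c0) * w z - \<beta> z) z"
    proof (rule almost_submean_of_strict_domination[OF nhG[OF z] C oG z cyG e strict[OF z] cf _ _ \<beta> l A0])
      have "norm lf \<le> L * s'"
        using lf(1) Gd(3)[OF z] L mult_left_mono[of "norm (y z - yp)" s' L] by (simp add: dist_norm norm_minus_commute)
      then have "C * norm lf \<le> C * (L * s')" using C by (rule mult_left_mono)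
      then show "C * norm lf \<le> c0 / 2" using s'(3) by simp
      show "f z + lf \<bullet> (y b - y z) + c0 * (norm (y b - y z))\<^sup>2 \<le> f b" if "b \<in> G" for b
        using lf(2)[OF Gd(4)[OF that]] f\<tau>[OF z] f\<tau>[OF that] by simp
      show "2 * (\<kappa> + C * \<Lambda>) \<le> 2 * (\<kappa> + C * \<Lambda>) / (e * c0) * e * c0" using e c0 by simp
    qed
  qed
  have anorm: "norm a = 1" by (rule open_arc_neighbourhood(1)[OF assms(6,8)])
  obtain r0 where r0: "r0 > 0" "\<And>c. norm c = 1 \<Longrightarrow> dist c a < r0 \<Longrightarrow> c \<in> \<gamma>"
    using open_arc_neighbourhood(2)[OF assms(6,8)] by blast
  have wlim: "(w \<longlongrightarrow> 0) (at b within unit_disc)" if "b \<in> \<gamma>" for b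
  proof -
    have "((\<lambda>\<zeta>. \<rho> (u \<zeta>)) \<longlongrightarrow> ereal 0) (at b within unit_disc)" using assms(7) that by (simp add: zero_ereal_def)
    moreover have "\<forall>\<^sub>F \<zeta> in at b within unit_disc. \<rho> (u \<zeta>) = ereal (w \<zeta>)"
      unfolding eventually_at_filter by (intro always_eventually) (use \<rho>w(1) in blast)
    ultimately have "((\<lambda>\<zeta>. ereal (w \<zeta>)) \<longlongrightarrow> ereal 0) (at b within unit_disc)"
      by (rule Lim_transform_eventually)
    then show ?thesis by simp
  qed
  have "\<forall>\<^sub>F \<zeta> in at a within unit_disc. w \<zeta> < 1" using wlim[OF assms(8)] by (rule order_tendstoD) simp
  then obtain r1 where r1: "r1 > 0" "\<And>z. z \<in> unit_disc \<Longrightarrow> z \<noteq> a \<Longrightarrow> dist z a < r1 \<Longrightarrow> w z < 1"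
    unfolding eventually_at by blast
  define r where "r = Min {r0, r1, 1}"
  have r: "0 < r" "r \<le> r0" "r \<le> r1" "r \<le> 1" unfolding r_def using r0 r1 by auto
  have a_notin: "z \<noteq> a" if "z \<in> unit_disc" for z using that anorm by auto
  have decay: "w z \<le> (32 / r\<^sup>2) * (1 - norm z)" if "z \<in> unit_disc" "dist z a < r / 4" for z
    by (rule boundary_decay[OF anorm r(1,4) uscw asubw _ _ that])
       (use r r1(2) a_notin r0(2) wlim in \<open>force intro: less_imp_le\<close>)+
  have r2: "32 / r\<^sup>2 \<ge> 0" by simp
  define s2 where "s2 = s' / 2"
  have s2: "0 < s2" "s2 < s'" "s2 \<le> s" using s' unfolding s2_def by auto
  define \<xi> where "\<xi> = (\<lambda>z. if z \<in> G then max 0 (s2\<^sup>2 - (norm (y z - yp))\<^sup>2) else 0)"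
  have \<xi>_bounds: "0 \<le> \<xi> z" "\<xi> z \<le> s2\<^sup>2" for z unfolding \<xi>_def by auto
  \<comment> \<open>\<open>G\<close> and \<open>N\<close> are open and cover the disc: the closed ball of half the radius has compact, hence closed, image in the manifold\<close>
  define N where "N = unit_disc \<inter> u -` (- (cinv c ` cball yp s2))"
  have oN: "open N"
  proof -
    have "continuous_on (cball yp s2) (cinv c)" by (rule continuous_on_subset[OF chc(4)]) (use sc s2 in force)
    then have "compact (cinv c ` cball yp s2)" by (rule compact_continuous_image) simp
    then have "open (- (cinv c ` cball yp s2))" by (simp add: compact_imp_closed open_Compl)
    then show ?thesis unfolding N_def by (rule continuous_open_preimage[OF cu open_ball])
  qed
  have \<xi>N: "\<xi> z = 0" if z: "z \<in> N" for z
  proof (cases "z \<in> G")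
    case True
    have "y z \<notin> cball yp s2" using z Gd(6)[OF True] unfolding N_def by auto
    then have "s2 < norm (y z - yp)" by (simp add: dist_norm norm_minus_commute)
    then have "s2\<^sup>2 \<le> (norm (y z - yp))\<^sup>2" using s2(1) by (intro power_mono) auto
    then show ?thesis by (simp add: \<xi>_def)
  qed (simp add: \<xi>_def)
  have GN: "z \<in> G \<or> z \<in> N" if z: "z \<in> unit_disc" for z
  proof (rule ccontr)
    assume neg: "\<not> (z \<in> G \<or> z \<in> N)"
    then obtain b where b: "b \<in> cball yp s2" "u z = cinv c b" using z unfolding N_def by auto
    have bc: "b \<in> cimage c" using b(1) sc s2(3) by force
    have "u z \<in> cdom c" "y z = b" using b(2) chc(6,7)[OF bc] unfolding y_def by auto
    then have "z \<in> G" using z b(1) s2(2) unfolding G_def by auto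
    then show False using neg by blast
  qed
  have c\<xi>: "continuous_on unit_disc \<xi>"
  proof -
    have "continuous_on G (\<lambda>z. max 0 (s2\<^sup>2 - (norm (y z - yp))\<^sup>2))" by (intro continuous_intros cyG)
    then have "continuous_on G \<xi>" using continuous_on_cong[of G G \<xi>] by (simp add: \<xi>_def)
    moreover have "continuous_on N \<xi>" using continuous_on_cong[of N N \<xi> "\<lambda>z. 0"] \<xi>N by simp
    ultimately have "continuous_on (G \<union> N) \<xi>" by (rule continuous_on_open_Un[OF oG oN])
    then show ?thesis by (rule continuous_on_subset) (use GN in blast)
  qed
  obtain A\<xi> where A\<xi>: "A\<xi> \<ge> 0" "\<And>z \<beta>. z \<in> G \<Longrightarrow> continuous_on G \<beta> \<Longrightarrow>
      \<exists>l. norm l \<le> 4 * s2\<^sup>2 * s' \<and> (\<forall>b\<in>G. \<beta> b \<le> \<beta> z + l \<bullet> (y b - y z) + (2 * s2\<^sup>2 + 16 * s'\<^sup>2) * (norm (y b - y z))\<^sup>2) \<Longrightarrow>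
      almost_submean (\<lambda>z. A\<xi> * w z - \<beta> z) z"
    using key[of "2 * s2\<^sup>2 + 16 * s'\<^sup>2" "4 * s2\<^sup>2 * s'"] s' by auto
  have sub\<xi>: "almost_submean (\<lambda>z. A\<xi> * w z - (norm (\<xi> z - \<xi> z'))\<^sup>2) z" if z: "z \<in> unit_disc" for z z'
    using GN[OF z]
  proof
    assume zG: "z \<in> G"
    show ?thesis
    proof (rule A\<xi>(2)[OF zG])
      show "continuous_on G (\<lambda>z. (norm (\<xi> z - \<xi> z'))\<^sup>2)"
        by (intro continuous_intros continuous_on_subset[OF c\<xi>]) (use Gd(1) in blast)
      have le: "norm (y b - yp) \<le> s'" if "b \<in> G" for b
        using Gd(3)[OF that] by (simp add: dist_norm norm_minus_commute)
      have eq: "(norm (\<xi> b - \<xi> z'))\<^sup>2 = (max 0 (s2\<^sup>2 - (norm (y b - yp))\<^sup>2) - \<xi> z')\<^sup>2" if "b \<in> G" for b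
        using that by (simp add: \<xi>_def)
      show "\<exists>l. norm l \<le> 4 * s2\<^sup>2 * s' \<and> (\<forall>b\<in>G. (norm (\<xi> b - \<xi> z'))\<^sup>2 \<le> (norm (\<xi> z - \<xi> z'))\<^sup>2
          + l \<bullet> (y b - y z) + (2 * s2\<^sup>2 + 16 * s'\<^sup>2) * (norm (y b - y z))\<^sup>2)"
        using truncated_distance_quadratic[OF \<xi>_bounds[of z'] le[OF zG]] s'(1) le eq eq[OF zG] by fastforce
    qed
  next
    assume zN: "z \<in> N"
    have "almost_submean (\<lambda>z. A\<xi> * w z + (- (\<xi> z')\<^sup>2)) z"
      by (intro almost_submean_add almost_submean_scale asubw z A\<xi>(1) almost_submean_const)
    then show ?thesis
      by (rule almost_submean_cong[OF _ oN zN]) (use \<xi>N in simp)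
  qed
  let ?r = "r / 4"
  obtain K\<xi> where K\<xi>: "K\<xi> \<ge> 0" "\<And>z1 z2. z1 \<in> unit_disc \<inter> ball a (?r / 40) \<Longrightarrow> z2 \<in> unit_disc \<inter> ball a (?r / 40) \<Longrightarrow>
      norm (\<xi> z1 - \<xi> z2) \<le> K\<xi> * (sqrt (1 - norm z1) + sqrt (1 - norm z2) + sqrt (dist z1 z2))"
  proof -
    have "\<exists>K\<ge>0. \<forall>z1\<in>unit_disc \<inter> ball a (?r / 40). \<forall>z2\<in>unit_disc \<inter> ball a (?r / 40).
        norm (\<xi> z1 - \<xi> z2) \<le> K * (sqrt (1 - norm z1) + sqrt (1 - norm z2) + sqrt (dist z1 z2))"
      by (rule coarse_holder[OF anorm _ _ A\<xi>(1) r2 uscw _ continuous_on_subset[OF c\<xi>]])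
         (use r decay \<rho>w(2) sub\<xi> in auto)
    then show ?thesis using that by blast
  qed
  have loc: "\<exists>t>0. t \<le> ?r / 40 \<and> unit_disc \<inter> ball a t \<subseteq> G"
  proof -
    \<comment> \<open>the truncation is close to its maximum \<open>s2\<^sup>2\<close> at some point \<open>z0\<close> near \<open>a\<close>, and on the ball of radius \<open>t\<close> it varies by at most \<open>s2\<^sup>2 / 4\<close>; so it does not vanish there\<close>
    define k where "k = s2\<^sup>2 / (16 * (K\<xi> + 1))"
    have k: "k > 0" unfolding k_def using s2 K\<xi>(1) by simp
    define t where "t = min (?r / 40) (k\<^sup>2)"
    have t: "t > 0" "t \<le> ?r / 40" "t \<le> k\<^sup>2" unfolding t_def using r k by auto
    have sqt: "sqrt t \<le> k" using t k by (intro real_le_lsqrt) auto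
    have Kt: "K\<xi> * (4 * sqrt t) \<le> s2\<^sup>2 / 4"
    proof -
      have "K\<xi> * (4 * sqrt t) \<le> (K\<xi> + 1) * (4 * k)" using sqt K\<xi>(1) t by (intro mult_mono) auto
      also have "\<dots> = s2\<^sup>2 / 4" unfolding k_def using K\<xi>(1) by (simp add: field_simps)
      finally show ?thesis .
    qed
    obtain zk where zk: "\<And>k. zk k \<in> unit_disc" "zk \<longlonglongrightarrow> a" "(\<lambda>k. u (zk k)) \<longlonglongrightarrow> p"
      using assms(9) unfolding cluster_set_def by blast
    have "isCont (cmap c) p"
      using chc(1,3) c(2) by (simp add: continuous_on_eq_continuous_at)
    then have "(\<lambda>k. y (zk k)) \<longlonglongrightarrow> yp"
      using isCont_tendsto_compose[OF _ zk(3)] unfolding y_def yp_def by (simp add: o_def)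
    then have "\<forall>\<^sub>F k in sequentially. dist (y (zk k)) yp < s2 / 2" by (rule tendstoD) (use s2(1) in simp)
    moreover have "\<forall>\<^sub>F k in sequentially. u (zk k) \<in> cdom c" using zk(3) chc(1) c(2) by (rule topological_tendstoD)
    moreover have "\<forall>\<^sub>F k in sequentially. dist (zk k) a < t" using zk(2) t(1) by (simp add: tendsto_iff)
    ultimately have "\<forall>\<^sub>F k in sequentially. dist (y (zk k)) yp < s2 / 2 \<and> u (zk k) \<in> cdom c \<and> dist (zk k) a < t"
      by eventually_elim auto
    then obtain n where n: "dist (y (zk n)) yp < s2 / 2" "u (zk n) \<in> cdom c" "dist (zk n) a < t"
      using eventually_happens' trivial_limit_sequentially by blast
    define z0 where "z0 = zk n"
    have z0G: "z0 \<in> G" unfolding G_def z0_def using zk(1) n s2 by (auto simp: dist_commute)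
    have z0t: "z0 \<in> unit_disc \<inter> ball a t" unfolding z0_def using zk(1) n by (auto simp: dist_commute)
    have "(norm (y z0 - yp))\<^sup>2 \<le> (s2 / 2)\<^sup>2"
      using n(1) unfolding z0_def by (intro power_mono) (auto simp: dist_norm)
    then have "s2\<^sup>2 - (norm (y z0 - yp))\<^sup>2 \<ge> 3 / 4 * s2\<^sup>2" by (simp add: power_divide)
    then have \<xi>0: "\<xi> z0 \<ge> 3 / 4 * s2\<^sup>2" using z0G unfolding \<xi>_def by (simp add: le_max_iff_disj)
    have "z \<in> G" if z: "z \<in> unit_disc \<inter> ball a t" for z
    proof -
      have sq: "sqrt (1 - norm b) \<le> sqrt t" if "b \<in> unit_disc \<inter> ball a t" for b
        using that anorm norm_triangle_ineq2[of a b] by (intro real_sqrt_le_mono) (auto simp: dist_norm)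
      have "dist z z0 \<le> 2\<^sup>2 * t" using dist_triangle2[of z z0 a] z z0t t(1) by (auto simp: dist_commute)
      then have "sqrt (dist z z0) \<le> sqrt (2\<^sup>2 * t)" by (rule real_sqrt_le_mono)
      then have sd: "sqrt (dist z z0) \<le> 2 * sqrt t" by (simp add: real_sqrt_mult)
      have "norm (\<xi> z - \<xi> z0) \<le> K\<xi> * (sqrt (1 - norm z) + sqrt (1 - norm z0) + sqrt (dist z z0))"
        by (rule K\<xi>(2)) (use z z0t t in auto)
      also have "\<dots> \<le> K\<xi> * (4 * sqrt t)"
      proof (rule mult_left_mono[OF _ K\<xi>(1)])
        show "sqrt (1 - norm z) + sqrt (1 - norm z0) + sqrt (dist z z0) \<le> 4 * sqrt t"
          using sq[OF z] sq[OF z0t] sd by linarith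
      qed
      also have "\<dots> \<le> s2\<^sup>2 / 4" by (rule Kt)
      finally have "\<bar>\<xi> z - \<xi> z0\<bar> \<le> s2\<^sup>2 / 4" by simp
      moreover have "s2\<^sup>2 > 0" using s2 by simp
      ultimately have "\<xi> z > 0" using \<xi>0 by linarith
      then show ?thesis unfolding \<xi>_def by (auto split: if_splits)
    qed
    then show ?thesis using t by blast
  qed
  then obtain t1 where t1: "t1 > 0" "t1 \<le> ?r / 40" "unit_disc \<inter> ball a t1 \<subseteq> G" by blast
  obtain Ay where Ay: "Ay \<ge> 0" "\<And>z \<beta>. z \<in> G \<Longrightarrow> continuous_on G \<beta> \<Longrightarrow>
      \<exists>l. norm l \<le> 4 * s' \<and> (\<forall>b\<in>G. \<beta> b \<le> \<beta> z + l \<bullet> (y b - y z) + 1 * (norm (y b - y z))\<^sup>2) \<Longrightarrow>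
      almost_submean (\<lambda>z. Ay * w z - \<beta> z) z"
    using key[of 1 "4 * s'"] s' by auto
  have suby: "almost_submean (\<lambda>z. Ay * w z - (norm (y z - y z'))\<^sup>2) z" if z: "z \<in> G" "z' \<in> G" for z z'
  proof (rule Ay(2)[OF z(1)])
    show "continuous_on G (\<lambda>z. (norm (y z - y z'))\<^sup>2)" by (intro continuous_intros cyG)
    have "norm (y z - y z') \<le> 2 * s'"
      using dist_triangle2[of "y z" "y z'" yp] Gd(3)[OF z(1)] Gd(3)[OF z(2)] by (simp add: dist_norm norm_minus_commute)
    then have "norm (2 *\<^sub>R (y z - y z')) \<le> 4 * s'" by simp
    moreover have "(norm (y b - y z'))\<^sup>2 \<le> (norm (y z - y z'))\<^sup>2
        + (2 *\<^sub>R (y z - y z')) \<bullet> (y b - y z) + 1 * (norm (y b - y z))\<^sup>2" for b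
      unfolding mult_1 by (rule eq_refl[OF norm_sq_expand])
    ultimately show "\<exists>l. norm l \<le> 4 * s' \<and> (\<forall>b\<in>G. (norm (y b - y z'))\<^sup>2 \<le> (norm (y z - y z'))\<^sup>2
        + l \<bullet> (y b - y z) + 1 * (norm (y b - y z))\<^sup>2)"
      by blast
  qed
  have "\<exists>K\<ge>0. \<forall>z1\<in>unit_disc \<inter> ball a (t1 / 40). \<forall>z2\<in>unit_disc \<inter> ball a (t1 / 40).
      norm (y z1 - y z2) \<le> K * (sqrt (1 - norm z1) + sqrt (1 - norm z2) + sqrt (dist z1 z2))"
    by (rule coarse_holder[OF anorm t1(1) _ Ay(1) r2 uscw _ continuous_on_subset[OF cyG t1(3)]
          suby[OF subsetD[OF t1(3)] subsetD[OF t1(3)]]])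
       (use r t1 decay \<rho>w(2) in auto)
  then obtain Ky where Ky: "Ky \<ge> 0" "\<And>z1 z2. z1 \<in> unit_disc \<inter> ball a (t1 / 40) \<Longrightarrow> z2 \<in> unit_disc \<inter> ball a (t1 / 40) \<Longrightarrow>
      norm (y z1 - y z2) \<le> Ky * (sqrt (1 - norm z1) + sqrt (1 - norm z2) + sqrt (dist z1 z2))" by blast
  have subG: "unit_disc \<inter> ball a (t1 / 40) \<subseteq> G" using t1 by force
  have "\<exists>t>0. t \<le> t1 / 40 \<and> (\<exists>H\<ge>0. \<forall>z1\<in>unit_disc \<inter> ball a t. \<forall>z2\<in>unit_disc \<inter> ball a t.
      norm (y z1 - y z2) \<le> H * sqrt (dist z1 z2))"
    by (rule fine_holder[OF anorm _ Ky(1) C Ky(2) continuous_on_subset[OF cyG subG]])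
       (use t1 nhG subG in auto)
  then obtain t H where t: "t > 0" "t \<le> t1 / 40" and H: "H \<ge> 0"
    and hol: "\<And>z1 z2. z1 \<in> unit_disc \<inter> ball a t \<Longrightarrow> z2 \<in> unit_disc \<inter> ball a t \<Longrightarrow>
      norm (y z1 - y z2) \<le> H * sqrt (dist z1 z2)" by blast
  let ?X = "unit_disc \<inter> ball a t"
  have XG: "?X \<subseteq> G" using subG t by force
  have "uniformly_continuous_on ?X y"
    unfolding uniformly_continuous_on_def
  proof (intro allI impI)
    fix \<epsilon> :: real assume \<epsilon>: "\<epsilon> > 0"
    have H1: "H + 1 > 0" using H by simp
    show "\<exists>d>0. \<forall>z\<in>?X. \<forall>z'\<in>?X. dist z' z < d \<longrightarrow> dist (y z') (y z) < \<epsilon>"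
    proof (intro exI[of _ "(\<epsilon> / (H + 1))\<^sup>2"] conjI ballI impI)
      show "(\<epsilon> / (H + 1))\<^sup>2 > 0" using \<epsilon> H1 by simp
      fix z z' assume z: "z \<in> ?X" "z' \<in> ?X" and d: "dist z' z < (\<epsilon> / (H + 1))\<^sup>2"
      have "sqrt (dist z' z) < \<epsilon> / (H + 1)" using d \<epsilon> H1 by (intro real_less_lsqrt) auto
      then have "(H + 1) * sqrt (dist z' z) < \<epsilon>" using H1 by (simp add: field_simps)
      moreover have "H * sqrt (dist z' z) \<le> (H + 1) * sqrt (dist z' z)" by (intro mult_right_mono) auto
      ultimately show "dist (y z') (y z) < \<epsilon>" using hol[OF z(2,1)] by (simp add: dist_norm)
    qed
  qed
  then obtain Y where Y: "uniformly_continuous_on (closure ?X) Y" "\<And>z. z \<in> ?X \<Longrightarrow> y z = Y z"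
    using uniformly_continuous_on_extension_on_closure by metis
  have cY: "continuous_on (closure ?X) Y" by (rule uniformly_continuous_imp_continuous[OF Y(1)])
  have holY: "norm (Y z1 - Y z2) \<le> H * sqrt (dist z1 z2)" if z: "z1 \<in> closure ?X" "z2 \<in> closure ?X" for z1 z2
  proof -
    have "norm (Y (fst (z1, z2)) - Y (snd (z1, z2))) - H * sqrt (dist (fst (z1, z2)) (snd (z1, z2))) \<le> 0"
    proof (rule continuous_le_on_closure[of "?X \<times> ?X" "\<lambda>q. norm (Y (fst q) - Y (snd q)) - H * sqrt (dist (fst q) (snd q))" "(z1, z2)" 0])
      show "continuous_on (closure (?X \<times> ?X)) (\<lambda>q. norm (Y (fst q) - Y (snd q)) - H * sqrt (dist (fst q) (snd q)))"
        by (intro continuous_intros continuous_on_compose2[OF cY]) (auto simp: closure_Times)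
      show "(z1, z2) \<in> closure (?X \<times> ?X)" using z by (simp add: closure_Times)
      show "norm (Y (fst q) - Y (snd q)) - H * sqrt (dist (fst q) (snd q)) \<le> 0" if "q \<in> ?X \<times> ?X" for q
        using hol[of "fst q" "snd q"] Y(2) that by (cases q) auto
    qed
    then show ?thesis by simp
  qed
  have Ys: "Y z \<in> cball yp s" if z: "z \<in> closure ?X" for z
  proof -
    have "Y ` closure ?X \<subseteq> cball yp s"
      by (rule image_closure_subset[OF cY closed_cball]) (use Y(2) Gd(4) XG in force)
    then show ?thesis using z by blast
  qed
  obtain B where B: "B \<ge> 0" "\<And>b b'. b \<in> cball yp s \<Longrightarrow> b' \<in> cball yp s \<Longrightarrow>
      rdist M (cinv c b) (cinv c b') \<le> ennreal (B * norm (b - b'))"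
    using rdist_le_chart_dist[OF R c(1) sc] by blast
  \<comment> \<open>both branches agree near \<open>a\<close>, where \<open>u\<close> stays in the chart\<close>
  define U where "U = (\<lambda>\<zeta>. if \<zeta> \<in> unit_disc then u \<zeta> else cinv c (Y \<zeta>))"
  have \<gamma>1: "norm b = 1" if "b \<in> \<gamma>" for b using assms(6) that unfolding open_arc_def by auto
  have incl: "\<zeta> \<in> closure ?X" "U \<zeta> = cinv c (Y \<zeta>)" if \<zeta>: "\<zeta> \<in> ball a t \<inter> (unit_disc \<union> \<gamma>)" for \<zeta>
  proof -
    have "\<zeta> \<in> ball a t \<inter> closure unit_disc" using \<zeta> \<gamma>1 by auto
    then have "\<zeta> \<in> closure (ball a t \<inter> unit_disc)" using open_Int_closure_subset[OF open_ball] by blast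
    then show "\<zeta> \<in> closure ?X" by (simp add: Int_commute)
    show "U \<zeta> = cinv c (Y \<zeta>)"
    proof (cases "\<zeta> \<in> unit_disc")
      case True
      then have X: "\<zeta> \<in> ?X" using \<zeta> by simp
      then show ?thesis using True Gd(6)[of \<zeta>] XG Y(2)[OF X] unfolding U_def by auto
    qed (simp add: U_def)
  qed
  have "holder_continuous_on M (1/2) (ball a t \<inter> (unit_disc \<union> \<gamma>)) U"
    unfolding holder_continuous_on_def
  proof (intro exI[of _ "B * H"] conjI ballI)
    show "0 \<le> B * H" using B H by simp
    fix z1 z2 assume z: "z1 \<in> ball a t \<inter> (unit_disc \<union> \<gamma>)" "z2 \<in> ball a t \<inter> (unit_disc \<union> \<gamma>)"
    have "rdist M (U z1) (U z2) \<le> ennreal (B * norm (Y z1 - Y z2))"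
      unfolding incl(2)[OF z(1)] incl(2)[OF z(2)] by (intro B(2) Ys incl(1) z)
    also have "\<dots> \<le> ennreal (B * (H * sqrt (dist z1 z2)))"
      by (intro ennreal_leI mult_left_mono holY incl(1) z B(1))
    finally show "rdist M (U z1) (U z2) \<le> ennreal (B * H * dist z1 z2 powr (1/2))"
      by (simp add: powr_half_sqrt mult.assoc)
  qed
  then show ?thesis using t(1) by (intro exI[of _ "ball a t"] exI[of _ U]) (auto simp: U_def)
qed

end
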